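(* Let $N\ge 1$. (1) Let $K$ be a field of odd characteristic $p$. Then $$\mathrm{Ann}(D_N)=Q_N+\bigl(F_U : U\subseteq[N],\ |U|=2p-2\bigr).$$ The classes of the elements $F_U$ ($U\subseteq[N]$, $|U|=2p-2$) form a $K$-basis of the degree-$(p-1)$ component $(\mathrm{Ann}(D_N)/Q_N)_{p-1}$ and minimally generate $\mathrm{Ann}(D_N)/Q_N$ as an $S$-module. In particular, there are exactly $\binom{N}{2p-2}$ additional generators modulo $Q_N$. If $p\ge 5$, the ideal $\mathrm{Ann}(D_N)$ is generated by quadrics (homogeneous elements of degree $2$) if and only if $N<2p-2$; and its only possible minimal generator degrees are $2$ and $p-1$. If $p=3$, the entire ideal $\mathrm{Ann}(D_N)$ is generated by quadrics. (2) If $K$ is a field of characteristic zero, then $\mathrm{Ann}(D_N)=Q_N$.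
   Context: $[N]=\{1,\dots,N\}$. $X=(x_{ij})_{1\le i,j\le N}$ is the generic symmetric matrix: $x_{ji}=x_{ij}$ and the $x_{ij}$, $i\le j$, are algebraically independent over the field $K$. $R=K[x_{ij}:1\le i\le j\le N]$, $S=K[d_{ij}:1\le i\le j\le N]$ (standard graded, each $d_{ij}$ of degree $1$), $d_{ji}:=d_{ij}$, and $D_N=\det X\in R$. The variable $d_{ij}$ acts on $R$ as the ordinary partial derivative $\partial/\partial x_{ij}$ ($i\le j$); for $f\in S$, $f(\partial)$ denotes the resulting differential operator. $\mathrm{Ann}(D_N)=\{f\in S: f(\partial)D_N=0\}$. $Q_N\subset S$ is the ideal generated by: $d_{ii}^2$; $d_{ii}d_{ij}$ ($i\ne j$); $d_{ij}^2+2d_{ii}d_{jj}$ ($i\neq j$); $d_{ij}d_{ik}+d_{ii}d_{jk}$ ($i,j,k$ distinct); $d_{ij}d_{kl}+d_{ik}d_{jl}+d_{il}d_{jk}$ ($i,j,k,l$ distinct). For $K$ of odd characteristic $p$, put $m=p-1$; for $U=\{u_1<\cdots<u_{2m}\}\subseteq[N]$ set $F_U=\det\bigl(d_{u_i,u_{m+j}}\bigr)_{1\le i,j\le m}\in S$. Binomial coefficients $\binom{a}{b}$ are $0$ when $b<0$ or $b>a$ ($a\ge 0$). *)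

theory Defs
  imports
    "HOL-Library.Poly_Mapping"
    "HOL-Algebra.QuotRing"
    "HOL-Algebra.Module"
    "Jordan_Normal_Form.Determinant"
begin

section \<open>Polynomials in the entries of a symmetric matrix\<close>

text \<open>
  Polynomials over \<open>'k\<close> in variables indexed by pairs of natural numbers: a polynomial
  is a finitely supported map from exponent vectors to coefficients.
\<close>

type_synonym expo = "(nat \<times> nat) \<Rightarrow>\<^sub>0 nat"
type_synonym 'k spoly = "expo \<Rightarrow>\<^sub>0 'k"

definition const :: "'k::comm_ring_1 \<Rightarrow> 'k spoly" where
  "const c = Poly_Mapping.single 0 c"

text \<open>
  \<open>symvar i j\<close> is the variable with index \<open>(min i j, max i j)\<close>, so \<open>symvar i j = symvar j i\<close>.
  The rings \<open>R = K[x\<^sub>i\<^sub>j]\<close> and \<open>S = K[d\<^sub>i\<^sub>j]\<close> are two copies of the same polynomial ring;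
  \<open>symvar i j\<close> stands both for \<open>x\<^sub>i\<^sub>j \<in> R\<close> and for \<open>d\<^sub>i\<^sub>j \<in> S\<close>.
\<close>

definition symvar :: "nat \<Rightarrow> nat \<Rightarrow> 'k::comm_ring_1 spoly" where
  "symvar i j = Poly_Mapping.single (Poly_Mapping.single (min i j, max i j) 1) 1"

definition indices :: "nat \<Rightarrow> (nat \<times> nat) set" where
  "indices N = {(i, j). 1 \<le> i \<and> i \<le> j \<and> j \<le> N}"

definition sym_poly_ring :: "nat \<Rightarrow> ('k::comm_ring_1 spoly) ring" where
  "sym_poly_ring N =
     \<lparr>carrier = {f. \<forall>s\<in>Poly_Mapping.keys f. Poly_Mapping.keys s \<subseteq> indices N},
      monoid.mult = (*), one = 1, zero = 0, add = (+)\<rparr>"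

definition expo_degree :: "expo \<Rightarrow> nat" where
  "expo_degree s = (\<Sum>v\<in>Poly_Mapping.keys s. Poly_Mapping.lookup s v)"

text \<open>The zero polynomial is homogeneous of every degree.\<close>

definition homogeneous :: "nat \<Rightarrow> 'k::comm_ring_1 spoly \<Rightarrow> bool" where
  "homogeneous d f \<longleftrightarrow> (\<forall>s\<in>Poly_Mapping.keys f. expo_degree s = d)"

text \<open>Matrices are 0-indexed, the variables 1-indexed.\<close>

definition generic_sym_mat :: "nat \<Rightarrow> 'k::comm_ring_1 spoly mat" where
  "generic_sym_mat N = mat N N (\<lambda>(i, j). symvar (i + 1) (j + 1))"

definition sym_det :: "nat \<Rightarrow> 'k::comm_ring_1 spoly" where
  "sym_det N = det (generic_sym_mat N)"


section \<open>Differential operators and the annihilator\<close>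

definition partial_deriv :: "nat \<times> nat \<Rightarrow> 'k::comm_ring_1 spoly \<Rightarrow> 'k spoly" where
  "partial_deriv v h =
     (\<Sum>t\<in>Poly_Mapping.keys h.
        Poly_Mapping.single (t - Poly_Mapping.single v 1)
          (of_nat (Poly_Mapping.lookup t v) * Poly_Mapping.lookup h t))"

text \<open>
  \<open>monom_deriv s\<close> is the composition of the operators \<open>(\<partial>/\<partial>x\<^sub>v)\<^bsup>s v\<^esup>\<close> over the variables \<open>v\<close>
  occurring in \<open>s\<close>; partial derivatives commute, so the order of the fold is immaterial.
\<close>

definition monom_deriv :: "expo \<Rightarrow> 'k::comm_ring_1 spoly \<Rightarrow> 'k spoly" where
  "monom_deriv s h =
     Finite_Set.fold (\<lambda>v. partial_deriv v ^^ Poly_Mapping.lookup s v) h (Poly_Mapping.keys s)"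

definition diff_op :: "'k::comm_ring_1 spoly \<Rightarrow> 'k spoly \<Rightarrow> 'k spoly" where
  "diff_op f h =
     (\<Sum>s\<in>Poly_Mapping.keys f. const (Poly_Mapping.lookup f s) * monom_deriv s h)"

definition Ann :: "nat \<Rightarrow> 'k::comm_ring_1 spoly set" where
  "Ann N = {f \<in> carrier (sym_poly_ring N). diff_op f (sym_det N) = 0}"


section \<open>The ideal \<open>Q\<^sub>N\<close> and the minors \<open>F\<^sub>U\<close>\<close>

definition Q_gens :: "nat \<Rightarrow> 'k::comm_ring_1 spoly set" where
  "Q_gens N =
     {(symvar i i)\<^sup>2 | i. i \<in> {1..N}} \<union>
     {symvar i i * symvar i j | i j. {i, j} \<subseteq> {1..N} \<and> i \<noteq> j} \<union>
     {(symvar i j)\<^sup>2 + 2 * symvar i i * symvar j j | i j. {i, j} \<subseteq> {1..N} \<and> i \<noteq> j} \<union>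
     {symvar i j * symvar i k + symvar i i * symvar j k | i j k.
        {i, j, k} \<subseteq> {1..N} \<and> distinct [i, j, k]} \<union>
     {symvar i j * symvar k l + symvar i k * symvar j l + symvar i l * symvar j k | i j k l.
        {i, j, k, l} \<subseteq> {1..N} \<and> distinct [i, j, k, l]}"

definition Q_ideal :: "nat \<Rightarrow> 'k::comm_ring_1 spoly set" where
  "Q_ideal N = genideal (sym_poly_ring N) (Q_gens N)"

text \<open>With \<open>m = p - 1\<close> and \<open>u\<^sub>1 < \<dots> < u\<^sub>2\<^sub>m\<close> the elements of \<open>U\<close>; the list indices below start at 0.\<close>

definition F_minor :: "nat \<Rightarrow> nat set \<Rightarrow> 'k::comm_ring_1 spoly" where
  "F_minor p U = (let m = p - 1; u = sorted_list_of_set U in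
     det (mat m m (\<lambda>(i, j). symvar (u ! i) (u ! (m + j)))))"

definition F_index :: "nat \<Rightarrow> nat \<Rightarrow> nat set set" where
  "F_index N p = {U. U \<subseteq> {1..N} \<and> card U = 2 * p - 2}"


section \<open>Generators of ideals and modules\<close>

definition generated_by_quadrics :: "nat \<Rightarrow> 'k::comm_ring_1 spoly set \<Rightarrow> bool" where
  "generated_by_quadrics N I \<longleftrightarrow>
     (\<exists>G \<subseteq> {f \<in> carrier (sym_poly_ring N). homogeneous 2 f}.
        I = genideal (sym_poly_ring N) G)"

definition minimal_homogeneous_ideal_gens ::
    "nat \<Rightarrow> 'k::comm_ring_1 spoly set \<Rightarrow> 'k spoly set \<Rightarrow> bool" where
  "minimal_homogeneous_ideal_gens N I G \<longleftrightarrow>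
     G \<subseteq> {f \<in> carrier (sym_poly_ring N). \<exists>d. homogeneous d f} \<and>
     genideal (sym_poly_ring N) G = I \<and>
     (\<forall>H. H \<subset> G \<longrightarrow> genideal (sym_poly_ring N) H \<noteq> I)"

text \<open>
  The \<open>R\<close>-module \<open>I/J\<close> for ideals \<open>J \<subseteq> I\<close> of \<open>R\<close>, with cosets of \<open>J\<close> as elements. The fields
  \<open>mult\<close> and \<open>one\<close> (those of \<open>R/J\<close>) only fill the record type and play no role for a module.
\<close>

definition quot_module ::
    "('a, 'b) ring_scheme \<Rightarrow> 'a set \<Rightarrow> 'a set \<Rightarrow> ('a, 'a set) module" where
  "quot_module R I J =
     \<lparr>carrier = a_r_coset R J ` I, monoid.mult = rcoset_mult R J, one = a_r_coset R J \<one>\<^bsub>R\<^esub>,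
      zero = J, add = set_add R, module.smult = (\<lambda>r A. rcoset_mult R J (a_r_coset R J r) A)\<rparr>"

definition generated_submodule ::
    "('a, 'b) ring_scheme \<Rightarrow> ('a, 'c, 'd) module_scheme \<Rightarrow> 'c set \<Rightarrow> 'c set" where
  "generated_submodule R M G = \<Inter>{H. submodule H R M \<and> G \<subseteq> H}"

definition minimally_generates ::
    "('a, 'b) ring_scheme \<Rightarrow> ('a, 'c, 'd) module_scheme \<Rightarrow> 'c set \<Rightarrow> bool" where
  "minimally_generates R M G \<longleftrightarrow>
     G \<subseteq> carrier M \<and> generated_submodule R M G = carrier M \<and>
     (\<forall>H. H \<subset> G \<longrightarrow> generated_submodule R M H \<noteq> carrier M)"

text \<open>
  The family \<open>(b i)\<^sub>i\<^sub>\<in>\<^sub>I\<close>, \<open>I\<close> finite, is a \<open>K\<close>-basis of the \<open>K\<close>-subspace \<open>V\<close> of the \<open>S\<close>-module \<open>M\<close>,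
  where \<open>K\<close> acts through \<open>const\<close>.
\<close>

definition K_basis_family ::
    "('k::comm_ring_1 spoly, 'c, 'd) module_scheme \<Rightarrow> 'c set \<Rightarrow> 'i set \<Rightarrow> ('i \<Rightarrow> 'c) \<Rightarrow> bool" where
  "K_basis_family M V I b \<longleftrightarrow>
     finite I \<and> b ` I \<subseteq> V \<and>
     (\<forall>c. (\<Oplus>\<^bsub>M\<^esub>i\<in>I. const (c i) \<odot>\<^bsub>M\<^esub> b i) = \<zero>\<^bsub>M\<^esub> \<longrightarrow> (\<forall>i\<in>I. c i = 0)) \<and>
     (\<forall>x\<in>V. \<exists>c. x = (\<Oplus>\<^bsub>M\<^esub>i\<in>I. const (c i) \<odot>\<^bsub>M\<^esub> b i))"

definition Q_class :: "nat \<Rightarrow> 'k::comm_ring_1 spoly \<Rightarrow> 'k spoly set" where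
  "Q_class N f = a_r_coset (sym_poly_ring N) (Q_ideal N) f"

definition Ann_mod_Q :: "nat \<Rightarrow> ('k::comm_ring_1 spoly, 'k spoly set) module" where
  "Ann_mod_Q N = quot_module (sym_poly_ring N) (Ann N) (Q_ideal N)"

definition Ann_mod_Q_component :: "nat \<Rightarrow> nat \<Rightarrow> 'k::comm_ring_1 spoly set set" where
  "Ann_mod_Q_component N d = Q_class N ` {f \<in> Ann N. homogeneous d f}"

end

theory Submission
  imports Defs
begin

text \<open>Where m + 1 comes from: modulo \<open>Q\<close>, the sum of the transpositions (a j)
  multiplies a matching of 2m indices by 2 - m, since the partner of a contributes 1 and each of the
  other m - 1 arcs contributes -1 by the four-index relation. On an antisymmetric element the same
  sum is -(2m - 1), and the two values differ by m + 1. If p divides m + 1, then p - 1 \<le> 2m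
  indices are available, and p - 1 is the largest number of indices for which the order of the
  symmetric group is still invertible. The annihilator is reached through weights: every monomial of
  \<open>D_N\<close> has weight 2 at every index, so an element of \<open>Ann\<close> may be taken
  homogeneous for this multigrading. It is then, modulo \<open>Q\<close>, a product of diagonal
  variables and a matching, and multiplication by the missing \<open>d_ii\<close> turns the
  condition into one on the matching alone. Ordinary derivatives lose information in characteristic
  p. Coefficients are read off through them only for monomials with exponents at most 2, where it is
  enough that 2 is invertible.\<close>

text \<open>
  In \<open>S/Q\<close> every monomial is a combination of products of some \<open>d\<^sub>i\<^sub>i\<close> with perfect matchings of a
  disjoint set of indices, and multiplication by \<open>d\<^sub>i\<^sub>j\<close> contracts a matching along \<open>i, j\<close>. So \<open>Ann/Q\<close> is
  governed by the radicals of the matching form in which a loop has the value \<open>-2\<close> (the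
  Temperley--Lieb category at \<open>q = 1\<close> with a sign twist). An element of the radical becomes
  antisymmetric modulo contractions; a Jucys--Murphy element then acts on it by \<open>m + 1\<close>, where \<open>2m\<close>
  is the number of indices. This kills the radical in characteristic \<open>0\<close> and for \<open>m < p - 1\<close>, while for
  \<open>m \<ge> p - 1\<close> antisymmetrising over \<open>p - 1\<close> indices exhibits the element as a combination of
  multiples of the \<open>F\<^sub>U\<close>, which play the role of the Jones--Wenzl projectors. Conversely \<open>F\<^sub>U\<close>
  annihilates \<open>D\<^sub>N\<close> since contracting it produces the factor \<open>p\<close>, and it is not in \<open>Q\<close> since \<open>Q\<close>
  annihilates all minors of \<open>X\<close>, including \<open>F\<^sub>U\<close> itself, whereas \<open>F\<^sub>U(\<partial>) F\<^sub>U = (p - 1)!\<close>.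
\<close>

abbreviation "lookup \<equiv> Poly_Mapping.lookup"
abbreviation "keys \<equiv> Poly_Mapping.keys"
abbreviation "single \<equiv> Poly_Mapping.single"

subsection \<open>Calculus of differential operators\<close>

lemma poly_mapping_as_sum:
  "f = (\<Sum>s\<in>keys f. single s (lookup f s))"
  by (rule poly_mapping_eqI)
    (auto simp: lookup_sum lookup_single when_def in_keys_iff)

lemma poly_mapping_add_induct [case_names single add]:
  assumes "\<And>s c. P (single s c)" and "\<And>f g. P f \<Longrightarrow> P g \<Longrightarrow> P (f + g)"
  shows "P (f :: 'a \<Rightarrow>\<^sub>0 'b::comm_monoid_add)"
proof -
  have "finite A \<Longrightarrow> P (\<Sum>s\<in>A. single s (lookup f s))" for A
  proof (induction A rule: finite_induct)
    case empty
    \<comment> \<open>The empty sum is a term with coefficient 0, so the rule has no separate case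
      for zero.\<close>
    show ?case using assms(1)[of undefined 0] by simp
  qed (simp add: assms)
  from this[OF finite_keys[of f]] show ?thesis
    by (simp flip: poly_mapping_as_sum)
qed

lemma expo_induct [case_names zero add]:
  fixes s :: "'a \<Rightarrow>\<^sub>0 nat"
  assumes "P 0" and "\<And>v s. P s \<Longrightarrow> P (single v 1 + s)"
  shows "P s"
proof -
  have "P (single v n + s)" if "P s" for v n s
    using that
  proof (induction n)
    case (Suc n)
    have "single v (Suc n) + s = single v 1 + (single v n + s)"
      by (simp add: add.assoc[symmetric] single_add[symmetric])
    then show ?case using assms(2) Suc by metis
  qed simp
  then have "P (s + t)" if "P t" for t
    using that by (induction s arbitrary: t rule: poly_mapping_add_induct) (auto simp: add.assoc)
  from this[of 0] assms(1) show ?thesis by simp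
qed

lemma lookup_const_mult [simp]: "lookup (const c * f) t = c * lookup f t"
proof (induction f rule: poly_mapping_add_induct)
  case (single s d)
  show ?case by (simp add: const_def mult_single lookup_single when_def)
qed (simp add: algebra_simps lookup_add)

section \<open>Partial derivatives\<close>

lemma lookup_partial_deriv:
  "lookup (partial_deriv v h) t = of_nat (lookup t v + 1) * lookup h (t + single v 1)"
proof -
  have eq: "lookup (single (s - single v 1) (of_nat (lookup s v) * lookup h s)) t =
      (if s = t + single v 1 then of_nat (lookup s v) * lookup h s else 0)" for s
  \<comment> \<open>If \<open>v\<close> does not occur in \<open>s\<close>, the truncated
    subtraction leaves \<open>s\<close> unchanged; the spurious term disappears because its
    coefficient has the factor 0.\<close>
  proof (cases "lookup s v = 0")
    case False
    have "s - single v 1 = t \<longleftrightarrow> s = t + single v 1"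
    proof
      assume *: "s - single v 1 = t"
      show "s = t + single v 1"
      proof (rule poly_mapping_eqI)
        fix k
        from * have "lookup s k - lookup (single v 1) k = lookup t k"
          by (simp flip: lookup_minus)
        then show "lookup s k = lookup (t + single v 1) k"
          using False by (auto simp: lookup_add lookup_single when_def split: if_splits)
      qed
    qed simp
    then show ?thesis by (auto simp: lookup_single when_def)
  qed (auto simp: lookup_add)
  show ?thesis
    unfolding partial_deriv_def lookup_sum eq
    by (auto simp: sum.delta in_keys_iff lookup_add)
qed

lemma partial_deriv_add: "partial_deriv v (f + g) = partial_deriv v f + partial_deriv v g"
  by (rule poly_mapping_eqI) (simp add: lookup_partial_deriv lookup_add algebra_simps)

lemma partial_deriv_0 [simp]: "partial_deriv v 0 = 0"
  by (rule poly_mapping_eqI) (simp add: lookup_partial_deriv)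

lemma partial_deriv_sum: "partial_deriv v (sum f A) = (\<Sum>x\<in>A. partial_deriv v (f x))"
  by (induction A rule: infinite_finite_induct) (auto simp: partial_deriv_add)

lemma partial_deriv_const_mult: "partial_deriv v (const c * f) = const c * partial_deriv v f"
  by (rule poly_mapping_eqI) (simp add: lookup_partial_deriv mult_ac del: of_nat_Suc mult.commute)

lemma partial_deriv_commute:
  "partial_deriv v (partial_deriv w f) = partial_deriv w (partial_deriv v f)"
  by (cases "v = w"; rule poly_mapping_eqI)
    (simp_all add: lookup_partial_deriv lookup_add lookup_single add_ac mult_ac)

lemma partial_deriv_single:
  "partial_deriv v (single t c) = single (t - single v 1) (of_nat (lookup t v) * c)"
  by (simp add: partial_deriv_def)

lemma partial_deriv_mult:
  "partial_deriv v (f * g) = partial_deriv v f * g + f * partial_deriv v g"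
proof (induction f rule: poly_mapping_add_induct)
  case (single s c)
  show ?case
  proof (induction g rule: poly_mapping_add_induct)
    case (single t d)
    \<comment> \<open>Truncated subtraction commutes with the sum only if the variable occurs; in
      the other case the term has coefficient 0.\<close>
    have 1: "t + (s - single v 1) = s + t - single v 1" if "lookup s v > 0"
      using that by (intro poly_mapping_eqI) (auto simp: lookup_add lookup_minus lookup_single when_def)
    have 2: "s + (t - single v 1) = s + t - single v 1" if "lookup t v > 0"
      using that by (intro poly_mapping_eqI) (auto simp: lookup_add lookup_minus lookup_single when_def)
    show ?case
      by (cases "lookup s v = 0"; cases "lookup t v = 0")
        (simp_all add: partial_deriv_single mult_single lookup_add 1 2 algebra_simps
          del: One_nat_def flip: single_add)
  next
    case (add g h)
    then show ?case by (simp add: partial_deriv_add algebra_simps)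
  qed
next
  case (add f h)
  then show ?case by (simp add: partial_deriv_add algebra_simps)
qed

lemma partial_deriv_of_int [simp]: "partial_deriv v (of_int n) = 0"
proof (rule poly_mapping_eqI)
  fix t :: expo
  have "lookup (t + single v 1) v \<noteq> 0" by (simp add: lookup_add)
  then have "t + single v 1 \<noteq> 0" by auto
  then show "lookup (partial_deriv v (of_int n)) t = lookup 0 t"
    by (simp add: lookup_partial_deriv lookup_of_int)
qed

lemma partial_deriv_prod:
  "finite A \<Longrightarrow> partial_deriv v (prod f A) = (\<Sum>k\<in>A. partial_deriv v (f k) * prod f (A - {k}))"
proof (induction A rule: finite_induct)
  case empty
  show ?case using partial_deriv_of_int[of v 1] by simp
next
  case (insert x A)
  have "prod f (insert x A - {k}) = f x * prod f (A - {k})" if "k \<in> A" for k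
    using insert that by (subst insert_Diff_if) auto
  with insert show ?case
    by (simp add: partial_deriv_mult sum_distrib_left mult_ac)
qed

section \<open>Iterated derivatives\<close>

lemma comp_fun_commute_partial_deriv:
  "comp_fun_commute (\<lambda>v. partial_deriv v ^^ e v :: 'a::comm_ring_1 spoly \<Rightarrow> _)"
proof
  fix x y
  have 1: "(partial_deriv x ^^ n) (partial_deriv y h) = partial_deriv y ((partial_deriv x ^^ n) h)"
    for n and h :: "'a spoly"
    by (induction n) (auto simp: partial_deriv_commute)
  have "(partial_deriv x ^^ n) ((partial_deriv y ^^ m) h) = (partial_deriv y ^^ m) ((partial_deriv x ^^ n) h)"
    for m n and h :: "'a spoly"
    by (induction m) (auto simp: 1)
  then show "partial_deriv y ^^ e y \<circ> partial_deriv x ^^ e x =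
      partial_deriv x ^^ e x \<circ> (partial_deriv y ^^ e y :: 'a spoly \<Rightarrow> _)"
    by (simp add: fun_eq_iff)
qed

text \<open>Variables of exponent 0 contribute identity maps to the fold. This allows two exponents
  with different supports to be compared over one common set.\<close>

lemma monom_deriv_eq_fold:
  fixes h :: "'a::comm_ring_1 spoly"
  assumes "finite A" and "keys s \<subseteq> A"
  shows "monom_deriv s h = Finite_Set.fold (\<lambda>v. partial_deriv v ^^ lookup s v) h A"
proof -
  interpret comp_fun_commute "\<lambda>v. partial_deriv v ^^ lookup s v :: 'a spoly \<Rightarrow> _"
    by (rule comp_fun_commute_partial_deriv)
  have "finite B \<Longrightarrow> keys s \<inter> B = {} \<Longrightarrow> Finite_Set.fold (\<lambda>v. partial_deriv v ^^ lookup s v) h (keys s \<union> B) =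
       Finite_Set.fold (\<lambda>v. partial_deriv v ^^ lookup s v) h (keys s)" for B
  proof (induction B rule: finite_induct)
    case (insert x B)
    then have "lookup s x = 0" by (auto simp: in_keys_iff)
    with insert show ?case by simp
  qed simp
  from this[of "A - keys s"] assms show ?thesis
    by (simp add: monom_deriv_def Un_absorb1)
qed

lemma monom_deriv_single_add:
  fixes h :: "'a::comm_ring_1 spoly"
  shows "monom_deriv (single v 1 + s) h = partial_deriv v (monom_deriv s h)"
proof -
  \<comment> \<open>Both exponents agree on \<open>A\<close>, and \<open>v\<close> is split off from
    each fold separately, whether or not it already occurs in \<open>s\<close>.\<close>
  define A where "A = keys s - {v}"
  have fin: "finite A" "v \<notin> A" by (auto simp: A_def)
  note * = comp_fun_commute_partial_deriv
  interpret s: comp_fun_commute "\<lambda>v. partial_deriv v ^^ lookup s v :: 'a spoly \<Rightarrow> _" by (rule *)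
  interpret s': comp_fun_commute "\<lambda>w. partial_deriv w ^^ lookup (single v 1 + s) w :: 'a spoly \<Rightarrow> _"
    by (rule *)
  have keys: "keys (single v 1 + s) \<subseteq> insert v A" "keys s \<subseteq> insert v A"
    using keys_add[of "single v 1" s] by (auto simp: A_def)
  have "Finite_Set.fold (\<lambda>w. partial_deriv w ^^ lookup (single v 1 + s) w) h A =
     Finite_Set.fold (\<lambda>w. partial_deriv w ^^ lookup s w) h A"
    by (rule Finite_Set.fold_cong[OF *[of "lookup (single v 1 + s)", unfolded comp_fun_commute_def'] *[unfolded comp_fun_commute_def'] subset_UNIV])
      (auto simp: A_def lookup_add lookup_single)
  then show ?thesis
    unfolding monom_deriv_eq_fold[OF finite.insertI[OF fin(1)] keys(1)]
      monom_deriv_eq_fold[OF finite.insertI[OF fin(1)] keys(2)]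
      s.fold_insert[OF fin] s'.fold_insert[OF fin]
    by (simp add: lookup_add)
qed

lemma monom_deriv_0 [simp]: "monom_deriv 0 h = h"
  by (simp add: monom_deriv_def)

lemma monom_deriv_plus: "monom_deriv (s + t) h = monom_deriv s (monom_deriv t h)"
  by (induction s rule: expo_induct) (simp_all add: add.assoc monom_deriv_single_add del: One_nat_def)

lemma monom_deriv_add: "monom_deriv s (f + g) = monom_deriv s f + monom_deriv s g"
  by (induction s rule: expo_induct) (simp_all add: monom_deriv_single_add partial_deriv_add del: One_nat_def)

lemma monom_deriv_const_mult: "monom_deriv s (const c * f) = const c * monom_deriv s f"
  by (induction s rule: expo_induct) (simp_all add: monom_deriv_single_add partial_deriv_const_mult del: One_nat_def)

text \<open>In general the constant term is the coefficient of \<open>s\<close> times the product of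
  the factorials of the exponents, and this product is 1 for squarefree \<open>s\<close>.\<close>

lemma lookup_monom_deriv_0:
  assumes "\<And>v. lookup s v \<le> 1"
  shows "lookup (monom_deriv s h) 0 = lookup h s"
  using assms
proof (induction s arbitrary: h rule: expo_induct)
  case (add v s)
  have "lookup s w \<le> 1" for w
    using add.prems[of w] by (simp add: lookup_add)
  moreover have "lookup s v = 0"
    using add.prems[of v] by (simp add: lookup_add)
  ultimately show ?case
    using add.IH
    by (simp add: add.commute[of "single v _"] monom_deriv_plus lookup_partial_deriv
        monom_deriv_single_add[of v 0, simplified])
qed simp

text \<open>The product of the factorials is now a power of 2, hence invertible.\<close>

lemma lookup_monom_deriv_0_eq_0_iff:
  assumes "\<And>v. lookup s v \<le> 2" and "(2 :: 'k::field) \<noteq> 0"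
  shows "lookup (monom_deriv s h) 0 = (0 :: 'k) \<longleftrightarrow> lookup h s = 0"
  using assms(1)
proof (induction s arbitrary: h rule: expo_induct)
  case (add v s)
  have "lookup s w \<le> 2" for w
    using add.prems[of w] by (simp add: lookup_add)
  moreover have "lookup s v = 0 \<or> lookup s v = 1"
    using add.prems[of v] by (simp add: lookup_add) linarith
  then have "(of_nat (lookup s v + 1) :: 'k) \<noteq> 0"
    using assms(2) by auto
  ultimately show ?case
    using add.IH
    by (simp add: add.commute[of "single v _"] monom_deriv_plus lookup_partial_deriv
        monom_deriv_single_add[of v 0, simplified] del: of_nat_Suc)
qed simp

text \<open>Only one implication holds in general: the integer factors produced by differentiation
  can vanish in characteristic p.\<close>

lemma keys_monom_deriv: "t \<in> keys (monom_deriv s h) \<Longrightarrow> s + t \<in> keys h"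
proof (induction s arbitrary: t rule: expo_induct)
  case (add v s)
  from add.prems have "t + single v 1 \<in> keys (monom_deriv s h)"
    by (auto simp: monom_deriv_single_add lookup_partial_deriv in_keys_iff simp del: One_nat_def)
  from add.IH[OF this] show ?case by (simp add: add_ac)
qed simp

section \<open>The action of S on R\<close>

lemma diff_op_eq_sum:
  assumes "finite A" and "keys f \<subseteq> A"
  shows "diff_op f h = (\<Sum>s\<in>A. const (lookup f s) * monom_deriv s h)"
  unfolding diff_op_def using assms
  by (intro sum.mono_neutral_left) (auto simp: in_keys_iff const_def)

lemma const_0 [simp]: "const 0 = 0" and const_1 [simp]: "const 1 = 1"
  by (simp_all add: const_def)

lemma const_add: "const (a + b) = const a + const b"
  by (simp add: const_def single_add)

lemma const_mult: "const (a * b) = const a * const b"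
  by (simp add: const_def mult_single)

lemma const_uminus: "const (- a) = - const a"
  by (simp add: const_def single_uminus)

lemma const_of_nat: "const (of_nat n) = of_nat n"
  by (simp add: const_def)

lemma const_of_int: "const (of_int n) = of_int n"
  by (simp add: const_def)

lemma const_mult_inverse: "c \<noteq> (0::'k::field) \<Longrightarrow> const c * const (inverse c) = 1"
  by (simp flip: const_mult)

lemma diff_op_add: "diff_op (f + g) h = diff_op f h + diff_op g h"
  using keys_add[of f g]
  by (simp add: diff_op_eq_sum[of "keys f \<union> keys g"] lookup_add const_add algebra_simps sum.distrib)

lemma diff_op_single [simp]: "diff_op (single s c) h = const c * monom_deriv s h"
  by (simp add: diff_op_def)

lemma diff_op_0 [simp]: "diff_op 0 h = 0"
  by (simp add: diff_op_def)

lemma diff_op_add_right: "diff_op f (g + h) = diff_op f g + diff_op f h"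
  by (simp add: diff_op_def monom_deriv_add algebra_simps sum.distrib)

lemma diff_op_0_right [simp]: "diff_op f 0 = (0 :: 'k::comm_ring_1 spoly)"
  using monom_deriv_const_mult[of _ "0::'k" 0] by (simp add: diff_op_def)

lemma diff_op_sum: "diff_op (sum f A) h = (\<Sum>x\<in>A. diff_op (f x) h)"
  by (induction A rule: infinite_finite_induct) (auto simp: diff_op_add)

lemma diff_op_mult: "diff_op (f * g) h = diff_op f (diff_op g h)"
proof (induction f rule: poly_mapping_add_induct)
  case (single s c)
  show ?case
  proof (induction g rule: poly_mapping_add_induct)
    case (single t d)
    show ?case
      by (simp add: mult_single monom_deriv_plus monom_deriv_const_mult const_mult mult_ac)
  next
    case (add g h)
    then show ?case by (simp add: diff_op_add diff_op_add_right algebra_simps monom_deriv_add)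
  qed
next
  case (add f h)
  then show ?case by (simp add: diff_op_add algebra_simps)
qed

lemma diff_op_const_mult: "diff_op (const c * f) h = const c * diff_op f h"
  unfolding diff_op_mult by (simp add: const_def)

lemma diff_op_uminus: "diff_op (- f) h = - diff_op f h"
  using diff_op_const_mult[of "-1" f h] by (simp add: const_uminus)

lemma diff_op_diff: "diff_op (f - g) h = diff_op f h - diff_op g h"
  using diff_op_add[of f "- g" h] by (simp add: diff_op_uminus)

lemma keys_diff_op: "t \<in> keys (diff_op f h) \<Longrightarrow> \<exists>s\<in>keys f. s + t \<in> keys h"
proof -
  assume "t \<in> keys (diff_op f h)"
  then have "(\<Sum>s\<in>keys f. lookup f s * lookup (monom_deriv s h) t) \<noteq> 0"
    by (simp add: diff_op_def lookup_sum in_keys_iff)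
  then obtain s where "s \<in> keys f" "lookup (monom_deriv s h) t \<noteq> 0"
    by (metis (no_types, lifting) mult_zero_right sum.neutral)
  then show ?thesis using keys_monom_deriv[of t s h] by (auto simp: in_keys_iff)
qed

lemma symvar_commute: "symvar i j = symvar j i"
  by (simp add: symvar_def min.commute max.commute)

lemma diff_op_symvar: "diff_op (symvar i j) h = partial_deriv (min i j, max i j) h"
  using monom_deriv_single_add[of "(min i j, max i j)" 0 h] by (simp add: symvar_def)

subsection \<open>The polynomial ring and its ideals\<close>

lemma sym_poly_ring_simps [simp]:
  "monoid.mult (sym_poly_ring N) = (*)" "one (sym_poly_ring N) = 1"
  "zero (sym_poly_ring N) = 0" "add (sym_poly_ring N) = (+)"
  by (simp_all add: sym_poly_ring_def)

abbreviation polys :: "nat \<Rightarrow> 'k::comm_ring_1 spoly set" where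
  "polys N \<equiv> carrier (sym_poly_ring N)"

lemma polys_def: "polys N = {f. \<forall>s\<in>keys f. keys s \<subseteq> indices N}"
  by (simp add: sym_poly_ring_def)

lemma polys_0 [simp, intro]: "0 \<in> polys N"
  and polys_1 [simp, intro]: "1 \<in> polys N"
  and polys_single: "keys s \<subseteq> indices N \<Longrightarrow> single s c \<in> polys N"
  and polys_const [simp, intro]: "const c \<in> polys N"
  by (auto simp: polys_def const_def)

lemma polys_add [intro]: "f \<in> polys N \<Longrightarrow> g \<in> polys N \<Longrightarrow> f + g \<in> polys N"
  using keys_add[of f g] by (auto simp: polys_def)

lemma polys_mult [intro]:
  assumes "f \<in> polys N" "g \<in> polys N"
  shows "f * g \<in> polys N"
proof -
  have "keys s \<subseteq> indices N" if s: "s \<in> keys (f * g)" for s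
  proof -
    obtain a b where ab: "s = a + b" "a \<in> keys f" "b \<in> keys g"
      using s keys_mult[of f g] by blast
    with keys_add[of a b] assms show ?thesis by (fastforce simp: polys_def)
  qed
  then show ?thesis by (auto simp: polys_def)
qed

lemma polys_uminus [intro]: "f \<in> polys N \<Longrightarrow> - f \<in> polys N"
  using polys_mult[OF polys_const[of "-1"], of f] by (simp add: const_uminus)

lemma polys_sum [intro]: "(\<And>x. x \<in> A \<Longrightarrow> f x \<in> polys N) \<Longrightarrow> sum f A \<in> polys N"
  by (induction A rule: infinite_finite_induct) auto

lemma polys_prod [intro]: "(\<And>x. x \<in> A \<Longrightarrow> f x \<in> polys N) \<Longrightarrow> prod f A \<in> polys N"
  by (induction A rule: infinite_finite_induct) auto

lemma polys_symvar [intro]: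
  "Suc 0 \<le> i \<Longrightarrow> i \<le> N \<Longrightarrow> Suc 0 \<le> j \<Longrightarrow> j \<le> N \<Longrightarrow> symvar i j \<in> polys N"
  unfolding symvar_def by (rule polys_single) (auto simp: indices_def)

lemma polys_of_int [simp, intro]: "of_int c \<in> polys N"
  by (metis const_of_int polys_const)

lemma polys_numeral [simp, intro]: "numeral c \<in> polys N"
  by (metis of_int_numeral polys_of_int)

lemma polys_power2 [intro]: "f \<in> polys N \<Longrightarrow> f\<^sup>2 \<in> polys N"
  by (auto simp: power2_eq_square)

lemma cring_sym_poly_ring: "cring (sym_poly_ring N :: 'k::comm_ring_1 spoly ring)"
proof (rule cringI)
  show "abelian_group (sym_poly_ring N :: 'k spoly ring)"
    by (rule abelian_groupI) (auto simp: add_ac intro!: bexI[of _ "- x" for x])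
  show "Group.comm_monoid (sym_poly_ring N :: 'k spoly ring)"
    by (rule comm_monoidI) (auto simp: mult_ac)
qed (auto simp: algebra_simps)

interpretation sym_poly: cring "sym_poly_ring N :: 'k::comm_ring_1 spoly ring" for N
  by (rule cring_sym_poly_ring)

lemma a_inv_sym_poly_ring [simp]: "f \<in> polys N \<Longrightarrow> \<ominus>\<^bsub>sym_poly_ring N\<^esub> f = - f"
  by (rule sym_poly.minus_equality) auto

lemma ideal_sym_poly_ringI:
  assumes "I \<subseteq> polys N" "0 \<in> I"
    and "\<And>f g. f \<in> I \<Longrightarrow> g \<in> I \<Longrightarrow> f + g \<in> I"
    and "\<And>f g. f \<in> polys N \<Longrightarrow> g \<in> I \<Longrightarrow> f * g \<in> I"
  shows "ideal I (sym_poly_ring N)"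
proof (rule idealI)
  have "- f \<in> I" if "f \<in> I" for f
    using assms(4)[OF polys_const[of "-1"] that] by (simp add: const_uminus)
  with assms show "subgroup I (add_monoid (sym_poly_ring N))"
    by (intro sym_poly.add.subgroupI) (auto simp: a_inv_def[symmetric] subset_iff)
qed (use assms(4) in \<open>auto simp: sym_poly.ring_axioms intro: subst[OF mult.commute]\<close>)

text \<open>Translates ideals of the record ring into closure rules stated with the type class
  operations, so that ordinary algebraic simplification applies to membership goals.\<close>

locale sym_ideal =
  fixes I :: "'k::comm_ring_1 spoly set" and N :: nat
  assumes is_ideal: "ideal I (sym_poly_ring N)"
begin

lemmas is_additive_subgroup = ideal.axioms(1)[OF is_ideal]

lemma subset_polys: "f \<in> I \<Longrightarrow> f \<in> polys N"
  using additive_subgroup.a_subset[OF is_additive_subgroup] by auto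

lemma zero_mem [simp, intro]: "0 \<in> I"
  using additive_subgroup.zero_closed[OF is_additive_subgroup] by simp

lemma add_mem [intro]: "f \<in> I \<Longrightarrow> g \<in> I \<Longrightarrow> f + g \<in> I"
  using additive_subgroup.a_closed[OF is_additive_subgroup] by simp

lemma mult_mem: "f \<in> polys N \<Longrightarrow> g \<in> I \<Longrightarrow> f * g \<in> I"
  using ideal.I_l_closed[OF is_ideal] by simp

lemma mult_mem': "g \<in> I \<Longrightarrow> f \<in> polys N \<Longrightarrow> g * f \<in> I"
  using ideal.I_r_closed[OF is_ideal] by simp

lemma const_mult_mem [intro]: "g \<in> I \<Longrightarrow> const c * g \<in> I"
  by (rule mult_mem) auto

lemma uminus_mem [intro]: "f \<in> I \<Longrightarrow> - f \<in> I"
  using const_mult_mem[of f "-1"] by (simp add: const_uminus)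

lemma diff_mem [intro]: "f \<in> I \<Longrightarrow> g \<in> I \<Longrightarrow> f - g \<in> I"
  using add_mem[of f "- g"] by auto

lemma sum_mem [intro]: "(\<And>x. x \<in> A \<Longrightarrow> f x \<in> I) \<Longrightarrow> sum f A \<in> I"
  by (induction A rule: infinite_finite_induct) auto

lemma add_mem_cancel: "f - g \<in> I \<Longrightarrow> f \<in> I \<longleftrightarrow> g \<in> I"
  using add_mem[of "f - g" g] diff_mem[of f "f - g"] by auto

end

lemma genideal_sym_poly:
  assumes "G \<subseteq> polys N"
  shows "sym_ideal (genideal (sym_poly_ring N) G) N"
  unfolding sym_ideal_def using assms by (rule sym_poly.genideal_ideal)

lemma Q_gens_subset: "Q_gens N \<subseteq> polys N"
  unfolding Q_gens_def by auto

lemma sym_ideal_Q: "sym_ideal (Q_ideal N) N"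
  unfolding Q_ideal_def by (rule genideal_sym_poly[OF Q_gens_subset])

lemma Q_gens_in_Q: "f \<in> Q_gens N \<Longrightarrow> f \<in> Q_ideal N"
  unfolding Q_ideal_def using sym_poly.genideal_self[OF Q_gens_subset] by blast

lemma sym_ideal_annihilator: "sym_ideal {f \<in> polys N. diff_op f h = 0} N"
  unfolding sym_ideal_def
  by (rule ideal_sym_poly_ringI) (auto simp: diff_op_add diff_op_mult)

lemma sym_ideal_Ann: "sym_ideal (Ann N) N"
  unfolding Ann_def by (rule sym_ideal_annihilator)


lemma partial_deriv_of_int_mult: "partial_deriv v (of_int c * f) = of_int c * partial_deriv v f"
  by (simp add: partial_deriv_mult)

lemma const_numeral [simp]: "const (numeral w) = numeral w"
  by (simp add: const_def)

subsection \<open>Minors of the generic symmetric matrix\<close>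

text \<open>With arbitrary index functions for rows and columns, one notion covers both
  \<open>D_N\<close> and the minors \<open>F_U\<close>.\<close>

definition sym_minor :: "nat \<Rightarrow> (nat \<Rightarrow> nat) \<Rightarrow> (nat \<Rightarrow> nat) \<Rightarrow> 'k::comm_ring_1 spoly" where
  "sym_minor n a b =
     (\<Sum>p | p permutes {0..<n}. of_int (sign p) * (\<Prod>k\<in>{0..<n}. symvar (a k) (b (p k))))"

lemma sym_det_eq_sym_minor: "sym_det N = sym_minor N Suc Suc"
  unfolding sym_det_def sym_minor_def
  by (subst det_def'[of _ N])
    (auto simp: generic_sym_mat_def dest: permutes_in_image[THEN iffD2] permutes_nat_less intro!: sum.cong prod.cong arg_cong2[where f = "(*)"])

lemma F_minor_eq_sym_minor:
  "F_minor p U = sym_minor (p - 1) ((!) (sorted_list_of_set U))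
     (\<lambda>j. sorted_list_of_set U ! ((p - 1) + j))"
  unfolding F_minor_def sym_minor_def Let_def
  by (subst det_def'[of _ "p - 1"])
    (auto simp: dest: permutes_in_image[THEN iffD2] permutes_nat_less intro!: sum.cong prod.cong arg_cong2[where f = "(*)"])

context
  fixes n :: nat and a b :: "nat \<Rightarrow> nat"
begin

text \<open>The part of a second derivative of the minor that comes from differentiating the factors
  at the positions \<open>c\<close> and \<open>d\<close>; \<open>E\<close> is the product of the two
  derivatives as a function of the row and column indices of these factors.\<close>

definition alt_sum :: "(nat \<Rightarrow> nat \<Rightarrow> nat \<Rightarrow> nat \<Rightarrow> 'k::comm_ring_1 spoly) \<Rightarrow> nat \<Rightarrow> nat \<Rightarrow> 'k spoly" where
  "alt_sum E c d = (\<Sum>p | p permutes {0..<n}. of_int (sign p) *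
     (E (a c) (b (p c)) (a d) (b (p d)) * (\<Prod>k\<in>{0..<n} - {c} - {d}. symvar (a k) (b (p k)))))"

lemma alt_sum_add: "alt_sum (\<lambda>x y z w. E x y z w + F x y z w) c d = alt_sum E c d + alt_sum F c d"
  unfolding alt_sum_def by (simp add: algebra_simps sum.distrib)

lemma alt_sum_const_mult: "alt_sum (\<lambda>x y z w. const r * E x y z w) c d = const r * alt_sum E c d"
  unfolding alt_sum_def by (simp add: sum_distrib_left mult.assoc mult.left_commute)

text \<open>Substituting p composed with (c d) for p exchanges the two column arguments of
  \<open>E\<close>, leaves the remaining factors alone and changes the sign.\<close>

lemma alt_sum_swap:
  assumes "c < n" "d < n" "c \<noteq> d"
  shows "alt_sum (\<lambda>x y z w. E x w z y) c d = - alt_sum E c d"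
proof -
  let ?t = "transpose c d"
  have t: "?t permutes {0..<n}" using assms by (intro permutes_swap_id) auto
  have "alt_sum (\<lambda>x y z w. E x w z y) c d = (\<Sum>p | p permutes {0..<n}. of_int (sign (p \<circ> ?t)) *
     (E (a c) (b (p c)) (a d) (b (p d)) * (\<Prod>k\<in>{0..<n} - {c} - {d}. symvar (a k) (b ((p \<circ> ?t) k)))))"
    unfolding alt_sum_def by (subst sum_permutations_compose_right[OF t]) simp
  also have "\<dots> = (\<Sum>p | p permutes {0..<n}. - (of_int (sign p) *
     (E (a c) (b (p c)) (a d) (b (p d)) * (\<Prod>k\<in>{0..<n} - {c} - {d}. symvar (a k) (b (p k))))))"
  proof (intro sum.cong refl)
    fix p assume "p \<in> {p. p permutes {0..<n}}"
    then have p: "permutation p" using permutation_permutes by blast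
    have "sign (p \<circ> ?t) = - sign p"
      using assms by (subst sign_compose[OF p permutation_swap_id]) (simp add: sign_swap_id)
    moreover have "(\<Prod>k\<in>{0..<n} - {c} - {d}. symvar (a k) (b ((p \<circ> ?t) k))) =
        (\<Prod>k\<in>{0..<n} - {c} - {d}. symvar (a k) (b (p k)) :: 'a spoly)"
      by (intro prod.cong) (auto simp: transpose_apply_other)
    ultimately show "of_int (sign (p \<circ> ?t)) *
     (E (a c) (b (p c)) (a d) (b (p d)) * (\<Prod>k\<in>{0..<n} - {c} - {d}. symvar (a k) (b ((p \<circ> ?t) k)))) =
     - (of_int (sign p) * (E (a c) (b (p c)) (a d) (b (p d)) * (\<Prod>k\<in>{0..<n} - {c} - {d}. symvar (a k) (b (p k)))))"
      by simp
  qed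
  finally show ?thesis unfolding alt_sum_def by (simp add: sum_negf)
qed

text \<open>
  The sum over the ordered pairs of positions equals its image under exchanging the two positions,
  and is negated by exchanging the two column indices.
\<close>

lemma sum_alt_sum_eq_0:
  fixes E :: "nat \<Rightarrow> nat \<Rightarrow> nat \<Rightarrow> nat \<Rightarrow> 'k::field spoly"
  assumes E: "\<And>x y z w. E x y z w + E z w x y - E x w z y - E z y x w = 0"
    and two: "(2::'k) \<noteq> 0"
  shows "(\<Sum>d\<in>{0..<n}. \<Sum>c\<in>{0..<n} - {d}. alt_sum E c d) = 0"
proof -
  let ?S = "\<lambda>f. \<Sum>d\<in>{0..<n}. \<Sum>c\<in>{0..<n} - {d}. f c d :: 'k spoly"
  have swap: "?S f = ?S (\<lambda>c d. f d c)" for f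
  proof -
    \<comment> \<open>Filling in the diagonal with 0 makes the range rectangular, so that the order
      of summation can be exchanged.\<close>
    have *: "?S f = (\<Sum>d\<in>{0..<n}. \<Sum>c\<in>{0..<n}. if c = d then 0 else f c d)" for f
      by (intro sum.cong refl sum.mono_neutral_cong_left) auto
    from *[of f] have "?S f = (\<Sum>c\<in>{0..<n}. \<Sum>d\<in>{0..<n}. if d = c then 0 else f c d)"
      by (subst sum.swap) (simp only: eq_commute)
    also have "\<dots> = ?S (\<lambda>c d. f d c)"
      by (rule *[symmetric])
    finally show ?thesis .
  qed
  have "alt_sum E c d + alt_sum E d c
      - alt_sum (\<lambda>x y z w. E x w z y) c d - alt_sum (\<lambda>x y z w. E x w z y) d c = 0" for c d
  proof -
    have "{0..<n} - {d} - {c} = {0..<n} - {c} - {d}" by auto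
    then have "alt_sum E c d + alt_sum E d c
      - alt_sum (\<lambda>x y z w. E x w z y) c d - alt_sum (\<lambda>x y z w. E x w z y) d c =
      (\<Sum>p | p permutes {0..<n}. of_int (sign p) *
        ((E (a c) (b (p c)) (a d) (b (p d)) + E (a d) (b (p d)) (a c) (b (p c))
         - E (a c) (b (p d)) (a d) (b (p c)) - E (a d) (b (p c)) (a c) (b (p d))) *
       (\<Prod>k\<in>{0..<n} - {c} - {d}. symvar (a k) (b (p k)))))"
      unfolding alt_sum_def by (simp add: algebra_simps sum.distrib sum_subtractf)
    then show ?thesis by (simp add: E)
  qed
  moreover have "alt_sum (\<lambda>x y z w. E x w z y) c d = - alt_sum E c d"
    if "d \<in> {0..<n}" "c \<in> {0..<n} - {d}" for c d
    using that by (intro alt_sum_swap) auto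
  moreover have "alt_sum (\<lambda>x y z w. E x w z y) d c = - alt_sum E d c"
    if "d \<in> {0..<n}" "c \<in> {0..<n} - {d}" for c d
    using that by (intro alt_sum_swap) auto
  ultimately have "2 * (alt_sum E c d + alt_sum E d c) = 0"
    if "d \<in> {0..<n}" "c \<in> {0..<n} - {d}" for c d
    using that by (smt (verit) add.inverse_inverse diff_minus_eq_add mult_2 uminus_add_conv_diff add.assoc add.commute)
  then have "0 = ?S (\<lambda>c d. 2 * (alt_sum E c d + alt_sum E d c))"
    by simp
  also have "\<dots> = 2 * (?S (alt_sum E) + ?S (\<lambda>c d. alt_sum E d c))"
    by (simp add: sum.distrib sum_distrib_left)
  \<comment> \<open>One factor 2 comes from the symmetry in the two positions, the other from the
    alternation in the two columns.\<close>
  also have "\<dots> = const 4 * ?S (alt_sum E)"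
    unfolding swap[of "\<lambda>c d. alt_sum E d c"] by (simp add: const_def)
  finally have "const (inverse 4) * (const 4 * ?S (alt_sum E)) = 0" by simp
  moreover have "(4::'k) = 2 * 2" by simp
  then have "(4::'k) \<noteq> 0" using two by (metis mult_eq_0_iff)
  ultimately show ?thesis
    using const_mult_inverse[of "4::'k"]
    by (simp only: mult.assoc[symmetric] mult.commute[of "const (inverse _)"] not_False_eq_True mult_1_left)
qed

text \<open>Leibniz rule applied twice. The entries are linear, so the two derivatives must hit
  different factors, whence the sum runs over c \<noteq> d.\<close>

lemma diff_op_sym_minor_quadratic:
  "diff_op (symvar i j * symvar k l) (sym_minor n a b :: 'c::comm_ring_1 spoly) =
     (\<Sum>d\<in>{0..<n}. \<Sum>c\<in>{0..<n} - {d}.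
        alt_sum (\<lambda>x y z w. diff_op (symvar i j) (symvar x y) * diff_op (symvar k l) (symvar z w)) c d)"
proof -
  have const: "partial_deriv v (partial_deriv w (symvar x y :: 'c spoly)) = 0" for v w x y
  proof -
    define u where "u = (min x y, max x y)"
    show ?thesis
      unfolding symvar_def u_def[symmetric] partial_deriv_single
      by (cases "u = w") (simp_all add: lookup_single)
  qed
  have "diff_op (symvar i j * symvar k l) (sym_minor n a b :: 'c spoly) =
     (\<Sum>p | p permutes {0..<n}. \<Sum>d\<in>{0..<n}. \<Sum>c\<in>{0..<n} - {d}.
       of_int (sign p) * (diff_op (symvar i j) (symvar (a c) (b (p c))) *
         diff_op (symvar k l) (symvar (a d) (b (p d))) *
         (\<Prod>k\<in>{0..<n} - {c} - {d}. symvar (a k) (b (p k)))))"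
  proof -
    let ?v = "(min i j, max i j)" and ?w = "(min k l, max k l)"
    have 1: "partial_deriv ?w (of_int s * (\<Prod>k\<in>{0..<n}. symvar (a k) (b (p k)))) =
        of_int s * (\<Sum>d\<in>{0..<n}. partial_deriv ?w (symvar (a d) (b (p d))) *
          (\<Prod>k\<in>{0..<n} - {d}. symvar (a k) (b (p k)) :: 'c spoly))" for p s
      by (simp add: partial_deriv_of_int_mult partial_deriv_prod)
    have 2: "partial_deriv ?v (partial_deriv ?w (symvar (a d) (b (p d))) *
          (\<Prod>k\<in>{0..<n} - {d}. symvar (a k) (b (p k)) :: 'c spoly)) =
        (\<Sum>c\<in>{0..<n} - {d}. partial_deriv ?v (symvar (a c) (b (p c))) *
          partial_deriv ?w (symvar (a d) (b (p d))) *
          (\<Prod>k\<in>{0..<n} - {c} - {d}. symvar (a k) (b (p k))))" for d p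
    proof -
      have "{0..<n} - {d} - {c} = {0..<n} - {c} - {d}" for c by auto
      then show ?thesis
        by (simp add: partial_deriv_mult partial_deriv_prod const sum_distrib_left mult.assoc
            mult.left_commute)
    qed
    show ?thesis
      unfolding sym_minor_def diff_op_mult diff_op_symvar partial_deriv_sum 1
      by (simp only: partial_deriv_of_int_mult partial_deriv_sum 2 sum_distrib_left)
  qed
  also have "\<dots> = (\<Sum>d\<in>{0..<n}. \<Sum>c\<in>{0..<n} - {d}. \<Sum>p | p permutes {0..<n}.
       of_int (sign p) * (diff_op (symvar i j) (symvar (a c) (b (p c))) *
         diff_op (symvar k l) (symvar (a d) (b (p d))) *
         (\<Prod>k\<in>{0..<n} - {c} - {d}. symvar (a k) (b (p k)))))"
    by (subst sum.swap) (intro sum.cong refl sum.swap)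
  finally show ?thesis by (simp add: alt_sum_def)
qed

end

text \<open>For i \<noteq> j the two products exclude each other, so their sum is again 0 or 1.
  Written in this way, the exchange identities for the generators of \<open>Q\<close> become
  polynomial identities between Kronecker deltas.\<close>

lemma diff_op_symvar_symvar:
  "diff_op (symvar i j) (symvar x y) =
     (if i = j then of_bool (x = i) * of_bool (y = i)
      else of_bool (x = i) * of_bool (y = j) + of_bool (x = j) * of_bool (y = i))"
proof -
  have "diff_op (symvar i j) (symvar x y) = of_bool ((min i j, max i j) = (min x y, max x y))"
    unfolding diff_op_symvar unfolding symvar_def partial_deriv_single
  proof (cases "(min i j, max i j) = (min x y, max x y)")
    case False
    then show "single (single (min x y, max x y) 1 - single (min i j, max i j) 1)
        (of_nat (lookup (single (min x y, max x y) 1) (min i j, max i j)) * 1) =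
        of_bool ((min i j, max i j) = (min x y, max x y))"
      by (subst lookup_single_not_eq) auto
  qed simp
  also have "\<dots> = of_bool (x = i \<and> y = j \<or> x = j \<and> y = i)"
    by (rule arg_cong[where f = of_bool]) (auto simp: min_def max_def)
  finally show ?thesis by auto
qed

text \<open>Each generator yields a function \<open>E\<close> satisfying the exchange identity of
  \<open>sum_alt_sum_eq_0\<close>. The lemma is used twice: for \<open>D_N\<close> it gives that
  \<open>Q\<close> is contained in \<open>Ann\<close>, and for \<open>F_U\<close> it makes the
  pairing with \<open>F_U\<close> well defined modulo \<open>Q\<close>.\<close>

lemma Q_annihilates_sym_minor:
  fixes a b :: "nat \<Rightarrow> nat"
  assumes two: "(2::'k::field) \<noteq> 0" and "f \<in> Q_ideal N"
  shows "diff_op f (sym_minor n a b :: 'k spoly) = 0"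
proof -
  interpret I: sym_ideal "{f \<in> polys N. diff_op f (sym_minor n a b :: 'k spoly) = 0}" N
    by (rule sym_ideal_annihilator)
  define \<delta> where "\<delta> x i = (of_bool (x = i) :: 'k spoly)" for x i :: nat
  have diag: "diff_op (symvar i i) (symvar x y) = \<delta> x i * \<delta> y i" for i x y
    by (simp add: diff_op_symvar_symvar \<delta>_def)
  have off: "diff_op (symvar i j) (symvar x y) = \<delta> x i * \<delta> y j + \<delta> x j * \<delta> y i" if "i \<noteq> j" for i j x y
    using that by (simp add: diff_op_symvar_symvar \<delta>_def)
  let ?D = "\<lambda>f. diff_op f (sym_minor n a b :: 'k spoly)"
  have two_eq: "2 * x * y = const 2 * (x * y)" for x y :: "'k spoly"
    by simp
  note sums = diff_op_add diff_op_const_mult diff_op_sym_minor_quadratic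
    alt_sum_add[symmetric] alt_sum_const_mult[symmetric] sum_distrib_left sum.distrib[symmetric]
  have 1: "?D ((symvar i i)\<^sup>2) = 0" for i
    unfolding power2_eq_square sums
    by (rule sum_alt_sum_eq_0[OF _ two]) (simp add: diag mult_ac)
  have 2: "?D (symvar i i * symvar i j) = 0" if "i \<noteq> j" for i j
    unfolding sums
    by (rule sum_alt_sum_eq_0[OF _ two]) (simp add: diag off that algebra_simps)
  have 3: "?D ((symvar i j)\<^sup>2 + 2 * symvar i i * symvar j j) = 0" if "i \<noteq> j" for i j
    unfolding power2_eq_square two_eq sums
    by (rule sum_alt_sum_eq_0[OF _ two]) (simp add: diag off that algebra_simps)
  have 4: "?D (symvar i j * symvar i k + symvar i i * symvar j k) = 0"
    if "i \<noteq> j" "i \<noteq> k" "j \<noteq> k" for i j k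
    unfolding sums
    by (rule sum_alt_sum_eq_0[OF _ two]) (simp add: diag off that algebra_simps)
  have 5: "?D (symvar i j * symvar k l + symvar i k * symvar j l + symvar i l * symvar j k) = 0"
    if "i \<noteq> j" "i \<noteq> k" "i \<noteq> l" "j \<noteq> k" "j \<noteq> l" "k \<noteq> l" for i j k l
    unfolding sums
    by (rule sum_alt_sum_eq_0[OF _ two]) (simp add: off that algebra_simps)
  have quad: "?D f = 0" if "f \<in> Q_gens N" for f
    using that unfolding Q_gens_def
    by (elim UnE CollectE exE conjE) (simp_all add: 1 2 3 4 5)
  have "Q_ideal N \<subseteq> {f \<in> polys N. ?D f = 0}"
    unfolding Q_ideal_def
  proof (rule sym_poly.genideal_minimal[OF I.is_ideal])
    show "Q_gens N \<subseteq> {f \<in> polys N. ?D f = 0}"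
      using quad Q_gens_subset by blast
  qed
  with assms(2) show ?thesis by blast
qed

section \<open>Relations in S/Q\<close>

interpretation Q: sym_ideal "Q_ideal N :: 'k::comm_ring_1 spoly set" N for N
  by (rule sym_ideal_Q)

lemma Q_rels:
  fixes i j k l N :: nat
  shows "i \<in> {1..N} \<Longrightarrow> (symvar i i)\<^sup>2 \<in> Q_ideal N"
    and "{i, j} \<subseteq> {1..N} \<Longrightarrow> i \<noteq> j \<Longrightarrow> symvar i i * symvar i j \<in> Q_ideal N"
    and "{i, j} \<subseteq> {1..N} \<Longrightarrow> i \<noteq> j \<Longrightarrow> (symvar i j)\<^sup>2 + 2 * symvar i i * symvar j j \<in> Q_ideal N"
    and "{i, j, k} \<subseteq> {1..N} \<Longrightarrow> distinct [i, j, k] \<Longrightarrow>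
      symvar i j * symvar i k + symvar i i * symvar j k \<in> Q_ideal N"
    and "{i, j, k, l} \<subseteq> {1..N} \<Longrightarrow> distinct [i, j, k, l] \<Longrightarrow>
      symvar i j * symvar k l + symvar i k * symvar j l + symvar i l * symvar j k \<in> Q_ideal N"
  by (rule Q_gens_in_Q; unfold Q_gens_def; blast)+


text \<open>The relation at \<open>i\<close> replaces \<open>d_ij d_ik\<close> by
  \<open>- d_ii d_jk\<close>, the relation at \<open>j\<close> then replaces
  \<open>d_jk d_jl\<close> by \<open>- d_jj d_kl\<close>, and the signs cancel: the arcs ik and jl
  contract along ij to the arc kl.\<close>

lemma Q_contract:
  assumes "{i, j, k, l} \<subseteq> {1..N}" "distinct [i, j, k, l]"
  shows "symvar i j * (symvar i k * symvar j l) - symvar i i * symvar j j * symvar k l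
    \<in> (Q_ideal N :: 'k::comm_ring_1 spoly set)"
proof -
  have "(symvar i j * symvar i k + symvar i i * symvar j k) * symvar j l -
      (symvar j k * symvar j l + symvar j j * symvar k l) * symvar i i \<in> (Q_ideal N :: 'k spoly set)"
    using assms by (intro Q.diff_mem Q.mult_mem' Q_rels polys_symvar) auto
  then show ?thesis by (simp add: algebra_simps)
qed


subsection \<open>Renaming of indices\<close>

text \<open>Renaming can reverse the order of a pair; \<open>symvar\<close> sorts it again, which
  makes \<open>rename\<close> the substitution homomorphism for an arbitrary map of indices.\<close>

definition rename_monom :: "(nat \<Rightarrow> nat) \<Rightarrow> expo \<Rightarrow> 'k::comm_ring_1 spoly" where
  "rename_monom \<sigma> s = (\<Prod>v\<in>keys s. symvar (\<sigma> (fst v)) (\<sigma> (snd v)) ^ lookup s v)"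

definition rename :: "(nat \<Rightarrow> nat) \<Rightarrow> 'k::comm_ring_1 spoly \<Rightarrow> 'k spoly" where
  "rename \<sigma> f = (\<Sum>s\<in>keys f. const (lookup f s) * rename_monom \<sigma> s)"

lemma rename_monom_add: "rename_monom \<sigma> (s + t) = rename_monom \<sigma> s * rename_monom \<sigma> t"
proof -
  let ?A = "keys s \<union> keys t"
  have *: "rename_monom \<sigma> r = (\<Prod>v\<in>?A. symvar (\<sigma> (fst v)) (\<sigma> (snd v)) ^ lookup r v)"
    if "keys r \<subseteq> ?A" for r
    unfolding rename_monom_def using that
    by (intro prod.mono_neutral_left) (auto simp: in_keys_iff)
  show ?thesis
    by (simp add: * keys_add lookup_add power_add prod.distrib)
qed

lemma rename_monom_0 [simp]: "rename_monom \<sigma> 0 = 1"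
  by (simp add: rename_monom_def)

lemma rename_single: "rename \<sigma> (single s c) = const c * rename_monom \<sigma> s"
  by (simp add: rename_def)

lemma rename_0 [simp]: "rename \<sigma> 0 = 0"
  by (simp add: rename_def)

lemma rename_add: "rename \<sigma> (f + g) = rename \<sigma> f + rename \<sigma> g"
proof -
  let ?A = "keys f \<union> keys g"
  have *: "rename \<sigma> h = (\<Sum>s\<in>?A. const (lookup h s) * rename_monom \<sigma> s)" if "keys h \<subseteq> ?A" for h
    unfolding rename_def using that
    by (intro sum.mono_neutral_left) (auto simp: in_keys_iff)
  show ?thesis
    by (simp add: * keys_add lookup_add const_add algebra_simps sum.distrib)
qed

lemma rename_mult: "rename \<sigma> (f * g) = rename \<sigma> f * rename \<sigma> g"
proof (induction f rule: poly_mapping_add_induct)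
  case (single s c)
  show ?case
  proof (induction g rule: poly_mapping_add_induct)
    case (single t d)
    show ?case by (simp add: mult_single rename_single rename_monom_add const_mult mult_ac)
  qed (simp add: rename_add algebra_simps)
qed (simp add: rename_add algebra_simps)

lemma rename_const [simp]: "rename \<sigma> (const c) = const c"
  by (simp add: const_def[of c] rename_single)

lemma rename_1 [simp]: "rename \<sigma> 1 = 1"
  using rename_const[of \<sigma> 1] by simp

lemma rename_symvar [simp]: "rename \<sigma> (symvar i j) = symvar (\<sigma> i) (\<sigma> j)"
  unfolding symvar_def[of i j] rename_single rename_monom_def
  by (auto simp: min_def max_def symvar_commute)

lemma rename_prod: "rename \<sigma> (prod f A) = (\<Prod>x\<in>A. rename \<sigma> (f x))"
  by (induction A rule: infinite_finite_induct) (auto simp: rename_mult)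


subsection \<open>Spans of perfect matchings\<close>

text \<open>Consecutive entries of the list are joined. The singleton equation is a default, by
  which every list of odd length has the value 0.\<close>

fun arcs :: "nat list \<Rightarrow> 'k::comm_ring_1 spoly" where
  "arcs [] = 1"
| "arcs [a] = 0"
| "arcs (a # b # l) = symvar a b * arcs l"

lemma rename_arcs: "rename \<sigma> (arcs l) = arcs (map \<sigma> l)"
  by (induction l rule: arcs.induct) (auto simp: rename_mult)

lemma arcs_polys: "set l \<subseteq> {1..N} \<Longrightarrow> arcs l \<in> polys N"
  by (induction l rule: arcs.induct) (auto intro!: polys_mult)

text \<open>The K-span of the perfect matchings of \<open>B\<close>, made of polynomials rather than
  classes modulo \<open>Q\<close>. Being inductive, it lets linear statements be checked on single
  matchings.\<close>

inductive_set matchings :: "nat set \<Rightarrow> 'k::comm_ring_1 spoly set" for B :: "nat set" where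
  matchings_arcs: "distinct l \<Longrightarrow> set l = B \<Longrightarrow> even (length l) \<Longrightarrow> arcs l \<in> matchings B"
| matchings_0: "0 \<in> matchings B"
| matchings_add: "f \<in> matchings B \<Longrightarrow> g \<in> matchings B \<Longrightarrow> f + g \<in> matchings B"
| matchings_const_mult: "f \<in> matchings B \<Longrightarrow> const c * f \<in> matchings B"

lemma matchings_polys: "f \<in> matchings B \<Longrightarrow> B \<subseteq> {1..N} \<Longrightarrow> f \<in> polys N"
  by (induction rule: matchings.induct) (blast intro: arcs_polys polys_const)+

lemma matchings_rename:
  "f \<in> matchings B \<Longrightarrow> inj_on \<sigma> B \<Longrightarrow> \<sigma> ` B = B' \<Longrightarrow> rename \<sigma> f \<in> matchings B'"
  by (induction rule: matchings.induct)
    (auto simp: rename_arcs rename_add rename_mult distinct_map intro: matchings.intros)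

text \<open>The variables commute, so the arc at a prescribed index can be moved to the front; the
  relations of \<open>Q\<close> are then applied to this arc.\<close>

lemma arcs_pick:
  assumes "distinct l" "even (length l)" "i \<in> set l"
  shows "\<exists>k l'. arcs l = symvar i k * (arcs l' :: 'k::comm_ring_1 spoly) \<and> distinct (i # k # l') \<and>
    set (i # k # l') = set l \<and> even (length l')"
  using assms
proof (induction l rule: arcs.induct)
  case (3 a b l)
  show ?case
  proof (cases "i \<in> set l")
    case True
    with 3 obtain k l' where k: "arcs l = symvar i k * (arcs l' :: 'k spoly)" "distinct (i # k # l')"
      "set (i # k # l') = set l" "even (length l')"
      by auto
    then have "arcs (a # b # l) = symvar i k * (arcs (a # b # l') :: 'k spoly)"
      by (simp add: mult_ac)
    moreover have "distinct (i # k # a # b # l')" "set (i # k # a # b # l') = set (a # b # l)"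
      using k 3(2) by auto
    ultimately show ?thesis using k(4) by (metis even_Suc_Suc_iff length_Cons)
  next
    case False
    with 3 have "i = a \<or> i = b" by auto
    then show ?thesis
    proof
      assume "i = b"
      then have "arcs (a # b # l) = symvar i a * (arcs l :: 'k spoly)"
        by (simp add: symvar_commute)
      moreover have "distinct (i # a # l)" "set (i # a # l) = set (a # b # l)" "even (length l)"
        using 3 \<open>i = b\<close> by auto
      ultimately show ?thesis by blast
    next
      assume "i = a"
      with 3 show ?thesis by (intro exI[of _ b] exI[of _ l]) auto
    qed
  qed
qed auto

lemma transpose_map_id: "a \<notin> set l \<Longrightarrow> b \<notin> set l \<Longrightarrow> map (transpose a b) l = l"
  by (intro map_idI) (auto simp: transpose_def)

text \<open>
  In \<open>S/Q\<close>, multiplication by \<open>d\<^sub>i\<^sub>j\<close> turns a matching \<open>g\<close> of \<open>B\<close> into \<open>d\<^sub>i\<^sub>i d\<^sub>j\<^sub>j c\<close>, where \<open>c\<close> is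
  the contraction of \<open>g\<close> along \<open>i, j\<close> with loop value \<open>-2\<close>; and \<open>1 + (i j) = - d\<^sub>i\<^sub>j c\<close> as operators.
\<close>

lemma contraction:
  assumes "g \<in> matchings B" "B \<subseteq> {1..N}" "i \<in> B" "j \<in> B" "i \<noteq> j"
  shows "\<exists>c \<in> matchings (B - {i, j}).
     symvar i j * g - symvar i i * symvar j j * c \<in> Q_ideal N \<and>
     g + rename (transpose i j) g + symvar i j * c \<in> (Q_ideal N :: 'k::comm_ring_1 spoly set)"
  using assms(1)
proof (induction rule: matchings.induct)
  case (matchings_arcs l)
  obtain k l' where k: "arcs l = symvar i k * (arcs l' :: 'k spoly)" "distinct (i # k # l')"
      "set (i # k # l') = set l" "even (length l')"
    using arcs_pick[OF matchings_arcs(1,3)] assms matchings_arcs(2) by blast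
  show ?case
  proof (cases "k = j")
    case True
    \<comment> \<open>Here \<open>i\<close> and \<open>j\<close> are joined to each other. The loop
      value -2 comes from the relation \<open>d_ij^2 = - 2 d_ii d_jj\<close>, and as the
      transposition fixes the matching, g + g - 2g = 0.\<close>
    define L where "L = (arcs l' :: 'k spoly)"
    have L: "L \<in> polys N" "L \<in> matchings (B - {i, j})"
    proof -
      have "set l' = B - {i, j}" using k(2,3) matchings_arcs(2) True by auto
      then show "L \<in> polys N" "L \<in> matchings (B - {i, j})"
        using k(2,4) assms(2) unfolding L_def
        by (auto intro: arcs_polys matchings.matchings_arcs simp del: One_nat_def)
    qed
    have "rename (transpose i j) (arcs l) = symvar i j * L"
      unfolding k(1) rename_mult using k(2) True
      by (simp add: rename_arcs transpose_map_id symvar_commute L_def)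
    then have 2: "arcs l + rename (transpose i j) (arcs l) + symvar i j * (const (-2) * L) = 0"
      unfolding k(1) using True by (simp add: L_def algebra_simps const_uminus)
    have 1: "symvar i j * arcs l - symvar i i * symvar j j * (const (-2) * L) =
      ((symvar i j)\<^sup>2 + 2 * symvar i i * symvar j j) * L"
      unfolding k(1) using True by (simp add: L_def algebra_simps power2_eq_square const_uminus)
    have "((symvar i j)\<^sup>2 + 2 * symvar i i * symvar j j) * L \<in> Q_ideal N"
      using assms(2-5) L(1) by (intro Q.mult_mem' Q_rels(3)) auto
    then show ?thesis
      by (intro bexI[of _ "const (-2) * L"], unfold 1 2)
        (auto intro: matchings_const_mult L(2))
  next
    case False
    have "j \<in> set l'" using False k assms(4,5) matchings_arcs(2) by auto
    then obtain q l'' where q: "arcs l' = symvar j q * (arcs l'' :: 'k spoly)" "distinct (j # q # l'')"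
      "set (j # q # l'') = set l'" "even (length l'')"
      using arcs_pick[of l' j] k by auto
    \<comment> \<open>The arcs ik and jq contract to kq. The transposition turns them into jk and
      iq, and these two matchings together with ij, kq form the four-index relation.\<close>
    define L where "L = (arcs l'' :: 'k spoly)"
    have dist: "distinct (i # j # k # q # l'')" using k q False assms(5) by auto
    have sub: "{i, j, k, q} \<subseteq> {1..N}" "set l'' \<subseteq> {1..N}" "set l'' = B - {i, j, k, q}" "{i, j, k, q} \<subseteq> B"
    proof -
      have "B = insert i (insert k (set (j # q # l'')))"
        unfolding matchings_arcs(2)[symmetric] k(3)[symmetric] q(3) by simp
      then have B: "B = {i, j, k, q} \<union> set l''" by auto
      then show "{i, j, k, q} \<subseteq> {1..N}" "set l'' \<subseteq> {1..N}" "{i, j, k, q} \<subseteq> B"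
        using assms(2) by blast+
      show "set l'' = B - {i, j, k, q}" unfolding B using dist by auto
    qed
    have L: "L \<in> polys N" using sub unfolding L_def by (intro arcs_polys)
    have c: "symvar k q * L \<in> matchings (B - {i, j})"
      using matchings.matchings_arcs[of "k # q # l''" "B - {i, j}"] dist sub q(4) by (auto simp: L_def)
    have l: "arcs l = symvar i k * symvar j q * L"
      by (simp add: k(1) q(1) L_def mult_ac)
    have ren: "rename (transpose i j) (arcs l) = symvar j k * symvar i q * L"
      unfolding l rename_mult L_def using dist
      by (simp add: rename_arcs transpose_map_id transpose_apply_other)
    have 1: "symvar i j * arcs l - symvar i i * symvar j j * (symvar k q * L) =
       (symvar i j * (symvar i k * symvar j q) - symvar i i * symvar j j * symvar k q) * L"
      unfolding l by (simp add: algebra_simps)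
    have 2: "arcs l + rename (transpose i j) (arcs l) + symvar i j * (symvar k q * L) =
       (symvar i j * symvar k q + symvar i k * symvar j q + symvar i q * symvar j k) * L"
      unfolding ren unfolding l by (simp add: algebra_simps)
    show ?thesis
    proof (rule bexI[OF _ c], unfold 1 2, intro conjI Q.mult_mem' Q_contract L)
      show "symvar i j * symvar k q + symvar i k * symvar j q + symvar i q * symvar j k \<in> Q_ideal N"
        using sub dist by (intro Q_rels) auto
    qed (use sub dist in auto)
  qed
next
  case matchings_0
  show ?case by (rule bexI[of _ 0]) (auto intro: matchings.intros)
next
  case (matchings_add f g)
  then obtain c d where c: "c \<in> matchings (B - {i, j})"
      "symvar i j * f - symvar i i * symvar j j * c \<in> Q_ideal N"
      "f + rename (transpose i j) f + symvar i j * c \<in> Q_ideal N"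
    and d: "d \<in> matchings (B - {i, j})"
      "symvar i j * g - symvar i i * symvar j j * d \<in> Q_ideal N"
      "g + rename (transpose i j) g + symvar i j * d \<in> Q_ideal N" by blast
  show ?case
    by (rule bexI[of _ "c + d"])
      (use Q.add_mem[OF c(2) d(2)] Q.add_mem[OF c(3) d(3)] c(1) d(1) in
        \<open>auto simp: algebra_simps rename_add intro: matchings.intros\<close>)
next
  case (matchings_const_mult f r)
  then obtain c where c: "c \<in> matchings (B - {i, j})"
      "symvar i j * f - symvar i i * symvar j j * c \<in> Q_ideal N"
      "f + rename (transpose i j) f + symvar i j * c \<in> Q_ideal N" by blast
  show ?case
    by (rule bexI[OF _ matchings.matchings_const_mult[OF c(1), of r]])
      (use Q.const_mult_mem[OF c(2), of r] Q.const_mult_mem[OF c(3), of r] in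
        \<open>auto simp: algebra_simps rename_mult\<close>)
qed

text \<open>Exchanging a with either end of an arc cd of \<open>r\<close> gives the two other ways
  to join a, b, c, d. Together with the original matching they form the four-index relation, one for
  each of the arcs of \<open>r\<close>.\<close>

lemma transposition_sum_arcs:
  assumes "distinct (a # b # r)" "even (length r)" "set (a # b # r) \<subseteq> {1..N}"
  shows "(\<Sum>j\<in>set r. symvar j b * arcs (map (transpose a j) r)) +
     of_nat (length r div 2) * (symvar a b * arcs r) \<in> (Q_ideal N :: 'k::comm_ring_1 spoly set)"
  using assms
proof (induction r rule: arcs.induct)
  case (3 c d r)
  let ?T = "(\<Sum>j\<in>set r. symvar j b * arcs (map (transpose a j) r)) +
     of_nat (length r div 2) * (symvar a b * arcs r) :: 'k spoly"
  have "?T \<in> Q_ideal N"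
    using 3 by auto
  then have 1: "symvar c d * ?T \<in> Q_ideal N"
    using 3(4) by (intro Q.mult_mem) auto
  have 2: "(symvar a b * symvar c d + symvar a c * symvar b d + symvar a d * symvar b c) * arcs r
      \<in> Q_ideal N"
    using 3 by (intro Q.mult_mem' Q_rels arcs_polys) auto
  have j: "arcs (map (transpose a j) (c # d # r)) = symvar c d * (arcs (map (transpose a j) r) :: 'k spoly)"
    if "j \<in> set r" for j
  proof -
    have "transpose a j c = c" "transpose a j d = d"
      using 3(2) that by (auto intro!: transpose_apply_other)
    then show ?thesis by simp
  qed
  have c: "arcs (map (transpose a c) (c # d # r)) = symvar a d * (arcs r :: 'k spoly)"
    "arcs (map (transpose a d) (c # d # r)) = symvar a c * (arcs r :: 'k spoly)"
    using 3(2) by (auto simp: transpose_apply_other transpose_map_id symvar_commute)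
  have "(\<Sum>j\<in>set (c # d # r). symvar j b * arcs (map (transpose a j) (c # d # r))) =
      symvar c b * (symvar a d * arcs r) + (symvar d b * (symvar a c * arcs r) +
      (\<Sum>j\<in>set r. symvar j b * (symvar c d * arcs (map (transpose a j) r)) :: 'k spoly))"
    using 3(2) by (simp add: j[simplified] transpose_map_id symvar_commute[of c a])
  also have "\<dots> + of_nat (length (c # d # r) div 2) * (symvar a b * arcs (c # d # r)) =
      symvar c d * ?T + (symvar a b * symvar c d + symvar a c * symvar b d + symvar a d * symvar b c) * arcs r"
    by (simp add: algebra_simps sum_distrib_left symvar_commute[of c b] symvar_commute[of d b])
  finally show ?case using Q.add_mem[OF 1 2] by simp
qed auto

text \<open>The sum below is the Jucys--Murphy element of \<open>a\<close>.\<close>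

lemma transposition_sum:
  assumes "g \<in> matchings B" "B \<subseteq> {1..N}" "a \<in> B" "card B = 2 * m"
  shows "(\<Sum>j\<in>B - {a}. rename (transpose a j) g) + const (of_nat m - 2) * g
    \<in> (Q_ideal N :: 'k::comm_ring_1 spoly set)"
  using assms(1)
proof (induction rule: matchings.induct)
  case (matchings_arcs l)
  obtain b r where b: "arcs l = symvar a b * (arcs r :: 'k spoly)" "distinct (a # b # r)"
      "set (a # b # r) = set l" "even (length r)"
    using arcs_pick[OF matchings_arcs(1,3)] assms matchings_arcs(2) by blast
  have B: "B - {a} = insert b (set r)" "b \<notin> set r" using b matchings_arcs by auto
  have len: "of_nat (length r div 2) = (of_nat m - 1 :: 'k spoly)"
  proof -
    have "card B = length r + 2"
      using b matchings_arcs(2) by (metis distinct_card length_Cons add_2_eq_Suc')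
    then have "length r div 2 = m - 1" "m \<ge> 1" using assms(4) by auto
    then show ?thesis by (simp add: of_nat_diff)
  qed
  have "rename (transpose a b) (arcs l) = symvar a b * (arcs r :: 'k spoly)"
    unfolding b(1) rename_mult using b(2) by (simp add: rename_arcs transpose_map_id symvar_commute)
  moreover have "rename (transpose a j) (arcs l) = symvar j b * (arcs (map (transpose a j) r) :: 'k spoly)"
    if "j \<in> set r" for j
  proof -
    have "transpose a j b = b"
      using b(2) that by (auto intro!: transpose_apply_other)
    then show ?thesis unfolding b(1) rename_mult by (simp add: rename_arcs)
  qed
  moreover have "const (of_nat m - 2) = of_nat m - (2 :: 'k spoly)"
    by (simp add: const_def single_diff)
  ultimately have "(\<Sum>j\<in>B - {a}. rename (transpose a j) (arcs l)) + const (of_nat m - 2) * arcs l =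
     symvar a b * arcs r + (\<Sum>j\<in>set r. symvar j b * arcs (map (transpose a j) r)) +
     (of_nat m - 2) * (symvar a b * arcs r :: 'k spoly)"
    unfolding B(1) sum.insert[OF finite_set B(2)] by (simp add: b(1))
  also have "\<dots> = (\<Sum>j\<in>set r. symvar j b * arcs (map (transpose a j) r)) +
     of_nat (length r div 2) * (symvar a b * arcs r :: 'k spoly)"
    unfolding len by (simp add: algebra_simps)
  finally have "(\<Sum>j\<in>B - {a}. rename (transpose a j) (arcs l)) + const (of_nat m - 2) * arcs l = \<dots>" .
  then show ?case using transposition_sum_arcs[of a b r N] b matchings_arcs(2) assms(2) by auto
next
  case (matchings_add f g)
  then show ?case using Q.add_mem[OF matchings_add.IH] by (simp add: rename_add sum.distrib algebra_simps)
next
  case (matchings_const_mult f c)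
  then show ?case using Q.const_mult_mem[OF matchings_const_mult.IH, of c]
    by (simp add: rename_mult sum_distrib_left algebra_simps)
qed auto

subsection \<open>Antisymmetrised matchings\<close>

lemma sym_minor_eq_det: "sym_minor m a b = det (mat m m (\<lambda>(i, j). symvar (a i) (b j)))"
  unfolding sym_minor_def
  by (subst det_def'[of _ m]) (auto intro!: sum.cong prod.cong arg_cong2[where f = "(*)"])

lemma sym_minor_commute: "sym_minor m a b = (sym_minor m b a :: 'k::comm_ring_1 spoly)"
proof -
  have "transpose_mat (mat m m (\<lambda>(i, j). symvar (a i) (b j))) =
      (mat m m (\<lambda>(i, j). symvar (b i) (a j)) :: 'k spoly mat)"
    by (intro eq_matI) (auto simp: symvar_commute)
  then show ?thesis
    unfolding sym_minor_eq_det
    using det_transpose[of "mat m m (\<lambda>(i, j). symvar (a i) (b j)) :: 'k spoly mat" m] by simp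
qed

lemma sym_minor_permute:
  assumes "\<rho> permutes {0..<m}"
  shows "sym_minor m (a \<circ> \<rho>) b = of_int (sign \<rho>) * (sym_minor m a b :: 'k::comm_ring_1 spoly)"
proof -
  let ?A = "mat m m (\<lambda>(i, j). symvar (a i) (b j)) :: 'k spoly mat"
  have "mat m m (\<lambda>(i, j). symvar ((a \<circ> \<rho>) i) (b j)) = mat m m (\<lambda>(i, j). ?A $$ (\<rho> i, j))"
    using assms by (intro eq_matI) auto
  then show ?thesis
    unfolding sym_minor_eq_det using det_permute_rows[OF _ assms, of ?A] by simp
qed

lemma sym_minor_cong:
  assumes "\<And>k. k < m \<Longrightarrow> a k = a' k" and "\<And>k. k < m \<Longrightarrow> b k = b' k"
  shows "sym_minor m a b = sym_minor m a' b'"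
  unfolding sym_minor_eq_det using assms by (intro arg_cong[where f = det] eq_matI) auto

lemma sorted_list_of_set_Un_less:
  fixes I J :: "nat set"
  assumes "finite I" "finite J" "\<And>i j. i \<in> I \<Longrightarrow> j \<in> J \<Longrightarrow> i < j"
  shows "sorted_list_of_set (I \<union> J) = sorted_list_of_set I @ sorted_list_of_set J"
proof (rule sorted_distinct_set_unique)
  show "sorted (sorted_list_of_set I @ sorted_list_of_set J)"
    using assms by (auto simp: sorted_append less_imp_le)
  show "distinct (sorted_list_of_set I @ sorted_list_of_set J)"
    using assms by fastforce
qed (use assms in auto)

text \<open>As \<open>I\<close> lies below its image under \<open>v\<close>, it is the first half of
  the sorted list of the union. Since \<open>v\<close> need not be monotone, the second half is met
  in another order, which only costs a sign.\<close>

lemma sym_minor_matching_eq_F_minor: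
  fixes I :: "nat set" and v :: "nat \<Rightarrow> nat"
  defines "e \<equiv> (!) (sorted_list_of_set I)"
  assumes "finite I" "card I = p - 1" "inj_on v I" "\<And>i j. i \<in> I \<Longrightarrow> j \<in> v ` I \<Longrightarrow> i < j"
  shows "\<exists>s. sym_minor (p - 1) (v \<circ> e) e = of_int s * (F_minor p (I \<union> v ` I) :: 'k::comm_ring_1 spoly)"
proof -
  let ?m = "p - 1" and ?J = "v ` I"
  define u where "u = sorted_list_of_set (I \<union> ?J)"
  define w where "w = (!) (sorted_list_of_set ?J)"
  have card: "card ?J = ?m" using assms by (simp add: card_image)
  have u: "u = sorted_list_of_set I @ sorted_list_of_set ?J"
    unfolding u_def using assms by (intro sorted_list_of_set_Un_less) auto
  have "e k = u ! k" "w k = u ! (?m + k)" if "k < ?m" for k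
    using that assms(2,3) by (auto simp: e_def u w_def nth_append)
  then have F: "F_minor p (I \<union> ?J) = sym_minor ?m e w"
    unfolding F_minor_eq_sym_minor u_def[symmetric] by (intro sym_minor_cong) auto
  have be: "bij_betw e {0..<?m} I"
    unfolding e_def using assms(2,3) by (intro bij_betw_nth) auto
  have bw: "bij_betw w {0..<?m} ?J"
    unfolding w_def using assms(2) card by (intro bij_betw_nth) auto
  have bv: "bij_betw (v \<circ> e) {0..<?m} ?J"
    using be bij_betw_trans[OF be inj_on_imp_bij_betw[OF assms(4)]] by simp
  define \<rho> where "\<rho> k = (if k < ?m then inv_into {0..<?m} w ((v \<circ> e) k) else k)" for k
  have "bij_betw (inv_into {0..<?m} w \<circ> (v \<circ> e)) {0..<?m} {0..<?m}"
    by (rule bij_betw_trans[OF bv bij_betw_inv_into[OF bw]])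
  then have "bij_betw \<rho> {0..<?m} {0..<?m}"
    by (rule bij_betw_cong[THEN iffD1, rotated]) (auto simp: \<rho>_def)
  then have \<rho>: "\<rho> permutes {0..<?m}"
    by (rule bij_imp_permutes) (auto simp: \<rho>_def)
  have "(v \<circ> e) k = (w \<circ> \<rho>) k" if "k < ?m" for k
  proof -
    have "(v \<circ> e) k \<in> w ` {0..<?m}" using that bv bw by (auto simp: bij_betw_def)
    from f_inv_into_f[OF this] show ?thesis using that by (simp add: \<rho>_def)
  qed
  then have "sym_minor ?m (v \<circ> e) e = sym_minor ?m (w \<circ> \<rho>) e"
    by (intro sym_minor_cong) auto
  then show ?thesis
    unfolding sym_minor_permute[OF \<rho>] F sym_minor_commute[of _ e w] by blast
qed

text \<open>The dichotomy behind antisymmetrising over \<open>I\<close>: either two elements of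
  \<open>I\<close> are joined, and exchanging them fixes the matching, or each i in \<open>I\<close>
  is joined to some v(i) outside \<open>I\<close>, and these arcs split off as a factor whose
  cofactor avoids \<open>I\<close>.\<close>

lemma arcs_decompose:
  fixes I :: "nat set" and l :: "nat list"
  assumes "distinct l" "even (length l)"
  shows "(\<exists>i j l'. i \<in> I \<inter> set l \<and> j \<in> I \<inter> set l \<and> i \<noteq> j \<and> i \<notin> set l' \<and> j \<notin> set l' \<and>
        arcs l = symvar i j * (arcs l' :: 'k::comm_ring_1 spoly)) \<or>
     (\<exists>v l'. inj_on v (I \<inter> set l) \<and> v ` (I \<inter> set l) \<inter> I = {} \<and> v ` (I \<inter> set l) \<subseteq> set l \<and>
        set l' \<subseteq> set l - I \<and>
        arcs l = (\<Prod>i\<in>I \<inter> set l. symvar i (v i)) * (arcs l' :: 'k spoly))"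
    (is "?P1 l \<or> ?P2 l")
  using assms
proof (induction l rule: arcs.induct)
  case 1
  show ?case by (intro disjI2 exI[of _ id] exI[of _ "[]"]) auto
next
  case (3 a b l)
  let ?X = "symvar :: nat \<Rightarrow> nat \<Rightarrow> 'k spoly"
  \<comment> \<open>In case \<open>one\<close>, \<open>c\<close> names the end of the first arc that
    lies in \<open>I\<close>, whichever it is; \<open>v\<close> is then extended by the value
    \<open>d\<close> at \<open>c\<close>.\<close>
  consider "a \<in> I" "b \<in> I" | "?P1 l" | (one) c d where "{a, b} = {c, d}" "c \<in> I" "d \<notin> I" "?P2 l"
    | (none) "a \<notin> I" "b \<notin> I" "?P2 l"
  proof -
    have or: "?P1 l \<or> ?P2 l" using 3 by simp
    show thesis
    proof (cases "?P1 l")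
      case False
      have P2: "?P2 l"
      proof (rule disjE[OF or])
        assume "?P1 l"
        with False show "?P2 l" by (rule notE)
      qed
      show thesis
      proof (cases "a \<in> I"; cases "b \<in> I")
        assume "a \<in> I" "b \<notin> I"
        show thesis by (rule that(3)[OF refl \<open>a \<in> I\<close> \<open>b \<notin> I\<close> P2])
      next
        assume "a \<notin> I" "b \<in> I"
        show thesis by (rule that(3)[OF insert_commute \<open>b \<in> I\<close> \<open>a \<notin> I\<close> P2])
      qed (use that(1) that(4)[OF _ _ P2] in blast)+
    qed (rule that(2))
  qed
  then show ?case
  proof cases
    assume "a \<in> I" "b \<in> I"
    with 3(2) show ?thesis by (intro disjI1 exI[of _ a] exI[of _ b] exI[of _ l]) auto
  next
    assume "?P1 l"
    then obtain i j l' where ij: "i \<in> I \<inter> set l" "j \<in> I \<inter> set l" "i \<noteq> j" "i \<notin> set l'" "j \<notin> set l'"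
      "arcs l = ?X i j * arcs l'" by blast
    then have "arcs (a # b # l) = ?X i j * arcs (a # b # l')" by (simp add: mult_ac)
    moreover have "i \<notin> set (a # b # l')" "j \<notin> set (a # b # l')" using ij 3(2) by auto
    moreover have "i \<in> I \<inter> set (a # b # l)" "j \<in> I \<inter> set (a # b # l)" using ij by auto
    ultimately show ?thesis using ij(3) by blast
  next
    case (one c d)
    then obtain v l' where v: "inj_on v (I \<inter> set l)" "v ` (I \<inter> set l) \<inter> I = {}" "v ` (I \<inter> set l) \<subseteq> set l"
      "set l' \<subseteq> set l - I" "arcs l = (\<Prod>i\<in>I \<inter> set l. ?X i (v i)) * arcs l'" by blast
    have cd: "c \<notin> set l" "d \<notin> set l" "I \<inter> set (a # b # l) = insert c (I \<inter> set l)"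
      using one(1-3) 3(2) by (auto simp: doubleton_eq_iff)
    have X: "?X a b = ?X c d" using one(1) by (auto simp: doubleton_eq_iff symvar_commute)
    let ?v = "v(c := d)"
    have img: "?v ` insert c (I \<inter> set l) = insert d (v ` (I \<inter> set l))"
      using cd by (auto simp: image_iff)
    have "d \<in> set (a # b # l)" using one(1) by auto
    moreover have "inj_on ?v (insert c (I \<inter> set l))"
      using v(1,3) cd by (auto simp: inj_on_def)
    moreover have "arcs (a # b # l) = (\<Prod>i\<in>insert c (I \<inter> set l). ?X i (?v i)) * arcs l'"
    proof -
      have "(\<Prod>i\<in>I \<inter> set l. ?X i (?v i)) = (\<Prod>i\<in>I \<inter> set l. ?X i (v i))"
        using cd by (intro prod.cong) auto
      then show ?thesis using cd v(5) by (simp add: X mult_ac)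
    qed
    moreover have "?v ` insert c (I \<inter> set l) \<inter> I = {}"
      unfolding img using v(2) one(3) by blast
    moreover have "set l' \<subseteq> set (a # b # l) - I" using v(4) by auto
    moreover have "v ` (I \<inter> set l) \<subseteq> set (a # b # l)" using v(3) by auto
    ultimately show ?thesis
      unfolding cd(3) using img by (intro disjI2 exI[of _ ?v] exI[of _ l'] conjI) (assumption | simp only: img insert_subset)+
  next
    case none
    then obtain v l' where v: "inj_on v (I \<inter> set l)" "v ` (I \<inter> set l) \<inter> I = {}" "v ` (I \<inter> set l) \<subseteq> set l"
      "set l' \<subseteq> set l - I" "arcs l = (\<Prod>i\<in>I \<inter> set l. ?X i (v i)) * arcs l'" by blast
    have "I \<inter> set (a # b # l) = I \<inter> set l" using none by auto
    then show ?thesis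
      by (intro disjI2 exI[of _ v] exI[of _ "a # b # l'"]) (use v none in \<open>auto simp: mult_ac\<close>)
  qed
qed auto

lemma two_mult_eq_0_spoly: "(2::'k::field) \<noteq> 0 \<Longrightarrow> f + f = 0 \<Longrightarrow> f = (0 :: 'k spoly)"
proof (rule poly_mapping_eqI)
  fix k assume "(2::'k) \<noteq> 0" "f + f = 0"
  then have "lookup f k + lookup f k = 0" by (simp flip: lookup_add)
  then show "lookup f k = lookup 0 k" using \<open>2 \<noteq> 0\<close> by (simp flip: mult_2)
qed

text \<open>Composition with the transposition pairs equal values with opposite signs, so the sum
  equals its own negative.\<close>

lemma sum_permutations_antisym:
  fixes f :: "(nat \<Rightarrow> nat) \<Rightarrow> 'k::field spoly"
  assumes two: "(2::'k) \<noteq> 0" and "x < m" "y < m" "x \<noteq> y"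
    and f: "\<And>q. q permutes {0..<m} \<Longrightarrow> f (q \<circ> transpose x y) = f q"
  shows "(\<Sum>q | q permutes {0..<m}. of_int (sign q) * f q) = 0"
proof (rule two_mult_eq_0_spoly[OF two])
  have t: "transpose x y permutes {0..<m}" using assms by (intro permutes_swap_id) auto
  have "(\<Sum>q | q permutes {0..<m}. of_int (sign q) * f q) =
      (\<Sum>q | q permutes {0..<m}. of_int (sign (q \<circ> transpose x y)) * f (q \<circ> transpose x y))"
    by (rule sum_permutations_compose_right[OF t])
  also have "\<dots> = (\<Sum>q | q permutes {0..<m}. - (of_int (sign q) * f q))"
  proof (intro sum.cong refl)
    fix q assume q: "q \<in> {q. q permutes {0..<m}}"
    then have "permutation q" using permutation_permutes by blast
    then have "sign (q \<circ> transpose x y) = - sign q"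
      using assms(4) by (subst sign_compose[OF _ permutation_swap_id]) (simp_all add: sign_swap_id)
    then show "of_int (sign (q \<circ> transpose x y)) * f (q \<circ> transpose x y) = - (of_int (sign q) * f q)"
      using f q by simp
  qed
  finally show "(\<Sum>q | q permutes {0..<m}. of_int (sign q) * f q) +
      (\<Sum>q | q permutes {0..<m}. of_int (sign q) * f q) = 0"
    by (simp add: sum_negf eq_neg_iff_add_eq_0)
qed

text \<open>The permutations of \<open>I\<close> are transported from positions by the sorted
  enumeration of \<open>I\<close>, because minors are sums over permutations of positions. There is
  no division by the group order.\<close>

definition antisymmetrize :: "nat set \<Rightarrow> 'k::comm_ring_1 spoly \<Rightarrow> 'k spoly" where
  "antisymmetrize I f = (let e = (!) (sorted_list_of_set I) in
     \<Sum>q | q permutes {0..<card I}. of_int (sign q) * rename (map_permutation {0..<card I} e q) f)"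

text \<open>
  An arc inside \<open>I\<close> is killed by antisymmetrising over \<open>I\<close>. If all arcs leave \<open>I\<close>, then
  their other ends come after \<open>I\<close>, so that antisymmetrising produces a minor \<open>F\<^sub>U\<close> up to sign.
\<close>

lemma antisymmetrize_arcs:
  fixes P :: "'k::field spoly set"
  assumes "sym_ideal P N" and two: "(2::'k) \<noteq> 0"
    and l: "distinct l" "even (length l)" "set l \<subseteq> {1..N}"
    and I: "I \<subseteq> set l" "card I = p - 1" "\<And>i b. i \<in> I \<Longrightarrow> b \<in> set l - I \<Longrightarrow> i < b"
    and F: "\<And>U. U \<in> F_index N p \<Longrightarrow> F_minor p U \<in> P"
  shows "antisymmetrize I (arcs l) \<in> P"
proof -
  interpret P: sym_ideal P N by fact
  let ?X = "symvar :: nat \<Rightarrow> nat \<Rightarrow> 'k spoly"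
  let ?m = "p - 1"
  define e where "e = (!) (sorted_list_of_set I)"
  have fin: "finite I" using I(1) finite_subset by blast
  have be: "bij_betw e {0..<?m} I"
    unfolding e_def using fin I(2) by (intro bij_betw_nth) auto
  then have inj: "inj_on e {0..<?m}" by (simp add: bij_betw_def)
  define R :: "(nat \<Rightarrow> nat) \<Rightarrow> 'k spoly \<Rightarrow> 'k spoly"
    where "R q = rename (map_permutation {0..<?m} e q)" for q
  have anti: "antisymmetrize I f = (\<Sum>q | q permutes {0..<?m}. of_int (sign q) * R q f)" for f :: "'k spoly"
    by (simp add: antisymmetrize_def e_def[symmetric] I(2) R_def)
  have II: "I \<inter> set l = I" using I(1) by auto
  from arcs_decompose[OF l(1,2), where ?'k = 'k and I = I, unfolded II]
  consider (inner) i j l' where "i \<in> I" "j \<in> I" "i \<noteq> j" "i \<notin> set l'" "j \<notin> set l'" "arcs l = ?X i j * arcs l'"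
    | (outer) v l' where "inj_on v I" "v ` I \<inter> I = {}" "v ` I \<subseteq> set l" "set l' \<subseteq> set l - I"
      "arcs l = (\<Prod>i\<in>I. ?X i (v i)) * arcs l'"
  proof (elim disjE exE conjE, goal_cases)
    case (1 i j l')
    from 1(3-) show ?case by (rule 1(1))
  next
    case (2 v l')
    from 2(3-) show ?case by (rule 2(2))
  qed
  then show ?thesis
  proof cases
    case inner
    have "i \<in> e ` {0..<?m}" "j \<in> e ` {0..<?m}"
      unfolding bij_betw_imp_surj_on[OF be] by (fact inner)+
    then obtain x y where xy: "x < ?m" "y < ?m" "e x = i" "e y = j" by fastforce
    have "R (q \<circ> transpose x y) (arcs l) = R q (arcs l :: 'k spoly)" if q: "q permutes {0..<?m}" for q
    proof -
      have t: "transpose x y permutes {0..<?m}" using xy by (intro permutes_swap_id) auto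
      have "map_permutation {0..<?m} e (q \<circ> transpose x y) =
          map_permutation {0..<?m} e q \<circ> transpose i j"
        using xy map_permutation_compose'[OF inj t] map_permutation_transpose[OF inj, of x y] by simp
      then show ?thesis
        unfolding R_def inner(6) rename_mult using inner(4,5)
        by (simp add: rename_arcs transpose_map_id symvar_commute flip: map_map)
    qed
    then have "antisymmetrize I (arcs l) = (0 :: 'k spoly)"
      unfolding anti using xy inner(3) by (intro sum_permutations_antisym[OF two, where x = x and y = y]) auto
    then show ?thesis by simp
  next
    case outer
    have less: "i < j" if "i \<in> I" "j \<in> v ` I" for i j
      using that outer(2,3) by (intro I(3)) auto
    \<comment> \<open>The permutation moves only \<open>I\<close>, while the values of
      \<open>v\<close> and the list \<open>l'\<close> lie outside \<open>I\<close>. Reindexing by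
      \<open>e\<close> yields the terms of the minor with rows \<open>v \<circ> e\<close> and
      columns \<open>e\<close>.\<close>
    have R: "R q (arcs l) = (\<Prod>k\<in>{0..<?m}. ?X ((v \<circ> e) k) (e (q k))) * arcs l'"
      if q: "q permutes {0..<?m}" for q
    proof -
      let ?s = "map_permutation {0..<?m} e q"
      have s: "?s permutes I" by (rule map_permutation_permutes[OF be q])
      have s_out: "?s x = x" if "x \<notin> I" for x using s that by (rule permutes_not_in)
      moreover have "?s (v x) = v x" if "x \<in> I" for x
        using that outer(2) by (intro s_out) blast
      ultimately have "R q (arcs l) = (\<Prod>i\<in>I. ?X (?s i) (v i)) * arcs l'"
        unfolding R_def outer(5) rename_mult rename_prod rename_arcs using outer(2,4)
        by (intro arg_cong2[where f = "(*)"] prod.cong arg_cong[where f = arcs] map_idI) auto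
      also have "(\<Prod>i\<in>I. ?X (?s i) (v i)) = (\<Prod>k\<in>{0..<?m}. ?X (?s (e k)) (v (e k)))"
        by (rule prod.reindex_bij_betw[OF be, symmetric])
      also have "\<dots> = (\<Prod>k\<in>{0..<?m}. ?X ((v \<circ> e) k) (e (q k)))"
        by (intro prod.cong refl, subst map_permutation_apply[OF inj], assumption)
          (simp add: symvar_commute)
      finally show ?thesis .
    qed
    have "antisymmetrize I (arcs l) = sym_minor ?m (v \<circ> e) e * (arcs l' :: 'k spoly)"
      unfolding anti sym_minor_def sum_distrib_right
      by (intro sum.cong refl) (simp add: R mult.assoc)
    moreover obtain s where "sym_minor ?m (v \<circ> e) e = of_int s * (F_minor p (I \<union> v ` I) :: 'k spoly)"
      using sym_minor_matching_eq_F_minor[OF fin I(2) outer(1) less, where ?'k = 'k] unfolding e_def by blast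
    moreover have "I \<union> v ` I \<in> F_index N p"
    proof -
      have "card (I \<union> v ` I) = ?m + ?m"
        using fin outer(1,2) I(2) by (subst card_Un_disjoint) (auto simp: card_image)
      then show ?thesis using I(1) l(3) outer(3) by (auto simp: F_index_def)
    qed
    moreover have "arcs l' \<in> (polys N :: 'k spoly set)" using outer(4) l(3) by (intro arcs_polys) auto
    moreover from calculation(3) have "of_int s * F_minor p (I \<union> v ` I) \<in> P"
      by (intro P.mult_mem F polys_of_int)
    ultimately show ?thesis
      by (simp add: P.mult_mem')
  qed
qed

lemma antisymmetrize_matchings:
  fixes P :: "'k::field spoly set"
  assumes "sym_ideal P N" and two: "(2::'k) \<noteq> 0"
    and "g \<in> matchings B" "B \<subseteq> {1..N}"
    and I: "I \<subseteq> B" "card I = p - 1" "\<And>i b. i \<in> I \<Longrightarrow> b \<in> B - I \<Longrightarrow> i < b"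
    and F: "\<And>U. U \<in> F_index N p \<Longrightarrow> F_minor p U \<in> P"
  shows "antisymmetrize I g \<in> P"
  using assms(3)
proof (induction rule: matchings.induct)
  case (matchings_arcs l)
  with assms show ?case by (intro antisymmetrize_arcs[OF assms(1) two]) auto
next
  case matchings_0
  show ?case using sym_ideal.zero_mem[OF assms(1)] by (simp add: antisymmetrize_def)
next
  case (matchings_add f g)
  have "antisymmetrize I (f + g) = antisymmetrize I f + antisymmetrize I g"
    by (simp add: antisymmetrize_def Let_def rename_add algebra_simps sum.distrib)
  with sym_ideal.add_mem[OF assms(1) matchings_add.IH] show ?case by simp
next
  case (matchings_const_mult f c)
  have "antisymmetrize I (const c * f) = const c * antisymmetrize I f"
    by (simp add: antisymmetrize_def Let_def rename_mult sum_distrib_left mult.left_commute)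
  with sym_ideal.const_mult_mem[OF assms(1) matchings_const_mult.IH] show ?case by simp
qed

subsection \<open>The multigrading by the indices\<close>

text \<open>The multidegree in the row and column indices, in which a diagonal variable counts
  twice.\<close>

definition wt :: "expo \<Rightarrow> nat \<Rightarrow> nat" where
  "wt s i = (\<Sum>v\<in>keys s. lookup s v * (of_bool (fst v = i) + of_bool (snd v = i)))"

lemma wt_add: "wt (s + t) i = wt s i + wt t i"
proof -
  let ?A = "keys s \<union> keys t"
  have *: "wt r i = (\<Sum>v\<in>?A. lookup r v * (of_bool (fst v = i) + of_bool (snd v = i)))"
    if "keys r \<subseteq> ?A" for r
    unfolding wt_def using that by (intro sum.mono_neutral_left) (auto simp: in_keys_iff)
  show ?thesis
    by (simp add: * keys_add lookup_add algebra_simps sum.distrib)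
qed

lemma wt_0 [simp]: "wt 0 i = 0"
  by (simp add: wt_def)

lemma wt_single [simp]: "wt (single v n) i = n * (of_bool (fst v = i) + of_bool (snd v = i))"
  by (simp add: wt_def)

lemma lookup_le_wt: "lookup s v \<le> wt s (fst v)"
proof (cases "v \<in> keys s")
  case True
  then have "lookup s v * (of_bool (fst v = fst v) + of_bool (snd v = fst v)) \<le> wt s (fst v)"
    unfolding wt_def by (intro member_le_sum) auto
  then show ?thesis by simp
qed (auto simp: in_keys_iff)

lemma wt_eq_0_imp: "(\<And>i. wt s i = 0) \<Longrightarrow> s = 0"
  by (rule poly_mapping_eqI) (metis le_zero_eq lookup_le_wt lookup_zero)

definition has_wt :: "(nat \<Rightarrow> nat) \<Rightarrow> 'k::comm_ring_1 spoly \<Rightarrow> bool" where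
  "has_wt \<delta> f \<longleftrightarrow> (\<forall>s\<in>keys f. wt s = \<delta>)"

lemma has_wt_mult: "has_wt \<delta> f \<Longrightarrow> has_wt \<epsilon> g \<Longrightarrow> has_wt (\<lambda>i. \<delta> i + \<epsilon> i) (f * g)"
  unfolding has_wt_def using keys_mult[of f g] by (fastforce simp: wt_add fun_eq_iff)

lemma has_wt_sum: "(\<And>x. x \<in> A \<Longrightarrow> has_wt \<delta> (f x)) \<Longrightarrow> has_wt \<delta> (sum f A)"
proof (induction A rule: infinite_finite_induct)
  case (insert x A)
  then show ?case using keys_add[of "f x" "sum f A"] by (fastforce simp: has_wt_def)
qed (auto simp: has_wt_def)

lemma has_wt_const: "has_wt (\<lambda>_. 0) (const c)"
  by (auto simp: has_wt_def const_def fun_eq_iff)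

lemma has_wt_of_int: "has_wt (\<lambda>_. 0) (of_int c)"
  using has_wt_const[of "of_int c"] by (simp add: const_of_int)

lemma has_wt_symvar: "has_wt (\<lambda>x. of_bool (i = x) + of_bool (j = x)) (symvar i j)"
  by (auto simp: has_wt_def symvar_def fun_eq_iff min_def max_def)

lemma has_wt_prod: "finite A \<Longrightarrow> (\<And>x. x \<in> A \<Longrightarrow> has_wt (\<delta> x) (f x)) \<Longrightarrow>
    has_wt (\<lambda>i. \<Sum>x\<in>A. \<delta> x i) (prod f A)"
proof (induction A rule: finite_induct)
  case empty
  show ?case using has_wt_const[of 1] by simp
next
  case (insert x A)
  then show ?case using has_wt_mult[of "\<delta> x" "f x"] by simp
qed

text \<open>Reordering the columns does not change how often an index occurs, so all terms of the
  expansion share one weight.\<close>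

lemma has_wt_sym_minor:
  "has_wt (\<lambda>x. card {k\<in>{0..<m}. a k = x} + card {k\<in>{0..<m}. b k = x}) (sym_minor m a b)"
  unfolding sym_minor_def
proof (rule has_wt_sum)
  fix p assume "p \<in> {p. p permutes {0..<m}}"
  then have p: "p permutes {0..<m}" by simp
  have "has_wt (\<lambda>x. 0 + (\<Sum>k\<in>{0..<m}. of_bool (a k = x) + of_bool (b (p k) = x)))
      (of_int (sign p) * (\<Prod>k\<in>{0..<m}. symvar (a k) (b (p k))))"
    by (intro has_wt_mult has_wt_of_int has_wt_prod has_wt_symvar) auto
  moreover have "(\<Sum>k\<in>{0..<m}. of_bool (b (p k) = x)) = (\<Sum>k\<in>{0..<m}. of_bool (b k = x) :: nat)" for x
    using sum.permute[OF p, of "\<lambda>k. of_bool (b k = x) :: nat"] by (simp add: comp_def)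
  ultimately show "has_wt (\<lambda>x. card {k\<in>{0..<m}. a k = x} + card {k\<in>{0..<m}. b k = x})
      (of_int (sign p) * (\<Prod>k\<in>{0..<m}. symvar (a k) (b (p k))))"
    by (simp add: sum.distrib sum_of_bool_eq Int_def)
qed

lemma has_wt_sym_det: "has_wt (\<lambda>x. if x \<in> {1..N} then 2 else 0) (sym_det N)"
proof -
  have "card {k\<in>{0..<N}. Suc k = x} = of_bool (x \<in> {1..N})" for x
  proof (cases "x \<in> {1..N}")
    case True
    then have "{k\<in>{0..<N}. Suc k = x} = {x - 1}" by auto
    with True show ?thesis by simp
  next
    case False
    then have "{k\<in>{0..<N}. Suc k = x} = {}" by auto
    with False show ?thesis by (simp only: card.empty of_bool_eq)
  qed
  then have "(\<lambda>x. card {k\<in>{0..<N}. Suc k = x} + card {k\<in>{0..<N}. Suc k = x}) =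
      (\<lambda>x. if x \<in> {1..N} then 2 else 0)"
    by (simp add: fun_eq_iff)
  with has_wt_sym_minor[of N Suc Suc] show ?thesis
    by (simp add: sym_det_eq_sym_minor)
qed

lemma has_wt_F_minor:
  assumes "U \<in> F_index N p"
  shows "has_wt (\<lambda>x. of_bool (x \<in> U)) (F_minor p U)"
proof -
  let ?u = "sorted_list_of_set U" and ?m = "p - 1"
  have U: "finite U" "card U = ?m + ?m"
    using assms by (auto simp: F_index_def intro: finite_subset)
  have len: "length ?u = ?m + ?m" using U by simp
  have 1: "card {k\<in>{0..<n + n}. f k = x} = card {k\<in>{0..<n}. f k = x} + card {k\<in>{0..<n}. f (n + k) = x}"
    for f :: "nat \<Rightarrow> nat" and x n
  proof -
    have "(\<Sum>k\<in>{0..<n + n}. of_bool (f k = x)) =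
        (\<Sum>k\<in>{0..<n}. of_bool (f k = x)) + (\<Sum>k\<in>{0..<n}. of_bool (f (n + k) = x) :: nat)"
      using sum.atLeastLessThan_concat[of 0 n "n + n" "\<lambda>k. of_bool (f k = x) :: nat"]
        sum.shift_bounds_nat_ivl[of "\<lambda>k. of_bool (f k = x) :: nat" 0 n n]
      by (simp add: add.commute)
    then show ?thesis by (simp add: sum_of_bool_eq Int_def)
  qed
  have 2: "card {k\<in>{0..<?m + ?m}. ?u ! k = x} = of_bool (x \<in> U)" for x
  proof (cases "x \<in> U")
    case True
    then obtain k where k: "k < length ?u" "?u ! k = x"
      using U by (metis in_set_conv_nth set_sorted_list_of_set)
    then have "{k\<in>{0..<?m + ?m}. ?u ! k = x} = {k}"
      using len distinct_sorted_list_of_set[of U] by (auto simp: nth_eq_iff_index_eq)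
    with True show ?thesis by simp
  next
    case False
    have "?u ! k \<in> U" if "k < ?m + ?m" for k
      using that len U by (metis nth_mem set_sorted_list_of_set)
    with False have "{k\<in>{0..<?m + ?m}. ?u ! k = x} = {}" by fastforce
    with False show ?thesis by (simp only: card.empty of_bool_eq)
  qed
  have "(\<lambda>x. card {k\<in>{0..<?m}. ?u ! k = x} + card {k\<in>{0..<?m}. ?u ! (?m + k) = x}) = (\<lambda>x. of_bool (x \<in> U))"
    unfolding fun_eq_iff 1[symmetric] 2 by simp
  then show ?thesis
    using has_wt_sym_minor[of ?m "(!) ?u" "\<lambda>j. ?u ! (?m + j)"] by (simp add: F_minor_eq_sym_minor)
qed

lemma keys_diff_op_wt:
  assumes "t \<in> keys (diff_op f h)" "has_wt \<delta> f" "has_wt \<epsilon> h"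
  shows "\<delta> i + wt t i = \<epsilon> i"
  using keys_diff_op[OF assms(1)] assms(2,3) by (force simp: has_wt_def wt_add)

subsection \<open>Normal forms modulo the quadrics\<close>

definition diag :: "nat set \<Rightarrow> 'k::comm_ring_1 spoly" where
  "diag A = (\<Prod>i\<in>A. symvar i i)"

lemma diag_polys: "A \<subseteq> {1..N} \<Longrightarrow> diag A \<in> polys N"
  unfolding diag_def by (intro polys_prod polys_symvar) auto

lemma diag_empty [simp]: "diag {} = 1"
  by (simp add: diag_def)

lemma diag_insert: "finite A \<Longrightarrow> i \<notin> A \<Longrightarrow> diag (insert i A) = symvar i i * diag A"
  by (simp add: diag_def)

lemma diag_Un_disjoint: "finite A \<Longrightarrow> finite B \<Longrightarrow> A \<inter> B = {} \<Longrightarrow> diag (A \<union> B) = diag A * diag B"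
  by (simp add: diag_def prod.union_disjoint)

text \<open>The arc ik at \<open>i\<close> is replaced by jk at the cost of \<open>- d_ii\<close>:
  the index \<open>i\<close> is used up, and \<open>j\<close> takes its place in the
  matching.\<close>

lemma matchings_pick:
  assumes "g \<in> matchings B" "B \<subseteq> {1..N}" "i \<in> B" "j \<in> {1..N}" "j \<notin> B"
  shows "\<exists>h \<in> matchings (insert j (B - {i})).
     symvar i j * g + symvar i i * h \<in> (Q_ideal N :: 'k::comm_ring_1 spoly set)"
  using assms(1)
proof (induction rule: matchings.induct)
  case (matchings_arcs l)
  obtain k l' where k: "arcs l = symvar i k * (arcs l' :: 'k spoly)" "distinct (i # k # l')"
      "set (i # k # l') = B" "even (length l')"
    using arcs_pick[OF matchings_arcs(1,3)] assms matchings_arcs(2) by blast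
  have "insert j (B - {i}) = set (j # k # l')" "distinct (j # k # l')" "{i, j, k} \<subseteq> {1..N}"
    "set l' \<subseteq> {1..N}" "distinct [i, j, k]"
    using k(2,3) assms(2-5) by auto
  moreover from this have "(symvar i j * symvar i k + symvar i i * symvar j k) * arcs l' \<in> (Q_ideal N :: 'k spoly set)"
    by (intro Q.mult_mem' Q_rels arcs_polys)
  ultimately show ?case
    using k(4) matchings.matchings_arcs[of "j # k # l'" "insert j (B - {i})"]
    by (intro bexI[of _ "arcs (j # k # l')"]) (auto simp: k(1) algebra_simps)
next
  case matchings_0
  show ?case by (rule bexI[of _ 0]) (auto intro: matchings.intros)
next
  case (matchings_add f g)
  then obtain c d where c: "c \<in> matchings (insert j (B - {i}))" "symvar i j * f + symvar i i * c \<in> Q_ideal N"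
    and d: "d \<in> matchings (insert j (B - {i}))" "symvar i j * g + symvar i i * d \<in> Q_ideal N" by blast
  show ?case
    by (rule bexI[OF _ matchings.matchings_add[OF c(1) d(1)]])
      (use Q.add_mem[OF c(2) d(2)] in \<open>simp add: algebra_simps\<close>)
next
  case (matchings_const_mult f r)
  then obtain c where c: "c \<in> matchings (insert j (B - {i}))"
      "symvar i j * f + symvar i i * c \<in> Q_ideal N" by blast
  show ?case
    by (rule bexI[OF _ matchings.matchings_const_mult[OF c(1), of r]])
      (use Q.const_mult_mem[OF c(2), of r] in \<open>simp add: algebra_simps\<close>)
qed

text \<open>The relation \<open>d_ii d_ik\<close> applies to the arc at \<open>i\<close>; the weight
  at \<open>i\<close> would be 3.\<close>

lemma matchings_diag_kill:
  assumes "g \<in> matchings B" "B \<subseteq> {1..N}" "i \<in> B"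
  shows "symvar i i * g \<in> (Q_ideal N :: 'k::comm_ring_1 spoly set)"
  using assms(1)
proof (induction rule: matchings.induct)
  case (matchings_arcs l)
  obtain k l' where k: "arcs l = symvar i k * (arcs l' :: 'k spoly)" "distinct (i # k # l')"
      "set (i # k # l') = B" "even (length l')"
    using arcs_pick[OF matchings_arcs(1,3)] assms matchings_arcs(2) by blast
  have "{i, k} \<subseteq> {1..N}" "i \<noteq> k" "set l' \<subseteq> {1..N}"
    using k(2) assms(2) unfolding k(3)[symmetric] by auto
  then have "(symvar i i * symvar i k) * arcs l' \<in> (Q_ideal N :: 'k spoly set)"
    by (intro Q.mult_mem' Q_rels arcs_polys)
  then show ?case by (simp add: k(1) mult.assoc)
next
  case (matchings_add f g)
  then show ?case by (simp add: distrib_left Q.add_mem)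
next
  case (matchings_const_mult f c)
  then show ?case by (simp add: mult.left_commute[of _ "const c"] Q.const_mult_mem)
qed auto

lemma matchings_new_arc:
  assumes "g \<in> matchings B" "i \<notin> B" "j \<notin> B" "i \<noteq> j"
  shows "symvar i j * g \<in> matchings (insert i (insert j B))"
  using assms(1)
proof (induction rule: matchings.induct)
  case (matchings_arcs l)
  then show ?case
    using matchings.matchings_arcs[of "i # j # l" "insert i (insert j B)"] assms by simp
next
  case (matchings_add f g)
  then show ?case by (simp add: distrib_left matchings.matchings_add)
next
  case (matchings_const_mult f c)
  then show ?case by (simp add: mult.left_commute[of _ "const c"] matchings.matchings_const_mult)
qed (auto intro: matchings.intros)

lemma wt_eq_0_outside: "keys s \<subseteq> indices N \<Longrightarrow> i \<notin> {1..N} \<Longrightarrow> wt s i = 0"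
  unfolding wt_def by (intro sum.neutral) (force simp: indices_def)

text \<open>An index whose weight would exceed 2 makes the product vanish in S/Q. Otherwise, for i
  \<noteq> j, the number of ends of the new arc in \<open>B\<close> decides: none gives a new arc,
  one a rewired arc (\<open>matchings_pick\<close>), two a contraction. For i = j a diagonal
  variable is added.\<close>

lemma monomial_normal_form_step:
  fixes g :: "'k::comm_ring_1 spoly" and \<delta> \<delta>' :: "nat \<Rightarrow> nat"
  assumes g: "g \<in> matchings B" and AB: "A \<inter> B = {}" "A \<subseteq> {1..N}" "B \<subseteq> {1..N}"
    and ij: "i \<in> {1..N}" "j \<in> {1..N}"
    and wt: "A = {x. \<delta> x = 2}" "B = {x. \<delta> x = 1}" "\<And>x. \<delta> x \<le> 2"
    and \<delta>': "\<And>x. \<delta>' x = of_bool (i = x) + of_bool (j = x) + \<delta> x"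
  shows "if \<forall>x. \<delta>' x \<le> 2 then \<exists>h\<in>matchings {x. \<delta>' x = 1}.
      symvar i j * (diag A * g) - diag {x. \<delta>' x = 2} * h \<in> Q_ideal N
    else symvar i j * (diag A * g) \<in> Q_ideal N"
proof -
  have fin: "finite A" "finite B" using AB finite_subset by blast+
  have gN: "g \<in> polys N" using g AB(3) by (rule matchings_polys)
  have dA: "(diag X :: 'k spoly) \<in> polys N" if "X \<subseteq> A" for X using AB(2) that by (intro diag_polys) auto
  have big: "symvar i j * (diag A * g) \<in> Q_ideal N"
    if k: "i \<in> A \<or> j \<in> A" and ij: "i \<in> {1..N}" "j \<in> {1..N}" for i j
  proof -
    have *: "symvar a b * (diag A * g) \<in> Q_ideal N" if "a \<in> A" "b \<in> {1..N}" for a b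
    proof -
      have "diag A = symvar a a * (diag (A - {a}) :: 'k spoly)"
        using that fin diag_insert[of "A - {a}" a] by (simp add: insert_absorb)
      then have eq: "symvar a b * (diag A * g) = (symvar a a * symvar a b) * (diag (A - {a}) * g)"
        by (simp add: mult_ac)
      have rel: "symvar a a * symvar a b \<in> (Q_ideal N :: 'k spoly set)"
      proof (cases "a = b")
        case True
        then show ?thesis using Q_rels(1)[of a N] that AB(2) by (auto simp: power2_eq_square)
      next
        case False
        then show ?thesis using that AB(2) by (intro Q_rels) auto
      qed
      show ?thesis unfolding eq by (rule Q.mult_mem'[OF rel polys_mult[OF dA gN]]) blast
    qed
    show ?thesis
    proof (cases "i \<in> A")
      case True
      from *[OF this ij(2)] show ?thesis .
    next
      case False
      with k have "j \<in> A" by blast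
      from *[OF this ij(1)] show ?thesis by (simp add: symvar_commute)
    qed
  qed
  have mem: "diag A * f \<in> Q_ideal N" if "f \<in> Q_ideal N" for f :: "'k spoly"
    using that by (rule Q.mult_mem[OF dA[OF subset_refl]])
  have half: "\<exists>h\<in>matchings (insert j (B - {i})).
      symvar i j * (diag A * g) - diag (insert i A) * h \<in> Q_ideal N"
    if hyp: "i \<in> B" "j \<notin> B" "j \<in> {1..N}" for i j
  proof -
    obtain h where h: "h \<in> matchings (insert j (B - {i}))" "symvar i j * g + symvar i i * h \<in> Q_ideal N"
      using matchings_pick[OF g AB(3) hyp(1,3,2)] by blast
    have "diag (insert i A) = symvar i i * (diag A :: 'k spoly)"
      using that AB(1) fin by (intro diag_insert) auto
    then have "symvar i j * (diag A * g) - diag (insert i A) * (const (-1) * h) =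
        diag A * (symvar i j * g + symvar i i * h)"
      by (simp add: algebra_simps const_uminus)
    with mem[OF h(2)] show ?thesis
      by (intro bexI[OF _ matchings.matchings_const_mult[OF h(1), of "-1"]]) simp
  qed
  show ?thesis
  proof (cases "i \<in> A \<or> j \<in> A")
    case True
    then have "\<delta>' i > 2 \<or> \<delta>' j > 2" by (auto simp: \<delta>' wt)
    then have nle: "\<not> (\<forall>x. \<delta>' x \<le> 2)" by (meson not_le)
    show ?thesis unfolding if_not_P[OF nle] by (rule big[OF True ij])
  next
    case nA: False
    show ?thesis
    proof (cases "i = j")
      case True
      show ?thesis
      proof (cases "i \<in> B")
        case True
        then have "\<not> \<delta>' i \<le> 2" using \<open>i = j\<close> by (simp add: \<delta>' wt)
        then have nle: "\<not> (\<forall>x. \<delta>' x \<le> 2)" by blast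
        have "symvar i j * (diag A * g) = diag A * (symvar i i * g)"
          by (simp add: mult_ac \<open>i = j\<close>)
        with mem[OF matchings_diag_kill[OF g AB(3) True]] show ?thesis
          unfolding if_not_P[OF nle] by simp
      next
        case False
        then have 0: "\<delta> i = 0" using nA wt(3)[of i] by (auto simp: wt(1,2))
        have sets: "{x. \<delta>' x = 2} = insert i A" "{x. \<delta>' x = 1} = B" "\<forall>x. \<delta>' x \<le> 2"
          using 0 wt(3) \<open>i = j\<close> by (auto simp: \<delta>' wt)
        have "diag (insert i A) = symvar i i * (diag A :: 'k spoly)"
          using nA fin by (intro diag_insert) auto
        then show ?thesis unfolding sets(1,2) if_P[OF sets(3)]
          by (intro bexI[OF _ g]) (simp add: \<open>i = j\<close> mult.assoc)
      qed
    next
      case ne: False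
      have le: "\<forall>x. \<delta>' x \<le> 2"
      proof
        fix x show "\<delta>' x \<le> 2"
          using wt(3)[of x] nA ne by (cases "x = i \<or> x = j") (auto simp: \<delta>' wt(1,2) le_less)
      qed
      have d: "\<delta>' i = Suc (\<delta> i)" "\<delta>' j = Suc (\<delta> j)" "\<And>x. x \<noteq> i \<Longrightarrow> x \<noteq> j \<Longrightarrow> \<delta>' x = \<delta> x"
        using ne by (auto simp: \<delta>')
      have val: "\<delta> i = of_bool (i \<in> B)" "\<delta> j = of_bool (j \<in> B)"
        using nA wt(3)[of i] wt(3)[of j] by (auto simp: wt(1,2))
      have two: "{x. \<delta>' x = 2} = A \<union> ({i, j} \<inter> B)"
      proof (rule Set.set_eqI)
        fix x show "x \<in> {x. \<delta>' x = 2} \<longleftrightarrow> x \<in> A \<union> ({i, j} \<inter> B)"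
        proof (cases "x = i \<or> x = j")
          case True
          then show ?thesis using ne nA by (elim disjE) (auto simp: d(1,2) val)
        next
          case False
          moreover have "x \<in> A \<longleftrightarrow> \<delta> x = 2" by (simp add: wt(1))
          ultimately show ?thesis using d(3)[of x] by simp
        qed
      qed
      have one: "{x. \<delta>' x = 1} = (B - {i, j}) \<union> ({i, j} - B)"
      proof (rule Set.set_eqI)
        fix x show "x \<in> {x. \<delta>' x = 1} \<longleftrightarrow> x \<in> (B - {i, j}) \<union> ({i, j} - B)"
        proof (cases "x = i \<or> x = j")
          case True
          then show ?thesis using ne by (elim disjE) (auto simp: d(1,2) val)
        next
          case False
          moreover have "x \<in> B \<longleftrightarrow> \<delta> x = 1" by (simp add: wt(2))
          ultimately show ?thesis using d(3)[of x] by simp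
        qed
      qed
      consider (none) "i \<notin> B" "j \<notin> B" | (left) "i \<in> B" "j \<notin> B" | (right) "i \<notin> B" "j \<in> B"
        | (both) "i \<in> B" "j \<in> B"
        by blast
      then have "\<exists>h\<in>matchings {x. \<delta>' x = 1}.
          symvar i j * (diag A * g) - diag {x. \<delta>' x = 2} * h \<in> Q_ideal N"
      proof cases
        case none
        then have sets: "{x. \<delta>' x = 2} = A" "{x. \<delta>' x = 1} = insert i (insert j B)"
          unfolding one two by auto
        show ?thesis unfolding sets
          by (rule bexI[OF _ matchings_new_arc[OF g none ne]]) (simp add: mult_ac)
      next
        case left
        then have sets: "{x. \<delta>' x = 2} = insert i A" "{x. \<delta>' x = 1} = insert j (B - {i})"
          unfolding one two using ne by auto
        show ?thesis unfolding sets using half[OF left ij(2)] .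
      next
        case right
        then have sets: "{x. \<delta>' x = 2} = insert j A" "{x. \<delta>' x = 1} = insert i (B - {j})"
          unfolding one two using ne by auto
        show ?thesis unfolding sets symvar_commute[of i j] using half[OF right(2,1) ij(1)] .
      next
        case both
        then have sets: "{x. \<delta>' x = 2} = insert i (insert j A)" "{x. \<delta>' x = 1} = B - {i, j}"
          unfolding one two by auto
        obtain c where c: "c \<in> matchings (B - {i, j})"
            "symvar i j * g - symvar i i * symvar j j * c \<in> Q_ideal N"
          using contraction[OF g AB(3) both ne] by blast
        have "diag (insert i (insert j A)) = symvar i i * symvar j j * (diag A :: 'k spoly)"
          using nA fin ne by (simp add: diag_insert mult.assoc)
        then have "symvar i j * (diag A * g) - diag (insert i (insert j A)) * c =
            diag A * (symvar i j * g - symvar i i * symvar j j * c)"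
          by (simp add: algebra_simps)
        with mem[OF c(2)] show ?thesis unfolding sets
          by (intro bexI[OF _ c(1)]) simp
      qed
      then show ?thesis unfolding if_P[OF le] .
    qed
  qed
qed

lemma monomial_normal_form:
  assumes "keys s \<subseteq> indices N"
  shows "if \<forall>x. wt s x \<le> 2 then \<exists>g\<in>matchings {x. wt s x = 1}.
      single s (1::'k) - diag {x. wt s x = 2} * g \<in> Q_ideal N
    else single s (1::'k::comm_ring_1) \<in> Q_ideal N"
  using assms
proof (induction s rule: expo_induct)
  case zero
  have "(1 :: 'k spoly) \<in> matchings {}"
    using matchings.matchings_arcs[of "[]" "{}"] by simp
  then show ?case by (auto intro!: bexI[of _ 1])
next
  case (add v s)
  obtain i j where v: "v = (i, j)" by (cases v)
  have keys: "keys (single v 1 + s) = insert v (keys s)"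
    by (auto simp: in_keys_iff lookup_add lookup_single when_def split: if_splits)
  then have sN: "keys s \<subseteq> indices N" and "v \<in> indices N" using add.prems by auto
  then have ij: "i \<in> {1..N}" "j \<in> {1..N}" "i \<le> j" by (auto simp: v indices_def)
  have s: "single (single v 1 + s) (1::'k) = symvar i j * single s 1"
    using ij(3) by (simp add: symvar_def v mult_single)
  have wt': "wt (single v 1 + s) x = of_bool (i = x) + of_bool (j = x) + wt s x" for x
    unfolding wt_add wt_single by (simp add: v)
  have out: "x \<in> {1..N}" if "wt s x \<noteq> 0" for x
    using that wt_eq_0_outside[OF sN] by (rule contrapos_np)
  show ?case
  proof (cases "\<forall>x. wt s x \<le> 2")
    case False
    then have nle: "\<not> (\<forall>x. wt (single v 1 + s) x \<le> 2)" unfolding wt' by (meson le_add2 le_trans)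
    have "symvar i j * single s (1::'k) \<in> Q_ideal N"
      using add.IH[OF sN] False ij by (intro Q.mult_mem polys_symvar) auto
    then show ?thesis unfolding s if_not_P[OF nle] .
  next
    case True
    then obtain g where g: "g \<in> matchings {x. wt s x = 1}"
        "single s (1::'k) - diag {x. wt s x = 2} * g \<in> Q_ideal N"
      using add.IH[OF sN] by auto
    have "symvar i j * (single s (1::'k) - diag {x. wt s x = 2} * g) \<in> Q_ideal N"
      using g(2) ij by (intro Q.mult_mem polys_symvar) auto
    then have red: "symvar i j * single s (1::'k) - symvar i j * (diag {x. wt s x = 2} * g) \<in> Q_ideal N"
      by (simp add: right_diff_distrib)
    have sub: "{x. wt s x = 2} \<subseteq> {1..N}" "{x. wt s x = 1} \<subseteq> {1..N}" using out by auto
    have step: "if \<forall>x. wt (single v 1 + s) x \<le> 2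
      then \<exists>h\<in>matchings {x. wt (single v 1 + s) x = 1}.
        symvar i j * (diag {x. wt s x = 2} * g) - diag {x. wt (single v 1 + s) x = 2} * h \<in> Q_ideal N
      else symvar i j * (diag {x. wt s x = 2} * g) \<in> Q_ideal N"
      by (rule monomial_normal_form_step[OF g(1) _ sub ij(1,2) refl refl _ wt']) (use True in auto)
    show ?thesis
    proof (cases "\<forall>x. wt (single v 1 + s) x \<le> 2")
      case True
      with step obtain h where h: "h \<in> matchings {x. wt (single v 1 + s) x = 1}"
        "symvar i j * (diag {x. wt s x = 2} * g) - diag {x. wt (single v 1 + s) x = 2} * h \<in> Q_ideal N"
        by (simp del: One_nat_def) blast
      from Q.add_mem[OF red h(2)]
      have "single (single v 1 + s) 1 - diag {x. wt (single v 1 + s) x = 2} * h \<in> Q_ideal N"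
        unfolding s by (simp del: One_nat_def)
      with h(1) have "\<exists>h\<in>matchings {x. wt (single v 1 + s) x = 1}.
        single (single v 1 + s) (1::'k) - diag {x. wt (single v 1 + s) x = 2} * h \<in> Q_ideal N"
        by (intro bexI[of _ h])
      then show ?thesis unfolding if_P[OF True] .
    next
      case False
      with step have "symvar i j * (diag {x. wt s x = 2} * g) \<in> Q_ideal N" by (simp only: if_not_P if_False)
      from Q.add_mem[OF red this] have "single (single v 1 + s) (1::'k) \<in> Q_ideal N" unfolding s by simp
      then show ?thesis unfolding if_not_P[OF False] .
    qed
  qed
qed

text \<open>The two index sets of the normal form depend only on the weight, so the matchings of the
  monomials of \<open>f\<close> have a common diagonal factor and can be added.\<close>

lemma weighted_normal_form:
  fixes f :: "'k::comm_ring_1 spoly"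
  assumes "f \<in> polys N" "has_wt \<delta> f"
  shows "f \<in> Q_ideal N \<or> (\<exists>g\<in>matchings {x. \<delta> x = 1}. f - diag {x. \<delta> x = 2} * g \<in> Q_ideal N)"
proof (cases "\<forall>x. \<delta> x \<le> 2")
  case False
  have "single s (lookup f s) \<in> Q_ideal N" if s: "s \<in> keys f" for s
  proof -
    have "wt s = \<delta>" "keys s \<subseteq> indices N" using s assms by (auto simp: has_wt_def polys_def)
    with False monomial_normal_form[of s N, where ?'k = 'k] have "single s (1::'k) \<in> Q_ideal N" by simp
    from Q.const_mult_mem[OF this, of "lookup f s"] show ?thesis by (simp add: const_def mult_single)
  qed
  then have "f \<in> Q_ideal N" by (subst poly_mapping_as_sum) (rule Q.sum_mem)
  then show ?thesis by blast
next
  case True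
  let ?P = "\<lambda>f. \<exists>g\<in>matchings {x. \<delta> x = 1}. f - diag {x. \<delta> x = 2} * g \<in> Q_ideal N"
  have "?P (\<Sum>s\<in>A. single s (lookup f s))" if "finite A" "A \<subseteq> keys f" for A
    using that
  proof (induction A rule: finite_induct)
    case empty
    show ?case by (rule bexI[of _ 0]) (auto intro: matchings.intros)
  next
    case (insert s A)
    then obtain g where g: "g \<in> matchings {x. \<delta> x = 1}"
      "(\<Sum>s\<in>A. single s (lookup f s)) - diag {x. \<delta> x = 2} * g \<in> Q_ideal N" by auto
    have "wt s = \<delta>" "keys s \<subseteq> indices N" using insert assms by (auto simp: has_wt_def polys_def)
    with True monomial_normal_form[of s N, where ?'k = 'k] obtain h where h:
      "h \<in> matchings {x. \<delta> x = 1}" "single s (1::'k) - diag {x. \<delta> x = 2} * h \<in> Q_ideal N" by auto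
    let ?h = "const (lookup f s) * h"
    have "single s (lookup f s) - diag {x. \<delta> x = 2} * ?h \<in> Q_ideal N"
      using Q.const_mult_mem[OF h(2), of "lookup f s"]
      by (simp add: right_diff_distrib const_def mult_single mult.left_commute)
    from Q.add_mem[OF this g(2)] insert(1,2) show ?case
      by (intro bexI[OF _ matchings.matchings_add[OF matchings.matchings_const_mult[OF h(1)] g(1)]])
        (simp add: algebra_simps)
  qed
  from this[OF finite_keys subset_refl] show ?thesis by (simp flip: poly_mapping_as_sum)
qed

subsection \<open>Coefficients of minors\<close>

definition arc_expo :: "nat \<Rightarrow> (nat \<Rightarrow> nat) \<Rightarrow> (nat \<Rightarrow> nat) \<Rightarrow> expo" where
  "arc_expo m a c = (\<Sum>k\<in>{0..<m}. single (min (a k) (c k), max (a k) (c k)) 1)"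

lemma prod_symvar: "(\<Prod>k\<in>{0..<m}. symvar (a k) (c k)) = single (arc_expo m a c) 1"
proof -
  have "finite A \<Longrightarrow> (\<Prod>k\<in>A. symvar (a k) (c k)) =
      single (\<Sum>k\<in>A. single (min (a k) (c k), max (a k) (c k)) 1) (1::'a)" for A
    by (induction A rule: finite_induct) (auto simp: symvar_def mult_single)
  then show ?thesis by (simp add: arc_expo_def)
qed

lemma lookup_arc_expo:
  "lookup (arc_expo m a c) v = card {k\<in>{0..<m}. (min (a k) (c k), max (a k) (c k)) = v}"
  by (simp add: arc_expo_def lookup_sum lookup_single when_def sum.If_cases Int_def)

text \<open>Several permutations may produce the same monomial, for a symmetric matrix for instance
  p and its inverse; hence a signed count.\<close>

lemma lookup_sym_minor:
  "lookup (sym_minor m a b :: 'k::comm_ring_1 spoly) s =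
     (\<Sum>p | p permutes {0..<m}. of_int (sign p) * of_bool (arc_expo m a (b \<circ> p) = s))"
proof -
  have *: "lookup (of_int z * f) s = of_int z * lookup f s" for z and f :: "'k spoly"
    by (simp flip: const_of_int)
  have "(\<Prod>k\<in>{0..<m}. symvar (a k) (b (p k))) = single (arc_expo m a (b \<circ> p)) (1::'k)" for p
    using prod_symvar[where c = "b \<circ> p"] by simp
  then show ?thesis
    by (simp only: sym_minor_def lookup_sum * lookup_single when_def of_bool_def)
qed

text \<open>Only the identity permutation contributes the product of the diagonal entries, and this
  monomial is squarefree. It settles the empty index set in \<open>radical_subset\<close>, where the
  matching is a constant.\<close>

lemma diag_full_top: "lookup (diff_op (diag {1..N}) (sym_det N)) 0 = (1 :: 'k::comm_ring_1)"
proof -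
  have inj: "p = id" if p: "p permutes {0..<N}" and eq: "arc_expo N Suc (Suc \<circ> p) = arc_expo N Suc Suc" for p
  proof
    fix k
    show "p k = id k"
    proof (cases "k < N")
      case True
      have "k \<in> {k'\<in>{0..<N}. (min (Suc k') (Suc k'), max (Suc k') (Suc k')) = (Suc k, Suc k)}"
        using True by auto
      then have "lookup (arc_expo N Suc Suc) (Suc k, Suc k) \<noteq> 0"
        unfolding lookup_arc_expo by (subst card_eq_0_iff) auto
      with eq have "card {k'\<in>{0..<N}. (min (Suc k') ((Suc \<circ> p) k'), max (Suc k') ((Suc \<circ> p) k')) = (Suc k, Suc k)} \<noteq> 0"
        by (simp only: lookup_arc_expo[symmetric] not_False_eq_True)
      then obtain k' where "(min (Suc k') ((Suc \<circ> p) k'), max (Suc k') ((Suc \<circ> p) k')) = (Suc k, Suc k)"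
        by (metis (mono_tags, lifting) card.empty empty_Collect_eq)
      then have "k' = k" "p k' = k" by (auto simp: min_def max_def split: if_splits)
      then show ?thesis by simp
    next
      case False
      then show ?thesis using p by (simp add: permutes_not_in)
    qed
  qed
  have "lookup (sym_det N) (arc_expo N Suc Suc) =
      (\<Sum>p | p permutes {0..<N}. if p = id then (1::'k) else 0)"
    unfolding sym_det_eq_sym_minor lookup_sym_minor
    by (intro sum.cong refl) (use inj in \<open>auto simp: sign_id\<close>)
  also have "\<dots> = 1" by (simp add: sum.delta finite_permutations permutes_id)
  finally have top: "lookup (sym_det N) (arc_expo N Suc Suc) = (1::'k)" .
  have "diag {1..N} = (\<Prod>k\<in>{0..<N}. symvar (Suc k) (Suc k) :: 'k spoly)"
    unfolding diag_def by (rule prod.reindex_bij_witness[of _ Suc "\<lambda>k. k - 1"]) auto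
  then have "diag {1..N} = single (arc_expo N Suc Suc) (1::'k)" by (simp add: prod_symvar)
  moreover have "lookup (arc_expo N Suc Suc) v \<le> 1" for v
  proof -
    have "{k\<in>{0..<N}. (min (Suc k) (Suc k), max (Suc k) (Suc k)) = v} \<subseteq> {fst v - 1}" by auto
    from card_mono[OF _ this] show ?thesis by (simp add: lookup_arc_expo)
  qed
  ultimately show ?thesis
    by (simp add: lookup_monom_deriv_0 top)
qed


subsection \<open>The radical\<close>

lemma matchings_empty: "g \<in> matchings {} \<Longrightarrow> \<exists>c. g = const c"
proof (induction rule: matchings.induct)
  case (matchings_arcs l)
  then show ?case by (intro exI[of _ 1]) simp
next
  case matchings_0
  show ?case by (intro exI[of _ 0]) simp
qed (metis const_add, metis const_mult)

lemma matchings_odd: "g \<in> matchings B \<Longrightarrow> odd (card B) \<Longrightarrow> g = 0"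
  by (induction rule: matchings.induct) (auto simp: distinct_card)

lemma rename_rename_matchings:
  "f \<in> matchings B \<Longrightarrow> rename \<sigma> (rename \<tau> f) = rename (\<sigma> \<circ> \<tau>) f"
  by (induction rule: matchings.induct) (auto simp: rename_arcs rename_add rename_mult o_def)

lemma rename_id_matchings: "f \<in> matchings B \<Longrightarrow> rename id f = f"
  by (induction rule: matchings.induct) (auto simp: rename_arcs rename_add rename_mult)

text \<open>Taking the smallest elements puts the partners of an antisymmetrised set after it, the
  order in which \<open>F_U\<close> lists rows and columns.\<close>

lemma initial_subset:
  fixes B :: "nat set"
  assumes "finite B" "k \<le> card B"
  shows "\<exists>I \<subseteq> B. card I = k \<and> (\<forall>i\<in>I. \<forall>b\<in>B - I. i < b)"
  using assms(2)
proof (induction k)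
  case 0
  show ?case by (rule exI[of _ "{}"]) auto
next
  case (Suc k)
  then obtain I where I: "I \<subseteq> B" "card I = k" "\<forall>i\<in>I. \<forall>b\<in>B - I. i < b" by auto
  have fin: "finite I" using I(1) assms(1) finite_subset by blast
  have "B - I \<noteq> {}" using I Suc.prems fin assms(1) by (metis Diff_eq_empty_iff card_mono not_less_eq_eq)
  then have min: "Min (B - I) \<in> B - I" "\<And>b. b \<in> B - I \<Longrightarrow> Min (B - I) \<le> b"
    using assms(1) by (auto intro!: Min_in simp del: Diff_iff)
  show ?case
  proof (intro exI[of _ "insert (Min (B - I)) I"] conjI ballI)
    show "insert (Min (B - I)) I \<subseteq> B" using I(1) min(1) by blast
    show "card (insert (Min (B - I)) I) = Suc k" using min(1) fin I(2) by simp
    fix i b assume i: "i \<in> insert (Min (B - I)) I" and b: "b \<in> B - insert (Min (B - I)) I"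
    then have "b \<in> B - I" "b \<noteq> Min (B - I)" by auto
    with min(2)[of b] I(3) i show "i < b" by (metis insertE le_neq_implies_less)
  qed
qed

lemma of_nat_fact_CHAR_neq_0:
  assumes "CHAR('k::field) \<noteq> 0"
  shows "of_nat (fact (CHAR('k) - 1)) \<noteq> (0::'k)"
proof -
  have p: "prime CHAR('k)"
    using assms prime_CHAR_semidom by blast
  then have "CHAR('k) > 0" using prime_gt_0_nat by blast
  then have "\<not> CHAR('k) dvd fact (CHAR('k) - 1)"
    by (simp add: prime_dvd_fact_iff[OF p])
  then show ?thesis by (simp add: of_nat_eq_0_iff_char_dvd del: of_nat_fact)
qed

text \<open>
  Contracting an element \<open>g\<close> of the radical gives elements of smaller radicals, so by induction
  \<open>g\<close> is antisymmetric under all transpositions modulo \<open>P\<close>. Summing over the transpositions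
  moving a fixed index gives \<open>(m + 1) g \<in> P\<close>; if \<open>p\<close> divides \<open>m + 1\<close>, then \<open>m \<ge> p - 1\<close>, and one
  antisymmetrises over \<open>p - 1\<close> indices instead.
\<close>

lemma radical_subset:
  fixes P :: "'k::field spoly set"
  assumes P: "sym_ideal P N" and QP: "Q_ideal N \<subseteq> P" and PA: "P \<subseteq> Ann N" and two: "(2::'k) \<noteq> 0"
    and F: "\<And>U. CHAR('k) \<noteq> 0 \<Longrightarrow> U \<in> F_index N CHAR('k) \<Longrightarrow> F_minor CHAR('k) U \<in> P"
    and g: "g \<in> matchings B" "B \<subseteq> {1..N}" "diag ({1..N} - B) * g \<in> Ann N"
  shows "g \<in> P"
  using g
proof (induction "card B" arbitrary: B g rule: less_induct)
  case less
  interpret P: sym_ideal P N by (rule P)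
  interpret A: sym_ideal "Ann N :: 'k spoly set" N by (rule sym_ideal_Ann)
  let ?D = "diag ({1..N} - B) :: 'k spoly"
  have fin: "finite B" using less.prems(2) finite_subset by blast
  have DN: "?D \<in> polys N" by (intro diag_polys) auto
  \<comment> \<open>\<open>?D\<close> raises every index outside \<open>B\<close> to weight 2, its
    weight in \<open>D_N\<close>, so that \<open>g\<close> is tested on the indices of
    \<open>B\<close> alone.\<close>
  define rad where "rad = {g \<in> matchings B. ?D * g \<in> Ann N}"
  have anti: "g + rename (transpose i j) g \<in> P" if ij: "i \<in> B" "j \<in> B" "i \<noteq> j" and g: "g \<in> rad" for i j g
  proof -
    have ijN: "i \<in> {1..N}" "j \<in> {1..N}" using ij less.prems(2) by auto
    obtain c where c: "c \<in> matchings (B - {i, j})"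
        "symvar i j * g - symvar i i * symvar j j * c \<in> Q_ideal N"
        "g + rename (transpose i j) g + symvar i j * c \<in> Q_ideal N"
      using contraction[OF _ less.prems(2) ij] g by (auto simp: rad_def)
    have X: "symvar i j \<in> (polys N :: 'k spoly set)" using ijN by auto
    have "{1..N} - (B - {i, j}) = insert i (insert j ({1..N} - B))" using ij ijN by auto
    then have "diag ({1..N} - (B - {i, j})) = symvar i i * symvar j j * ?D"
      using ij by (simp add: diag_insert mult.assoc)
    \<comment> \<open>Modulo \<open>Q\<close>, multiplication of \<open>?D * g\<close> by
      \<open>d_ij\<close> produces exactly the diagonal factor belonging to
      \<open>B - {i, j}\<close>; thus the contraction lies in the smaller radical and the induction
      hypothesis applies to it.\<close>
    then have "diag ({1..N} - (B - {i, j})) * c =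
        symvar i j * (?D * g) - ?D * (symvar i j * g - symvar i i * symvar j j * c)"
      by (simp add: algebra_simps)
    moreover have "\<dots> \<in> Ann N"
    proof (rule A.diff_mem)
      show "symvar i j * (?D * g) \<in> Ann N" using g by (intro A.mult_mem[OF X]) (simp add: rad_def)
      show "?D * (symvar i j * g - symvar i i * symvar j j * c) \<in> Ann N"
        using c(2) QP PA by (intro A.mult_mem[OF DN]) auto
    qed
    ultimately have "diag ({1..N} - (B - {i, j})) * c \<in> Ann N" by simp
    moreover have "card (B - {i, j}) < card B" using fin ij by (intro psubset_card_mono) auto
    ultimately have "c \<in> P"
      using less.prems(2) by (intro less.hyps[OF _ c(1)]) auto
    then have "symvar i j * c \<in> P" using X by (intro P.mult_mem)
    with c(3) QP have "(g + rename (transpose i j) g + symvar i j * c) - symvar i j * c \<in> P"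
      by (intro P.diff_mem) auto
    then show ?thesis by simp
  qed
  \<comment> \<open>As \<open>P\<close> is contained in \<open>Ann\<close>, \<open>anti\<close>
    itself shows that the radical is stable under transpositions. This makes \<open>anti\<close>
    applicable repeatedly.\<close>
  have closed: "rename (transpose i j) g \<in> rad" if ij: "i \<in> B" "j \<in> B" "i \<noteq> j" and g: "g \<in> rad" for i j g
  proof -
    have "rename (transpose i j) g \<in> matchings B"
      using g ij by (intro matchings_rename[of g B]) (auto simp: rad_def intro: inj_on_subset[OF inj_transpose])
    moreover have "?D * (g + rename (transpose i j) g) - ?D * g \<in> Ann N"
      using anti[OF ij g] PA g by (intro A.diff_mem[OF A.mult_mem[OF DN]]) (auto simp: rad_def)
    ultimately show ?thesis by (simp add: rad_def distrib_left)
  qed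
  have g: "g \<in> rad" using less.prems by (simp add: rad_def)
  show ?case
  proof (cases "B = {}")
    case True
    then obtain c where c: "g = const c" using matchings_empty less.prems(1) by blast
    have "diff_op (g * diag {1..N}) (sym_det N) = 0"
      using less.prems(3) True by (simp add: Ann_def mult.commute)
    then have "lookup (const c * diff_op (diag {1..N}) (sym_det N)) 0 = 0"
      by (simp add: c diff_op_const_mult)
    then have "c = 0" unfolding lookup_const_mult diag_full_top by simp
    then show ?thesis by (simp add: c)
  next
    case False
    show ?thesis
    proof (cases "even (card B)")
      case False
      then show ?thesis using matchings_odd[OF less.prems(1)] by simp
    next
      case True
      then obtain m where m: "card B = 2 * m" by (elim evenE)
      from False obtain a where a: "a \<in> B" by blast
      have "(\<Sum>j\<in>B - {a}. g + rename (transpose a j) g) \<in> P"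
        using anti[OF a _ _ g] by (intro P.sum_mem) auto
      moreover have "(\<Sum>j\<in>B - {a}. rename (transpose a j) g) + const (of_nat m - 2) * g \<in> P"
        using transposition_sum[OF less.prems(1,2) a m] QP by auto
      ultimately have "(\<Sum>j\<in>B - {a}. g + rename (transpose a j) g) -
          ((\<Sum>j\<in>B - {a}. rename (transpose a j) g) + const (of_nat m - 2) * g) \<in> P"
        by (rule P.diff_mem)
      \<comment> \<open>There are 2m - 1 transpositions moving \<open>a\<close>, each leaving one
        copy of \<open>g\<close>, and (2m - 1) - (m - 2) = m + 1.\<close>
      also have "(\<Sum>j\<in>B - {a}. g + rename (transpose a j) g) -
          ((\<Sum>j\<in>B - {a}. rename (transpose a j) g) + const (of_nat m - 2) * g) =
          const (of_nat (m + 1)) * g"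
      proof -
        have "m \<ge> 1" using m False fin by (cases m) auto
        then have c1: "of_nat (card (B - {a})) = (of_nat m + of_nat m - 1 :: 'k spoly)"
          using a fin m by (simp add: of_nat_diff)
        have c2: "const (of_nat m - 2) = of_nat m - (2 :: 'k spoly)"
          by (simp add: const_def single_diff)
        have "(\<Sum>j\<in>B - {a}. g + rename (transpose a j) g) =
            of_nat (card (B - {a})) * g + (\<Sum>j\<in>B - {a}. rename (transpose a j) g)"
          by (simp add: sum.distrib)
        then show ?thesis unfolding c1 c2 const_of_nat by (simp add: algebra_simps)
      qed
      finally have m1: "const (of_nat (m + 1)) * g \<in> P" .
      show ?thesis
      proof (cases "of_nat (m + 1) = (0::'k)")
        case False
        then show ?thesis using P.const_mult_mem[OF m1, of "inverse (of_nat (m + 1))"]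
          by (simp add: mult.assoc[symmetric] del: of_nat_Suc flip: const_mult)
      next
        case True
        let ?p = "CHAR('k)"
        have "?p dvd m + 1" using True by (simp only: of_nat_eq_0_iff_char_dvd)
        then have "?p \<noteq> 0" "?p \<le> m + 1" by (auto intro!: Nat.gr0I dest: dvd_imp_le)
        then have p: "?p \<noteq> 0" "?p - 1 \<le> card B" using m by auto
        obtain I where I: "I \<subseteq> B" "card I = ?p - 1" "\<forall>i\<in>I. \<forall>b\<in>B - I. i < b"
          using initial_subset[OF fin p(2)] by blast
        define e where "e = (!) (sorted_list_of_set I)"
        define R :: "(nat \<Rightarrow> nat) \<Rightarrow> 'k spoly"
          where "R q = rename (map_permutation {0..<?p - 1} e q) g" for q
        have be: "bij_betw e {0..<?p - 1} I"
        proof -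
          have "finite I" using fin I(1) by (rule rev_finite_subset)
          then show ?thesis unfolding e_def using I(2) by (intro bij_betw_nth) auto
        qed
        then have inj: "inj_on e {0..<?p - 1}" by (simp add: bij_betw_def)
        \<comment> \<open>Every permutation of \<open>I\<close> acts on \<open>g\<close> by its sign
          modulo \<open>P\<close>. Membership in \<open>rad\<close> is carried along because each
          further transposition is applied to \<open>R q\<close> and not to
          \<open>g\<close>.\<close>
        have sign: "R q \<in> rad \<and> R q - of_int (sign q) * g \<in> P" if "q permutes {0..<?p - 1}" for q
          using that finite_atLeastLessThan
        proof (induction rule: permutes_induct)
          case id
          show ?case
            unfolding R_def map_permutation_id'[OF inj] rename_id_matchings[OF less.prems(1)]
            using g by simp
        next
          case (swap x y q)
          let ?t = "transpose (e x) (e y)"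
          have exy: "e x \<in> B" "e y \<in> B" "e x \<noteq> e y"
            using swap(1-3) be I(1) by (auto simp: bij_betw_def inj_on_def)
          have Rt: "R (transpose x y \<circ> q) = rename ?t (R q)"
            unfolding R_def map_permutation_compose'[OF inj swap(4)] map_permutation_transpose[OF inj swap(1,2)]
            by (rule rename_rename_matchings[OF less.prems(1), symmetric])
          have "sign (transpose x y \<circ> q) = - sign q"
            using swap(3,4) by (subst sign_compose[OF permutation_swap_id])
              (auto simp: sign_swap_id permutation_permutes)
          then have "R (transpose x y \<circ> q) - of_int (sign (transpose x y \<circ> q)) * g =
              (R q + rename ?t (R q)) - (R q - of_int (sign q) * g)"
            by (simp add: Rt)
          moreover have "\<dots> \<in> P"
            by (rule P.diff_mem[OF anti[OF exy conjunct1[OF swap(5)]] conjunct2[OF swap(5)]])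
          moreover have "R (transpose x y \<circ> q) \<in> rad"
            unfolding Rt using closed[OF exy] swap(5) by blast
          ultimately show ?case by (simp only: simp_thms)
        qed
        \<comment> \<open>The antisymmetrisation is evaluated in two ways: arc by arc it lies in
          \<open>P\<close>, and by \<open>sign\<close> it is (p - 1)! g modulo
          \<open>P\<close>.\<close>
        have "antisymmetrize I g \<in> P"
          using I by (intro antisymmetrize_matchings[OF P two less.prems(1,2) I(1,2)] F p(1)) auto
        moreover have "(\<Sum>q | q permutes {0..<?p - 1}. of_int (sign q) * (R q - of_int (sign q) * g)) \<in> P"
          using sign by (intro P.sum_mem P.mult_mem polys_of_int) auto
        ultimately have "antisymmetrize I g -
            (\<Sum>q | q permutes {0..<?p - 1}. of_int (sign q) * (R q - of_int (sign q) * g)) \<in> P"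
          by (rule P.diff_mem)
        also have "antisymmetrize I g -
            (\<Sum>q | q permutes {0..<?p - 1}. of_int (sign q) * (R q - of_int (sign q) * g)) =
            (\<Sum>q | q permutes {0..<?p - 1}. g)"
        proof -
          have "of_int (sign q) * (of_int (sign q) * g) = g" for q :: "nat \<Rightarrow> nat"
            by (simp flip: of_int_mult mult.assoc)
          moreover have "antisymmetrize I g = (\<Sum>q | q permutes {0..<?p - 1}. of_int (sign q) * R q)"
            unfolding antisymmetrize_def Let_def e_def[symmetric] I(2) R_def by (rule refl)
          ultimately show ?thesis
            by (simp add: right_diff_distrib sum_subtractf)
        qed
        also have "\<dots> = const (of_nat (fact (?p - 1))) * g"
        proof -
          have "card {q. q permutes {0..<?p - 1}} = fact (?p - 1)"
            by (rule card_permutations) simp_all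
          then show ?thesis by (simp only: sum_constant const_of_nat)
        qed
        finally have "const (of_nat (fact (?p - 1))) * g \<in> P" .
        from P.const_mult_mem[OF this, of "inverse (of_nat (fact (?p - 1)))"] of_nat_fact_CHAR_neq_0[OF p(1)]
        show ?thesis
          by (simp add: mult.assoc[symmetric] del: of_nat_fact flip: const_mult)
      qed
    qed
  qed
qed

lemma Q_subset_Ann: "(2::'k::field) \<noteq> 0 \<Longrightarrow> (Q_ideal N :: 'k spoly set) \<subseteq> Ann N"
  unfolding Ann_def sym_det_eq_sym_minor
  using Q_annihilates_sym_minor Q.subset_polys by blast

section \<open>Reduction to weight-homogeneous elements\<close>

definition wt_part :: "(nat \<Rightarrow> nat) \<Rightarrow> 'k::comm_ring_1 spoly \<Rightarrow> 'k spoly" where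
  "wt_part \<delta> f = (\<Sum>s | s \<in> keys f \<and> wt s = \<delta>. single s (lookup f s))"

lemma has_wt_wt_part: "has_wt \<delta> (wt_part \<delta> f)"
  unfolding wt_part_def by (rule has_wt_sum) (auto simp: has_wt_def)

lemma wt_part_polys: "f \<in> polys N \<Longrightarrow> wt_part \<delta> f \<in> polys N"
  unfolding wt_part_def by (intro polys_sum polys_single) (auto simp: polys_def)

lemma sum_wt_part: "(\<Sum>\<delta>\<in>wt ` keys f. wt_part \<delta> f) = f"
  unfolding wt_part_def
  using sum.image_gen[of "keys f" "\<lambda>s. single s (lookup f s)" wt] poly_mapping_as_sum[of f] by simp

text \<open>\<open>D_N\<close> is homogeneous for the weight, so parts of \<open>f\<close> of
  different weights send it to polynomials with disjoint supports; no cancellation between them is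
  possible.\<close>

lemma Ann_wt_part:
  assumes "f \<in> Ann N"
  shows "wt_part \<delta> f \<in> Ann N"
proof -
  let ?D = "sym_det N :: 'a spoly"
  have "diff_op (wt_part \<delta> f) ?D = 0"
  proof (rule ccontr)
    assume "diff_op (wt_part \<delta> f) ?D \<noteq> 0"
    then obtain t where t: "t \<in> keys (diff_op (wt_part \<delta> f) ?D)"
      by (metis keys_eq_empty ex_in_conv)
    have eq: "\<epsilon> x + wt t x = (if x \<in> {1..N} then 2 else 0)" if "t \<in> keys (diff_op (wt_part \<epsilon> f) ?D)" for \<epsilon> x
      using keys_diff_op_wt[OF that has_wt_wt_part has_wt_sym_det] .
    have "lookup (diff_op (wt_part \<epsilon> f) ?D) t = 0" if "\<epsilon> \<noteq> \<delta>" for \<epsilon>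
    proof (rule ccontr)
      assume "lookup (diff_op (wt_part \<epsilon> f) ?D) t \<noteq> 0"
      then have "\<epsilon> x + wt t x = \<delta> x + wt t x" for x
        using eq[of \<epsilon> x] eq[OF t, of x] by (simp add: in_keys_iff)
      with that show False by auto
    qed
    then have "(\<Sum>\<epsilon>\<in>wt ` keys f. lookup (diff_op (wt_part \<epsilon> f) ?D) t) =
        (\<Sum>\<epsilon>\<in>wt ` keys f. if \<epsilon> = \<delta> then lookup (diff_op (wt_part \<delta> f) ?D) t else 0)"
      by (intro sum.cong) auto
    moreover have "\<delta> \<in> wt ` keys f"
    proof (rule ccontr)
      assume "\<delta> \<notin> wt ` keys f"
      then have "{s. s \<in> keys f \<and> wt s = \<delta>} = {}" by blast
      then have "wt_part \<delta> f = 0" by (simp only: wt_part_def sum.empty)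
      with t show False by simp
    qed
    ultimately have "lookup (diff_op (\<Sum>\<epsilon>\<in>wt ` keys f. wt_part \<epsilon> f) ?D) t =
        lookup (diff_op (wt_part \<delta> f) ?D) t"
      by (simp add: diff_op_sum lookup_sum sum.delta)
    with t assms show False by (simp add: sum_wt_part Ann_def in_keys_iff)
  qed
  with assms show ?thesis by (simp add: Ann_def wt_part_polys)
qed

text \<open>The ideal \<open>P\<close> is a parameter so that both characteristics are covered: Q +
  (F_U) for odd p, and \<open>Q\<close> alone in characteristic 0, where the condition on the minors
  is vacuous.\<close>

lemma Ann_subset:
  fixes P :: "'k::field spoly set"
  assumes P: "sym_ideal P N" and QP: "Q_ideal N \<subseteq> P" and PA: "P \<subseteq> Ann N" and two: "(2::'k) \<noteq> 0"
    and F: "\<And>U. CHAR('k) \<noteq> 0 \<Longrightarrow> U \<in> F_index N CHAR('k) \<Longrightarrow> F_minor CHAR('k) U \<in> P"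
  shows "Ann N \<subseteq> P"
proof
  interpret P: sym_ideal P N by (rule P)
  interpret A: sym_ideal "Ann N :: 'k spoly set" N by (rule sym_ideal_Ann)
  fix f :: "'k spoly" assume f: "f \<in> Ann N"
  have "wt_part \<delta> f \<in> P" if \<delta>: "\<delta> \<in> wt ` keys f" for \<delta>
  proof -
    let ?A = "{x. \<delta> x = 2}" and ?B = "{x. \<delta> x = 1}"
    have fA: "wt_part \<delta> f \<in> Ann N" using f by (rule Ann_wt_part)
    have out: "\<delta> x = 0" if "x \<notin> {1..N}" for x
      using \<delta> A.subset_polys[OF f] that wt_eq_0_outside[of _ N x] by (auto simp: polys_def simp del: atLeastAtMost_iff)
    have sub: "?A \<subseteq> {1..N}" "?B \<subseteq> {1..N}"
    proof -
      show "?A \<subseteq> {1..N}" using out by (metis (mono_tags, lifting) mem_Collect_eq subsetI zero_neq_numeral)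
      show "?B \<subseteq> {1..N}" using out by (metis (mono_tags, lifting) mem_Collect_eq subsetI zero_neq_one)
    qed
    consider "wt_part \<delta> f \<in> Q_ideal N"
      | g where "g \<in> matchings ?B" "wt_part \<delta> f - diag ?A * g \<in> Q_ideal N"
      using weighted_normal_form[OF wt_part_polys[OF A.subset_polys[OF f]] has_wt_wt_part, of \<delta>] by blast
    then show ?thesis
    proof cases
      case 1
      then show ?thesis using QP by blast
    next
      case (2 g)
      have "diag ?A * g \<in> Ann N"
        using A.diff_mem[OF fA] 2(2) QP PA by (metis (no_types, lifting) diff_diff_eq2 add_diff_cancel_left' subsetD)
      \<comment> \<open>Multiplying by the remaining \<open>d_ii\<close> brings the element into the
        form required by \<open>radical_subset\<close>. That lemma returns membership of
        \<open>g\<close> itself, from which the original product is recovered.\<close>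
      then have "diag ({1..N} - ?B - ?A) * (diag ?A * g) \<in> Ann N"
        by (rule A.mult_mem[OF diag_polys, rotated]) blast
      also have "diag ({1..N} - ?B - ?A) * (diag ?A * g) = diag ({1..N} - ?B) * g"
      proof -
        have "{1..N} - ?B = ({1..N} - ?B - ?A) \<union> ?A" using sub by auto
        moreover have "diag (({1..N} - ?B - ?A) \<union> ?A) = diag ({1..N} - ?B - ?A) * (diag ?A :: 'k spoly)"
          using sub by (intro diag_Un_disjoint) (auto intro: finite_subset)
        ultimately show ?thesis by (simp only: mult.assoc)
      qed
      finally have dg: "diag ({1..N} - ?B) * g \<in> Ann N" .
      have "g \<in> P" by (rule radical_subset[OF P QP PA two _ 2(1) sub(2) dg]) (rule F)
      then have "diag ?A * g \<in> P" using sub by (intro P.mult_mem diag_polys)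
      then show ?thesis using P.add_mem_cancel 2(2) QP by blast
    qed
  qed
  then have "(\<Sum>\<delta>\<in>wt ` keys f. wt_part \<delta> f) \<in> P" by (rule P.sum_mem)
  then show "f \<in> P" by (simp add: sum_wt_part)
qed


subsection \<open>The minors \<open>F\<^sub>U\<close>\<close>

lemma sym_minor_polys:
  assumes "a ` {0..<m} \<subseteq> {1..N}" "b ` {0..<m} \<subseteq> {1..N}"
  shows "sym_minor m a b \<in> polys N"
  unfolding sym_minor_def
proof (intro polys_sum polys_mult polys_of_int polys_prod)
  fix p k assume "p \<in> {p. p permutes {0..<m}}" "k \<in> {0..<m}"
  then have "p k \<in> {0..<m}" by (simp add: permutes_in_image)
  with assms \<open>k \<in> _\<close> have "a k \<in> {1..N}" "b (p k) \<in> {1..N}" by blast+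
  then show "symvar (a k) (b (p k)) \<in> polys N" by auto
qed

section \<open>Contracting a minor with disjoint rows and columns\<close>

context
  fixes N m :: nat and a b :: "nat \<Rightarrow> nat"
  assumes a: "inj_on a {0..<m}" "a ` {0..<m} \<subseteq> {1..N}"
    and b: "inj_on b {0..<m}" "b ` {0..<m} \<subseteq> {1..N}"
    and disj: "a ` {0..<m} \<inter> b ` {0..<m} = {}"
begin

lemma ab_mem: "k < m \<Longrightarrow> a k \<in> {1..N}" "k < m \<Longrightarrow> b k \<in> {1..N}"
  using a(2) b(2) by (simp_all add: image_subset_iff)

lemma ab_neq:
  assumes "k < m" "l < m"
  shows "a k \<noteq> b l"
proof
  assume "a k = b l"
  moreover have "a k \<in> a ` {0..<m}" "b l \<in> b ` {0..<m}" using assms by simp_all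
  ultimately show False using disj by (simp add: disjoint_iff)
qed

lemma ab_inj: "k < m \<Longrightarrow> l < m \<Longrightarrow> a k = a l \<longleftrightarrow> k = l" "k < m \<Longrightarrow> l < m \<Longrightarrow> b k = b l \<longleftrightarrow> k = l"
  by (simp_all add: inj_on_eq_iff[OF a(1)] inj_on_eq_iff[OF b(1)])

lemma prod_symvar_polys:
  assumes "p permutes {0..<m}" "A \<subseteq> {0..<m}"
  shows "(\<Prod>k\<in>A. symvar (a k) (b (p k))) \<in> polys N"
proof (intro polys_prod)
  fix k assume "k \<in> A"
  with assms have "k < m" "p k < m" by (auto simp: subset_iff)
  from ab_mem(1)[OF this(1)] ab_mem(2)[OF this(2)] show "symvar (a k) (b (p k)) \<in> polys N" by auto
qed

text \<open>Contracting along two row indices joins the columns of these rows by an arc. The result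
  is symmetric in the two rows while the sign alternates, so the sum cancels.\<close>

lemma sym_minor_row_arc:
  assumes two: "(2::'k::field) \<noteq> 0" and r: "r < m" "r' < m" "r \<noteq> r'"
  shows "symvar (a r) (a r') * sym_minor m a b \<in> (Q_ideal N :: 'k spoly set)"
proof -
  let ?X = "symvar :: nat \<Rightarrow> nat \<Rightarrow> 'k spoly"
  define G where "G p = ?X (a r) (a r) * ?X (a r') (a r') * ?X (b (p r)) (b (p r')) *
      (\<Prod>k\<in>{0..<m} - {r, r'}. ?X (a k) (b (p k)))" for p
  have G: "?X (a r) (a r') * (\<Prod>k\<in>{0..<m}. ?X (a k) (b (p k))) - G p \<in> Q_ideal N"
    if p: "p permutes {0..<m}" for p
  proof -
    have pr: "p r < m" "p r' < m" "p r \<noteq> p r'"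
      using p r permutes_inj[OF p] by (auto dest: injD)
    have "{0..<m} = insert r (insert r' ({0..<m} - {r, r'}))" using r by auto
    then have "(\<Prod>k\<in>{0..<m}. ?X (a k) (b (p k))) = (\<Prod>k\<in>insert r (insert r' ({0..<m} - {r, r'})). ?X (a k) (b (p k)))"
      by simp
    also have "\<dots> = ?X (a r) (b (p r)) * ?X (a r') (b (p r')) * (\<Prod>k\<in>{0..<m} - {r, r'}. ?X (a k) (b (p k)))"
      using r by (simp add: mult.assoc)
    finally have "?X (a r) (a r') * (\<Prod>k\<in>{0..<m}. ?X (a k) (b (p k))) - G p =
        (?X (a r) (a r') * (?X (a r) (b (p r)) * ?X (a r') (b (p r'))) -
          ?X (a r) (a r) * ?X (a r') (a r') * ?X (b (p r)) (b (p r'))) *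
        (\<Prod>k\<in>{0..<m} - {r, r'}. ?X (a k) (b (p k)))"
      by (simp add: G_def algebra_simps)
    moreover have "{a r, a r', b (p r), b (p r')} \<subseteq> {1..N}"
      using ab_mem(1)[OF r(1)] ab_mem(1)[OF r(2)] ab_mem(2)[OF pr(1)] ab_mem(2)[OF pr(2)] by blast
    moreover have "distinct [a r, a r', b (p r), b (p r')]"
      using r pr ab_inj ab_neq by simp
    moreover have "(\<Prod>k\<in>{0..<m} - {r, r'}. ?X (a k) (b (p k))) \<in> polys N"
      by (rule prod_symvar_polys[OF p]) blast
    ultimately show ?thesis by (simp only:) (rule Q.mult_mem'[OF Q_contract])
  qed
  have "G (p \<circ> transpose r r') = G p" for p
    unfolding G_def by (auto simp: symvar_commute transpose_apply_other intro!: arg_cong2[where f = "(*)"] prod.cong)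
  then have "(\<Sum>p | p permutes {0..<m}. of_int (sign p) * G p) = 0"
    by (intro sum_permutations_antisym[OF two r])
  then have "?X (a r) (a r') * sym_minor m a b =
      (\<Sum>p | p permutes {0..<m}. of_int (sign p) * (?X (a r) (a r') * (\<Prod>k\<in>{0..<m}. ?X (a k) (b (p k))) - G p))"
    by (simp add: sym_minor_def sum_distrib_left right_diff_distrib sum_subtractf mult.left_commute)
  also have "\<dots> \<in> Q_ideal N"
    using G by (intro Q.sum_mem Q.mult_mem polys_of_int) auto
  finally show ?thesis .
qed

text \<open>Group the expansion by the permutations p with p(r) = q. Such a p closes a loop and
  gives -2 Y(p). For each of the m - 1 other rows k, the permutation p composed with (r k) gives
  Y(p) with opposite sign. Altogether the group contributes -(m + 1) Y(p) = 0.\<close>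

lemma sym_minor_cross_arc:
  assumes m1: "of_nat (m + 1) = (0::'k::field)" and r: "r < m" "q < m"
  shows "symvar (a r) (b q) * sym_minor m a b \<in> (Q_ideal N :: 'k spoly set)"
proof -
  let ?X = "symvar :: nat \<Rightarrow> nat \<Rightarrow> 'k spoly"
  let ?S = "{p. p permutes {0..<m}}"
  define T where "T p = ?X (a r) (b q) * (\<Prod>k\<in>{0..<m}. ?X (a k) (b (p k)))" for p
  define Y where "Y p = ?X (a r) (a r) * ?X (b q) (b q) * (\<Prod>k\<in>{0..<m} - {r}. ?X (a k) (b (p k)))" for p
  have prod1: "(\<Prod>k\<in>{0..<m}. ?X (a k) (b (p k))) = ?X (a r) (b (p r)) * (\<Prod>k\<in>{0..<m} - {r}. ?X (a k) (b (p k)))" for p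
    using r by (intro prod.remove) auto
  have 1: "T p + 2 * Y p \<in> Q_ideal N" if p: "p permutes {0..<m}" "p r = q" for p
  proof -
    have "T p + 2 * Y p = ((?X (a r) (b q))\<^sup>2 + 2 * ?X (a r) (a r) * ?X (b q) (b q)) *
        (\<Prod>k\<in>{0..<m} - {r}. ?X (a k) (b (p k)))"
      unfolding T_def Y_def prod1 p(2) by (simp add: algebra_simps power2_eq_square)
    also have "\<dots> \<in> Q_ideal N"
      using ab_mem(1)[OF r(1)] ab_mem(2)[OF r(2)] ab_neq[OF r]
      by (intro Q.mult_mem' Q_rels prod_symvar_polys[OF p(1)]) auto
    finally show ?thesis .
  qed
  have 2: "T (p \<circ> transpose r k) - Y p \<in> Q_ideal N"
    if p: "p permutes {0..<m}" "p r = q" and k: "k < m" "k \<noteq> r" for p k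
  proof -
    have pk: "p k < m" "p k \<noteq> q" using p k permutes_inj[OF p(1)] by (auto dest: injD)
    let ?R = "\<Prod>l\<in>{0..<m} - {r} - {k}. ?X (a l) (b (p l))"
    have "(\<Prod>l\<in>{0..<m}. ?X (a l) (b ((p \<circ> transpose r k) l))) =
        ?X (a r) (b (p k)) * (?X (a k) (b q) * (\<Prod>l\<in>{0..<m} - {r} - {k}. ?X (a l) (b ((p \<circ> transpose r k) l))))"
      unfolding prod1 using k p(2) by (subst prod.remove[of _ k]) auto
    also have "(\<Prod>l\<in>{0..<m} - {r} - {k}. ?X (a l) (b ((p \<circ> transpose r k) l))) = ?R"
      by (intro prod.cong) (auto simp: transpose_apply_other)
    finally have T: "T (p \<circ> transpose r k) = ?X (a r) (b q) * (?X (a r) (b (p k)) * (?X (a k) (b q) * ?R))"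
      unfolding T_def by simp
    have Y: "Y p = ?X (a r) (a r) * ?X (b q) (b q) * (?X (a k) (b (p k)) * ?R)"
      unfolding Y_def using k by (subst prod.remove[of _ k]) auto
    have "T (p \<circ> transpose r k) - Y p = (?X (a r) (b q) * (?X (a r) (b (p k)) * ?X (b q) (a k)) -
        ?X (a r) (a r) * ?X (b q) (b q) * ?X (b (p k)) (a k)) * ?R"
      unfolding T Y by (simp add: algebra_simps symvar_commute[of "b _" "a k"])
    also have "\<dots> \<in> Q_ideal N"
    proof (rule Q.mult_mem'[OF Q_contract])
      show "{a r, b q, b (p k), a k} \<subseteq> {1..N}"
        using ab_mem(1)[OF r(1)] ab_mem(1)[OF k(1)] ab_mem(2)[OF r(2)] ab_mem(2)[OF pk(1)] by blast
      show "distinct [a r, b q, b (p k), a k]"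
        using r k pk ab_inj ab_neq[of r q] ab_neq[of k q] ab_neq[of r "p k"] ab_neq[of k "p k"] by auto
      show "?R \<in> polys N" by (rule prod_symvar_polys[OF p(1)]) blast
    qed
    finally show ?thesis .
  qed
  have part: "(\<Sum>p\<in>?S. if p k = q then of_int (sign p) * T p else 0) =
      (\<Sum>p\<in>?S. if p r = q then - (of_int (sign p) * T (p \<circ> transpose r k)) else 0)"
    if k: "k < m" "k \<noteq> r" for k
  proof -
    have t: "transpose r k permutes {0..<m}" using r k by (intro permutes_swap_id) auto
    have "sign (p \<circ> transpose r k) = - sign p" if "p \<in> ?S" for p
      using that k(2) by (subst sign_compose[OF _ permutation_swap_id]) (auto simp: sign_swap_id permutation_permutes)
    then show ?thesis
      by (subst sum_permutations_compose_right[OF t]) (intro sum.cong refl, simp)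
  qed
  have "?X (a r) (b q) * sym_minor m a b = (\<Sum>p\<in>?S. of_int (sign p) * T p)"
    by (simp add: sym_minor_def sum_distrib_left T_def mult.left_commute)
  also have "\<dots> = (\<Sum>p\<in>?S. \<Sum>k\<in>{0..<m}. if p k = q then of_int (sign p) * T p else 0)"
  proof (intro sum.cong refl)
    fix p assume "p \<in> ?S"
    then have p: "p permutes {0..<m}" by simp
    then obtain k where k: "k \<in> {0..<m}" "p k = q"
      using r(2) by (metis atLeastLessThan_iff imageE le0 permutes_image)
    have "p l = q \<longleftrightarrow> l = k" for l using k permutes_inj[OF p] by (auto dest: injD)
    then show "of_int (sign p) * T p = (\<Sum>k\<in>{0..<m}. if p k = q then of_int (sign p) * T p else 0)"
      using k(1) by simp
  qed
  also have "\<dots> = (\<Sum>k\<in>{0..<m}. \<Sum>p\<in>?S. if p k = q then of_int (sign p) * T p else 0)"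
    by (rule sum.swap)
  also have "\<dots> = (\<Sum>p\<in>?S. if p r = q then of_int (sign p) * T p else 0) +
      (\<Sum>k\<in>{0..<m} - {r}. \<Sum>p\<in>?S. if p k = q then of_int (sign p) * T p else 0)"
    using r by (intro sum.remove) auto
  also have "(\<Sum>k\<in>{0..<m} - {r}. \<Sum>p\<in>?S. if p k = q then of_int (sign p) * T p else 0) =
      (\<Sum>k\<in>{0..<m} - {r}. \<Sum>p\<in>?S. if p r = q then - (of_int (sign p) * T (p \<circ> transpose r k)) else 0)"
    by (intro sum.cong refl part) auto
  also have "\<dots> = (\<Sum>p\<in>?S. \<Sum>k\<in>{0..<m} - {r}. if p r = q then - (of_int (sign p) * T (p \<circ> transpose r k)) else 0)"
    by (rule sum.swap)
  also have "(\<Sum>p\<in>?S. if p r = q then of_int (sign p) * T p else 0) + \<dots> =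
      (\<Sum>p\<in>?S. if p r = q then of_int (sign p) * (T p - (\<Sum>k\<in>{0..<m} - {r}. T (p \<circ> transpose r k))) else 0)"
    unfolding sum.distrib[symmetric]
    by (intro sum.cong refl) (simp add: sum_negf right_diff_distrib sum_distrib_left)
  also have "\<dots> \<in> Q_ideal N"
  proof (rule Q.sum_mem)
    fix p assume "p \<in> ?S"
    then have p: "p permutes {0..<m}" by simp
    have "of_int (sign p) * (T p - (\<Sum>k\<in>{0..<m} - {r}. T (p \<circ> transpose r k))) \<in> Q_ideal N" if pr: "p r = q"
    proof -
      have "card ({0..<m} - {r}) = m - 1" using r by simp
      moreover have "m \<ge> 1" using r by simp
      ultimately have card: "of_nat (card ({0..<m} - {r})) = (of_nat m - 1 :: 'k spoly)"
        by (simp add: of_nat_diff)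
      have "of_nat (m + 1) = (0 :: 'k spoly)"
        unfolding const_of_nat[symmetric] m1 by simp
      then have "of_nat m + 1 = (0 :: 'k spoly)" by (simp add: add.commute)
      then have "(of_nat m + 1) * Y p = 0" by simp
      then have "T p - (\<Sum>k\<in>{0..<m} - {r}. T (p \<circ> transpose r k)) =
          (T p + 2 * Y p) - (\<Sum>k\<in>{0..<m} - {r}. T (p \<circ> transpose r k) - Y p)"
        unfolding sum_subtractf sum_constant card by (simp add: algebra_simps)
      also have "\<dots> \<in> Q_ideal N"
        by (rule Q.diff_mem[OF 1[OF p pr] Q.sum_mem]) (rule 2[OF p pr], auto)
      finally show ?thesis by (intro Q.mult_mem polys_of_int)
    qed
    then show "(if p r = q then of_int (sign p) * (T p - (\<Sum>k\<in>{0..<m} - {r}. T (p \<circ> transpose r k))) else 0) \<in> Q_ideal N"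
      by simp
  qed
  finally show ?thesis .
qed

end

lemma F_index_enum:
  fixes U :: "nat set" and p :: nat
  defines "u \<equiv> sorted_list_of_set U"
  defines "a \<equiv> (!) u" and "b \<equiv> (\<lambda>j. u ! (p - 1 + j))"
  assumes U: "U \<in> F_index N p"
  shows "inj_on a {0..<p - 1}" "inj_on b {0..<p - 1}"
    and "a ` {0..<p - 1} \<union> b ` {0..<p - 1} = U"
    and "\<And>k l. k < p - 1 \<Longrightarrow> l < p - 1 \<Longrightarrow> a k < b l"
    and "a ` {0..<p - 1} \<inter> b ` {0..<p - 1} = {}"
proof -
  let ?m = "p - 1"
  have fin: "finite U" and card: "card U = ?m + ?m" and sub: "U \<subseteq> {1..N}"
    using U by (auto simp: F_index_def intro: finite_subset)
  have len: "length u = ?m + ?m" and dist: "distinct u" and set: "set u = U"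
    using fin card by (simp_all add: u_def)
  show "inj_on a {0..<?m}" "inj_on b {0..<?m}"
    using dist len by (auto simp: inj_on_def a_def b_def nth_eq_iff_index_eq)
  have "U = (!) u ` {0..<?m + ?m}"
    unfolding set[symmetric] len[symmetric] by (auto simp: set_conv_nth)
  also have "{0..<?m + ?m} = {0..<?m} \<union> (+) ?m ` {0..<?m}"
    unfolding image_add_atLeastLessThan by auto
  also have "(!) u ` ({0..<?m} \<union> (+) ?m ` {0..<?m}) = a ` {0..<?m} \<union> b ` {0..<?m}"
    by (simp add: a_def b_def image_Un image_image)
  finally show "a ` {0..<?m} \<union> b ` {0..<?m} = U" by simp
  have "sorted_wrt (<) u" unfolding u_def by (rule strict_sorted_list_of_set)
  then show less: "a k < b l" if "k < ?m" "l < ?m" for k l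
    unfolding a_def b_def using that len by (intro sorted_wrt_nth_less[of "(<)"]) auto
  show "a ` {0..<?m} \<inter> b ` {0..<?m} = {}"
  proof (rule ccontr)
    assume "a ` {0..<?m} \<inter> b ` {0..<?m} \<noteq> {}"
    then obtain k l where "k < ?m" "l < ?m" "a k = b l" by auto
    with less[of k l] show False by simp
  qed
qed

lemma F_index_subset: "U \<in> F_index N p \<Longrightarrow> U \<subseteq> {1..N}"
  by (simp add: F_index_def)

lemma F_minor_polys: "U \<in> F_index N p \<Longrightarrow> F_minor p U \<in> polys N"
  unfolding F_minor_eq_sym_minor
  using F_index_enum(3)[of U N p] F_index_subset[of U N p] by (intro sym_minor_polys) blast+

lemma two_neq_0_CHAR: "CHAR('k::field) = p \<Longrightarrow> p > 2 \<Longrightarrow> (2::'k) \<noteq> 0"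
  using of_nat_eq_0_iff_char_dvd[of 2, where ?'a = 'k] by (auto dest: dvd_imp_le)

text \<open>The matching joins the first row index to another element of \<open>U\<close>, which is
  a row or a column index; this single arc already multiplies \<open>F_U\<close> into
  \<open>Q\<close>.\<close>

lemma matchings_mult_F_minor:
  assumes p: "CHAR('k::field) = p" "p > 2" and U: "U \<in> F_index N p" and g: "g \<in> matchings U"
  shows "g * F_minor p U \<in> (Q_ideal N :: 'k spoly set)"
  using g
proof (induction rule: matchings.induct)
  case (matchings_arcs l)
  define a where "a = (!) (sorted_list_of_set U)"
  define b where "b = (\<lambda>j. a (p - 1 + j))"
  note enum = F_index_enum[OF U, folded a_def, folded b_def]
  have ranges: "a ` {0..<p - 1} \<subseteq> {1..N}" "b ` {0..<p - 1} \<subseteq> {1..N}"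
    using enum(3) F_index_subset[OF U] by blast+
  have F: "F_minor p U = sym_minor (p - 1) a b"
    by (simp add: F_minor_eq_sym_minor a_def b_def)
  have 0: "0 < p - 1" using p by simp
  then have "a 0 \<in> set l" using matchings_arcs(2) enum(3) by auto
  then obtain k l' where k: "arcs l = symvar (a 0) k * (arcs l' :: 'k spoly)" "distinct (a 0 # k # l')"
      "set (a 0 # k # l') = U" "even (length l')"
    using arcs_pick[OF matchings_arcs(1,3)] matchings_arcs(2) by blast
  have "of_nat p = (0::'k)" using p(1) by auto
  then have m1: "of_nat (p - 1 + 1) = (0::'k)" using p(2) by simp
  have two: "(2::'k) \<noteq> 0" using p by (rule two_neq_0_CHAR)
  have "k \<in> a ` {0..<p - 1} \<union> b ` {0..<p - 1}" unfolding enum(3) using k(3) by auto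
  then consider r where "r < p - 1" "k = a r" | q where "q < p - 1" "k = b q" by auto
  then have "symvar (a 0) k * F_minor p U \<in> (Q_ideal N :: 'k spoly set)"
  proof cases
    case (1 r)
    then have "0 \<noteq> r" using k(2) by (cases r) auto
    then show ?thesis unfolding F 1(2)
      using sym_minor_row_arc[OF enum(1) ranges(1) enum(2) ranges(2) enum(5) two 0 1(1)] by simp
  next
    case (2 q)
    then show ?thesis unfolding F 2(2)
      using sym_minor_cross_arc[OF enum(1) ranges(1) enum(2) ranges(2) enum(5) m1 0 2(1)] by simp
  qed
  moreover have "arcs l' \<in> (polys N :: 'k spoly set)"
    using k(3) F_index_subset[OF U] by (intro arcs_polys) auto
  ultimately have "arcs l' * (symvar (a 0) k * F_minor p U) \<in> (Q_ideal N :: 'k spoly set)"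
    by (rule Q.mult_mem[rotated])
  then show ?case by (simp add: k(1) mult_ac)
next
  case (matchings_add f g)
  then show ?case by (simp add: distrib_right Q.add_mem)
next
  case (matchings_const_mult f c)
  then show ?case by (simp add: mult.assoc Q.const_mult_mem)
qed auto

text \<open>
  A monomial whose weight is complementary to that of \<open>F\<^sub>U\<close> is, modulo \<open>Q\<close>, a multiple of a matching
  of \<open>U\<close>, so it multiplies \<open>F\<^sub>U\<close> into \<open>Q\<close>. Hence \<open>F\<^sub>U(\<partial>) D\<^sub>N\<close> has no coefficients.
\<close>

lemma F_minor_in_Ann:
  assumes p: "CHAR('k::field) = p" "p > 2" and U: "U \<in> F_index N p"
  shows "F_minor p U \<in> (Ann N :: 'k spoly set)"
proof -
  let ?F = "F_minor p U :: 'k spoly" and ?D = "sym_det N :: 'k spoly"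
  have two: "(2::'k) \<noteq> 0" using p by (rule two_neq_0_CHAR)
  have "diff_op ?F ?D = 0"
  proof (rule ccontr)
    assume "diff_op ?F ?D \<noteq> 0"
    then obtain s where s: "s \<in> keys (diff_op ?F ?D)"
      by (metis keys_eq_empty ex_in_conv)
    have wt: "of_bool (x \<in> U) + wt s x = (if x \<in> {1..N} then 2 else 0)" for x
      using keys_diff_op_wt[OF s has_wt_F_minor[OF U] has_wt_sym_det] .
    have le: "\<forall>x. wt s x \<le> 2"
    proof
      fix x show "wt s x \<le> 2" using wt[of x] by (cases "x \<in> {1..N}") (simp_all del: atLeastAtMost_iff)
    qed
    have one: "{x. wt s x = 1} = U"
    proof (rule Set.set_eqI)
      fix x show "x \<in> {x. wt s x = 1} \<longleftrightarrow> x \<in> U"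
        using wt[of x] F_index_subset[OF U]
        by (cases "x \<in> {1..N}"; cases "x \<in> U") (auto simp del: atLeastAtMost_iff)
    qed
    have sub: "{x. wt s x = 2} \<subseteq> {1..N}"
    proof
      fix x assume "x \<in> {x. wt s x = 2}"
      then show "x \<in> {1..N}" using wt[of x] by (cases "x \<in> {1..N}") (simp_all del: atLeastAtMost_iff)
    qed
    have "sym_det N \<in> (polys N :: 'k spoly set)"
      unfolding sym_det_eq_sym_minor by (intro sym_minor_polys) auto
    moreover obtain t where "t + s \<in> keys ?D" using keys_diff_op[OF s] by blast
    ultimately have "keys (t + s) \<subseteq> indices N" by (auto simp: polys_def)
    moreover have "keys s \<subseteq> keys (t + s)" by (auto simp: in_keys_iff lookup_add)
    ultimately have "keys s \<subseteq> indices N" by blast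
    from monomial_normal_form[OF this, where ?'k = 'k, unfolded if_P[OF le] one]
    obtain g where g: "g \<in> matchings U" "single s (1::'k) - diag {x. wt s x = 2} * g \<in> Q_ideal N"
      by blast
    have "(single s 1 - diag {x. wt s x = 2} * g) * ?F + diag {x. wt s x = 2} * (g * ?F) \<in> Q_ideal N"
      using g sub by (intro Q.add_mem Q.mult_mem' Q.mult_mem matchings_mult_F_minor[OF p U] F_minor_polys[OF U] diag_polys)
    then have "single s 1 * ?F \<in> Q_ideal N" by (simp add: algebra_simps)
    then have "single s 1 * ?F \<in> Ann N" using Q_subset_Ann[OF two] by blast
    \<comment> \<open>Applying the monomial \<open>s\<close> itself tests its coefficient in
      \<open>F_U(\<partial>) D_N\<close>, up to a power of 2, because the weights bound all
      exponents by 2.\<close>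
    then have "monom_deriv s (diff_op ?F ?D) = 0" by (simp add: Ann_def diff_op_mult)
    moreover have "lookup s v \<le> 2" for v using lookup_le_wt[of s v] le by (meson order_trans)
    ultimately have "lookup (diff_op ?F ?D) s = 0"
      using lookup_monom_deriv_0_eq_0_iff[OF _ two, of s "diff_op ?F ?D"] by simp
    with s show False by (simp add: in_keys_iff)
  qed
  then show ?thesis by (simp add: Ann_def F_minor_polys[OF U])
qed

text \<open>Comparing weights, the result is 0 for different sets of equal size and a constant for
  equal ones. The row indices precede the column indices, so different permutations give different
  squarefree monomials, and each of the (p - 1)! permutations contributes the square of its
  sign.\<close>

lemma diff_op_F_minor_F_minor:
  assumes U: "U \<in> F_index N p" and U': "U' \<in> F_index N p"
  shows "diff_op (F_minor p U') (F_minor p U) =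
     (if U = U' then const (of_nat (fact (p - 1))) else (0 :: 'k::comm_ring_1 spoly))"
proof -
  let ?F = "F_minor p U :: 'k spoly" and ?m = "p - 1"
  have wt: "of_bool (x \<in> U') + wt t x = of_bool (x \<in> U)"
    if "t \<in> keys (diff_op (F_minor p U') ?F)" for t x
    using keys_diff_op_wt[OF that has_wt_F_minor[OF U'] has_wt_F_minor[OF U]] .
  show ?thesis
  proof (cases "U = U'")
    case False
    have "diff_op (F_minor p U') ?F = 0"
    proof (rule ccontr)
      assume "diff_op (F_minor p U') ?F \<noteq> 0"
      then obtain t where t: "t \<in> keys (diff_op (F_minor p U') ?F)"
        by (metis keys_eq_empty ex_in_conv)
      have "U' \<subseteq> U"
      proof
        fix x assume "x \<in> U'"
        with wt[OF t, of x] show "x \<in> U" by (cases "x \<in> U") auto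
      qed
      moreover have "card U' = card U" "finite U"
        using U U' by (auto simp: F_index_def intro: finite_subset)
      ultimately show False using False card_subset_eq by blast
    qed
    with False show ?thesis by simp
  next
    case True
    define a where "a = (!) (sorted_list_of_set U)"
    define b where "b = (\<lambda>j. a (?m + j))"
    note enum = F_index_enum[OF U, folded a_def, folded b_def]
    have F: "?F = sym_minor ?m a b" by (simp add: F_minor_eq_sym_minor a_def b_def)
    have mm: "(min (a k) (b l), max (a k) (b l)) = (a k, b l)" if "k < ?m" "l < ?m" for k l
      using enum(4)[OF that] by (simp add: b_def)
    have keys0: "t = 0" if "t \<in> keys (diff_op ?F ?F)" for t
      using wt[of t] that True by (intro wt_eq_0_imp) simp
    have inj: "p = q" if p: "p permutes {0..<?m}" and q: "q permutes {0..<?m}"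
      and eq: "arc_expo ?m a (b \<circ> p) = arc_expo ?m a (b \<circ> q)" for p q
    proof
      fix k
      show "p k = q k"
      proof (cases "k < ?m")
        case k: True
        then have pk: "p k < ?m" using p by simp
        have "k \<in> {k'\<in>{0..<?m}. (min (a k') ((b \<circ> p) k'), max (a k') ((b \<circ> p) k')) = (a k, b (p k))}"
          using k mm[OF k pk] by simp
        then have "lookup (arc_expo ?m a (b \<circ> p)) (a k, b (p k)) \<noteq> 0"
          unfolding lookup_arc_expo by (subst card_eq_0_iff) auto
        then have "card {k'\<in>{0..<?m}. (min (a k') ((b \<circ> q) k'), max (a k') ((b \<circ> q) k')) = (a k, b (p k))} \<noteq> 0"
          unfolding eq lookup_arc_expo .
        then obtain k' where k': "k' < ?m"
          "(min (a k') ((b \<circ> q) k'), max (a k') ((b \<circ> q) k')) = (a k, b (p k))"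
          by (metis (mono_tags, lifting) atLeastLessThan_iff card.empty empty_Collect_eq)
        moreover have "q k' < ?m" using q k'(1) by simp
        ultimately have "a k' = a k" "b (q k') = b (p k)" using mm[of k' "q k'"] by simp_all
        then have "k' = k" "q k' = p k"
          using enum(1,2) k k'(1) pk \<open>q k' < ?m\<close> by (auto simp: inj_on_def)
        then show ?thesis by simp
      next
        case False
        then show ?thesis using p q by (simp add: permutes_not_in)
      qed
    qed
    have sqfree: "lookup (arc_expo ?m a (b \<circ> p)) v \<le> 1" if p: "p permutes {0..<?m}" for p v
    proof -
      have sub: "{k\<in>{0..<?m}. (min (a k) ((b \<circ> p) k), max (a k) ((b \<circ> p) k)) = v} \<subseteq> {k\<in>{0..<?m}. a k = fst v}"
      proof safe
        fix k assume "k \<in> {0..<?m}"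
        then have "k < ?m" "p k < ?m" using p by simp_all
        from mm[OF this] show "a k = fst (min (a k) ((b \<circ> p) k), max (a k) ((b \<circ> p) k))" by simp
      qed
      have le: "card {k\<in>{0..<?m}. a k = fst v} \<le> 1"
        using enum(1) by (subst One_nat_def, subst card_le_Suc0_iff_eq) (auto simp: inj_on_def)
      have "finite {k\<in>{0..<?m}. a k = fst v}" by simp
      from order_trans[OF card_mono[OF this sub] le] show ?thesis
        unfolding lookup_arc_expo .
    qed
    let ?S = "{p. p permutes {0..<?m}}"
    have "lookup (diff_op ?F ?F) 0 = (\<Sum>p\<in>?S. of_int (sign p) * lookup (monom_deriv (arc_expo ?m a (b \<circ> p)) ?F) 0)"
    proof -
      have "?F = (\<Sum>p\<in>?S. const (of_int (sign p)) * single (arc_expo ?m a (b \<circ> p)) 1)"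
        unfolding F sym_minor_def const_of_int prod_symvar[where c = "b \<circ> p" for p, unfolded o_def]
        by (simp add: o_def)
      then have "diff_op ?F ?F = (\<Sum>p\<in>?S. const (of_int (sign p)) * monom_deriv (arc_expo ?m a (b \<circ> p)) ?F)"
        by (metis (no_types, lifting) sum.cong diff_op_sum diff_op_const_mult diff_op_single const_1 mult_1_left)
      then show ?thesis by (simp add: lookup_sum)
    qed
    also have "\<dots> = (\<Sum>p\<in>?S. of_int (sign p) * lookup ?F (arc_expo ?m a (b \<circ> p)))"
      using sqfree by (intro sum.cong refl) (simp add: lookup_monom_deriv_0)
    also have "\<dots> = (\<Sum>p\<in>?S. 1)"
    proof (intro sum.cong refl)
      fix p assume p: "p \<in> ?S"
      have "lookup ?F (arc_expo ?m a (b \<circ> p)) = (\<Sum>q\<in>?S. if q = p then of_int (sign p) else 0)"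
        unfolding F lookup_sym_minor using p inj by (intro sum.cong refl) auto
      also have "\<dots> = of_int (sign p)" using p by (simp add: sum.delta finite_permutations)
      finally show "of_int (sign p) * lookup ?F (arc_expo ?m a (b \<circ> p)) = 1"
        by (simp flip: of_int_mult)
    qed
    also have "\<dots> = of_nat (fact ?m)"
    proof -
      have "card ?S = fact ?m" by (rule card_permutations) simp_all
      then show ?thesis by (simp only: sum_constant mult_1_right)
    qed
    finally have "lookup (diff_op ?F ?F) 0 = of_nat (fact ?m)" .
    then have "diff_op ?F ?F = const (of_nat (fact ?m))"
      using keys0 by (intro poly_mapping_eqI) (metis const_def in_keys_iff lookup_single_eq lookup_single_not_eq)
    then show ?thesis using True by simp
  qed
qed

subsection \<open>Homogeneous components\<close>

lemma expo_degree_add: "expo_degree (s + t) = expo_degree s + expo_degree t"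
proof -
  let ?A = "keys s \<union> keys t"
  have *: "expo_degree r = (\<Sum>v\<in>?A. lookup r v)" if "keys r \<subseteq> ?A" for r
    unfolding expo_degree_def using that by (intro sum.mono_neutral_left) (auto simp: in_keys_iff)
  show ?thesis
    by (simp add: * keys_add lookup_add sum.distrib)
qed

lemma expo_degree_0 [simp]: "expo_degree 0 = 0"
  and expo_degree_single [simp]: "expo_degree (single v n) = n"
  by (simp_all add: expo_degree_def)

lemma expo_degree_eq_0_iff: "expo_degree s = 0 \<longleftrightarrow> s = 0"
  by (auto simp: expo_degree_def in_keys_iff intro!: poly_mapping_eqI)

lemma homogeneous_0 [simp]: "homogeneous d 0"
  by (simp add: homogeneous_def)

lemma homogeneous_mult: "homogeneous d f \<Longrightarrow> homogeneous e g \<Longrightarrow> homogeneous (d + e) (f * g)"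
  unfolding homogeneous_def using keys_mult[of f g] by (fastforce simp: expo_degree_add)

lemma homogeneous_add: "homogeneous d f \<Longrightarrow> homogeneous d g \<Longrightarrow> homogeneous d (f + g)"
  unfolding homogeneous_def using keys_add[of f g] by blast

lemma homogeneous_sum: "(\<And>x. x \<in> A \<Longrightarrow> homogeneous d (f x)) \<Longrightarrow> homogeneous d (sum f A)"
  by (induction A rule: infinite_finite_induct) (auto intro: homogeneous_add)

lemma homogeneous_const [simp]: "homogeneous 0 (const c)"
  by (simp add: homogeneous_def const_def)

lemma homogeneous_symvar [simp]: "homogeneous 1 (symvar i j)"
  by (simp add: homogeneous_def symvar_def)

definition hom_part :: "nat \<Rightarrow> 'k::comm_ring_1 spoly \<Rightarrow> 'k spoly" where
  "hom_part d f = (\<Sum>s | s \<in> keys f \<and> expo_degree s = d. single s (lookup f s))"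

lemma lookup_hom_part: "lookup (hom_part d f) s = (if expo_degree s = d then lookup f s else 0)"
proof -
  have "lookup (hom_part d f) s =
      (\<Sum>t | t \<in> keys f \<and> expo_degree t = d. if t = s then lookup f s else 0)"
    unfolding hom_part_def lookup_sum by (intro sum.cong) (auto simp: lookup_single when_def)
  then show ?thesis by (auto simp: sum.delta in_keys_iff)
qed

lemma hom_part_add: "hom_part d (f + g) = hom_part d f + hom_part d g"
  by (rule poly_mapping_eqI) (simp add: lookup_hom_part lookup_add)

lemma hom_part_0 [simp]: "hom_part d 0 = 0"
  by (rule poly_mapping_eqI) (simp add: lookup_hom_part)

lemma hom_part_sum: "hom_part d (sum f A) = (\<Sum>x\<in>A. hom_part d (f x))"
  by (induction A rule: infinite_finite_induct) (auto simp: hom_part_add)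

lemma hom_part_homogeneous:
  "homogeneous e f \<Longrightarrow> hom_part d f = (if d = e then f else 0)"
  by (rule poly_mapping_eqI) (auto simp: lookup_hom_part homogeneous_def in_keys_iff)

lemma homogeneous_hom_part [simp]: "homogeneous d (hom_part d f)"
  by (auto simp: homogeneous_def in_keys_iff lookup_hom_part split: if_splits)

lemma hom_part_polys: "f \<in> polys N \<Longrightarrow> hom_part d f \<in> polys N"
  by (auto simp: polys_def in_keys_iff lookup_hom_part split: if_splits)

lemma hom_part_0_eq: "hom_part 0 f = const (lookup f 0)"
  by (rule poly_mapping_eqI) (auto simp: lookup_hom_part expo_degree_eq_0_iff const_def lookup_single when_def)

lemma sum_hom_part: "(\<Sum>d\<in>expo_degree ` keys f. hom_part d f) = f"
  unfolding hom_part_def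
  using sum.image_gen[of "keys f" "\<lambda>s. single s (lookup f s)" expo_degree] poly_mapping_as_sum[of f]
  by simp

lemma hom_part_mult:
  assumes "homogeneous e g"
  shows "hom_part d (f * g) = (if e \<le> d then hom_part (d - e) f * g else 0)"
proof (induction f rule: poly_mapping_add_induct)
  case (single s c)
  have s: "homogeneous (expo_degree s) (single s c)" by (simp add: homogeneous_def)
  show ?case
    unfolding hom_part_homogeneous[OF homogeneous_mult[OF s assms]] hom_part_homogeneous[OF s] by auto
qed (simp add: distrib_right hom_part_add)

section \<open>Homogeneous generators and their degrees\<close>

lemma genideal_mono_polys:
  "G \<subseteq> G' \<Longrightarrow> G' \<subseteq> polys N \<Longrightarrow> genideal (sym_poly_ring N) G \<subseteq> genideal (sym_poly_ring N) G'"
  by (metis sym_poly.genideal_ideal sym_poly.genideal_minimal sym_poly.genideal_self subset_trans)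

text \<open>The polynomials all of whose components have the asserted property form an ideal
  containing \<open>G\<close>. The degree of a generator is passed as a function \<open>deg\<close>,
  since 0 is homogeneous of every degree.\<close>

lemma hom_part_genideal:
  fixes G :: "'k::comm_ring_1 spoly set"
  assumes G: "G \<subseteq> polys N" and hom: "\<And>g. g \<in> G \<Longrightarrow> homogeneous (deg g) g"
    and f: "f \<in> genideal (sym_poly_ring N) G"
  shows "hom_part e f \<in> genideal (sym_poly_ring N) {g \<in> G. deg g \<le> e}"
proof -
  define J where "J e = genideal (sym_poly_ring N) {g \<in> G. deg g \<le> e}" for e
  have J: "sym_ideal (J e) N" for e unfolding J_def using G by (intro genideal_sym_poly) auto
  have mono: "J d \<subseteq> J e" if "d \<le> e" for d e
    unfolding J_def using G that by (intro genideal_mono_polys) auto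
  define I where "I = {f \<in> polys N. \<forall>e. hom_part e f \<in> J e}"
  have "ideal I (sym_poly_ring N)"
  proof (rule ideal_sym_poly_ringI)
    show "0 \<in> I" by (simp add: I_def sym_ideal.zero_mem[OF J])
    show "f + g \<in> I" if "f \<in> I" "g \<in> I" for f g
      using that by (auto simp: I_def hom_part_add intro: sym_ideal.add_mem[OF J])
    show "h * f \<in> I" if h: "h \<in> polys N" and f: "f \<in> I" for h f
    proof -
      have "hom_part e (h * hom_part d f) \<in> J e" for d e
      proof (cases "d \<le> e")
        case True
        then have "hom_part d f \<in> J e" using f mono by (auto simp: I_def)
        then show ?thesis
          using True h by (simp add: hom_part_mult[where e = d] sym_ideal.mult_mem[OF J] hom_part_polys)
      next
        case False
        then show ?thesis by (simp add: hom_part_mult[where e = d] sym_ideal.zero_mem[OF J])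
      qed
      then have "hom_part e (h * (\<Sum>d\<in>expo_degree ` keys f. hom_part d f)) \<in> J e" for e
        unfolding sum_distrib_left hom_part_sum by (intro sym_ideal.sum_mem[OF J])
      then show ?thesis using h f by (auto simp: I_def sum_hom_part)
    qed
  qed (auto simp: I_def)
  moreover have "G \<subseteq> I"
  proof
    fix g assume g: "g \<in> G"
    have "hom_part e g \<in> J e" for e
    proof (cases "e = deg g")
      case True
      have "g \<in> J e" unfolding J_def
        using g True G sym_poly.genideal_self[of "{g \<in> G. deg g \<le> e}" N] by auto
      then show ?thesis by (simp add: hom_part_homogeneous[OF hom[OF g]] True)
    next
      case False
      then show ?thesis by (simp add: hom_part_homogeneous[OF hom[OF g]] sym_ideal.zero_mem[OF J])
    qed
    then show "g \<in> I" using g G by (auto simp: I_def)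
  qed
  ultimately have "genideal (sym_poly_ring N) G \<subseteq> I" by (rule sym_poly.genideal_minimal)
  with f show ?thesis by (auto simp: I_def J_def)
qed

lemma homogeneous_genideal:
  fixes G :: "'k::comm_ring_1 spoly set"
  assumes "G \<subseteq> polys N" "\<And>g. g \<in> G \<Longrightarrow> homogeneous (deg g) g"
    and "f \<in> genideal (sym_poly_ring N) G" "homogeneous e f"
  shows "f \<in> genideal (sym_poly_ring N) {g \<in> G. deg g \<le> e}"
  using hom_part_genideal[OF assms(1-3), of e] by (simp add: hom_part_homogeneous[OF assms(4)])

lemma Q_gens_homogeneous: "f \<in> Q_gens N \<Longrightarrow> homogeneous 2 f"
proof -
  have 1: "homogeneous 2 (symvar i j * symvar k l)" for i j k l
    using homogeneous_mult[OF homogeneous_symvar homogeneous_symvar] by (simp add: numeral_2_eq_2)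
  have 2: "homogeneous 2 (2 * symvar i j * symvar k l)" for i j k l
    using homogeneous_mult[OF homogeneous_const[of 2] 1, of i j k l]
    by (simp add: mult.assoc numeral_2_eq_2)
  assume "f \<in> Q_gens N"
  then show ?thesis
    unfolding Q_gens_def
    by (elim UnE CollectE exE conjE) (simp_all add: power2_eq_square 1 2 homogeneous_add)
qed

lemma homogeneous_sym_minor: "homogeneous m (sym_minor m a b)"
  unfolding sym_minor_def
proof (rule homogeneous_sum)
  fix p
  have "finite A \<Longrightarrow> homogeneous (card A) (\<Prod>k\<in>A. symvar (a k) (b (p k)))" for A
  proof (induction A rule: finite_induct)
    case empty
    show ?case using homogeneous_const[of 1] by simp
  next
    case (insert x A)
    then show ?case using homogeneous_mult[OF homogeneous_symvar] by fastforce
  qed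
  from homogeneous_mult[OF homogeneous_const[of "of_int (sign p)"] this[of "{0..<m}"]]
  show "homogeneous m (of_int (sign p) * (\<Prod>k\<in>{0..<m}. symvar (a k) (b (p k))))"
    by (simp add: const_of_int)
qed

lemma homogeneous_F_minor: "homogeneous (p - 1) (F_minor p U)"
  unfolding F_minor_eq_sym_minor by (rule homogeneous_sym_minor)

lemma hom_part_Q:
  assumes "q \<in> Q_ideal N"
  shows "hom_part e q \<in> Q_ideal N"
proof -
  have "hom_part e q \<in> genideal (sym_poly_ring N) {g \<in> Q_gens N. 2 \<le> e}"
    using Q_gens_subset Q_gens_homogeneous assms unfolding Q_ideal_def by (rule hom_part_genideal)
  also have "\<dots> \<subseteq> Q_ideal N"
    unfolding Q_ideal_def by (rule genideal_mono_polys[OF _ Q_gens_subset]) blast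
  finally show ?thesis .
qed

subsection \<open>Pairing with the minors\<close>

lemma diff_op_const: "diff_op f (const c) = const (lookup f 0 * c)"
proof (induction f rule: poly_mapping_add_induct)
  case (single s d)
  have "monom_deriv s (const c) = 0" if "s \<noteq> 0"
  proof (rule ccontr)
    assume "monom_deriv s (const c) \<noteq> 0"
    then obtain t where "t \<in> keys (monom_deriv s (const c))" by (metis ex_in_conv keys_eq_empty)
    from keys_monom_deriv[OF this] have "s + t = 0" by (auto simp: const_def split: if_splits)
    then have "lookup s v + lookup t v = 0" for v by (metis lookup_add lookup_zero)
    then have "s = 0" by (intro poly_mapping_eqI) simp
    with that show False by simp
  qed
  then show ?case by (cases "s = 0") (simp_all add: const_mult lookup_single_not_eq)
qed (simp add: diff_op_add lookup_add const_add distrib_right)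

lemma lookup_const_0: "lookup (const c) 0 = c"
  by (simp add: const_def)

text \<open>These functionals vanish on \<open>Q\<close> and take the values (p - 1)! or 0 on the
  minors; up to this unit they are dual to the family of the \<open>F_U\<close>.\<close>

definition F_coeff :: "nat \<Rightarrow> nat set \<Rightarrow> 'k::comm_ring_1 spoly \<Rightarrow> 'k" where
  "F_coeff p U f = lookup (diff_op f (F_minor p U)) 0"

lemma F_coeff_add: "F_coeff p U (f + g) = F_coeff p U f + F_coeff p U g"
  by (simp add: F_coeff_def diff_op_add lookup_add)

lemma F_coeff_diff: "F_coeff p U (f - g) = F_coeff p U f - F_coeff p U g"
  by (simp add: F_coeff_def diff_op_diff lookup_minus)

lemma F_coeff_sum: "F_coeff p U (sum f A) = (\<Sum>x\<in>A. F_coeff p U (f x))"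
  by (simp add: F_coeff_def diff_op_sum lookup_sum)

lemma F_coeff_const_mult: "F_coeff p U (const c * f) = c * F_coeff p U f"
  by (simp add: F_coeff_def diff_op_const_mult)

lemma F_coeff_Q: "(2::'k::field) \<noteq> 0 \<Longrightarrow> q \<in> Q_ideal N \<Longrightarrow> F_coeff p U (q :: 'k spoly) = 0"
  by (simp add: F_coeff_def F_minor_eq_sym_minor Q_annihilates_sym_minor)

lemma F_coeff_F_minor:
  assumes "U \<in> F_index N p" "U' \<in> F_index N p"
  shows "F_coeff p U (F_minor p U') = (if U = U' then of_nat (fact (p - 1)) else 0)"
  unfolding F_coeff_def diff_op_F_minor_F_minor[OF assms]
  by (cases "U = U'") (simp_all only: refl if_True if_False lookup_const_0 lookup_zero)

lemma finite_F_index: "finite (F_index N p)"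
  unfolding F_index_def by (rule finite_subset[of _ "Pow {1..N}"]) auto

section \<open>The annihilator in odd characteristic\<close>

locale odd_char =
  fixes N p :: nat and ty :: "'k::field itself"
  assumes CHAR: "CHAR('k) = p" and p2: "p > 2"
begin

abbreviation "F \<equiv> F_minor p :: nat set \<Rightarrow> 'k spoly"
abbreviation "Q \<equiv> Q_ideal N :: 'k spoly set"
abbreviation "An \<equiv> Ann N :: 'k spoly set"
abbreviation "\<FF> \<equiv> F_index N p"
abbreviation "fct \<equiv> of_nat (fact (p - 1)) :: 'k"

lemma two: "(2::'k) \<noteq> 0"
  using CHAR p2 by (rule two_neq_0_CHAR)

lemma fct_neq_0: "fct \<noteq> 0"
  using of_nat_fact_CHAR_neq_0[where ?'k = 'k] CHAR p2 by simp

lemma F_Ann: "U \<in> \<FF> \<Longrightarrow> F U \<in> An"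
  by (rule F_minor_in_Ann[OF CHAR p2])

lemma Q_Ann: "Q \<subseteq> An"
  by (rule Q_subset_Ann[OF two])

sublocale A: sym_ideal An N
  by (rule sym_ideal_Ann)

lemma F_subset_polys: "F ` \<FF> \<subseteq> polys N"
  using F_Ann A.subset_polys by blast

lemma genideal_F: "genideal (sym_poly_ring N) (F ` \<FF>) \<subseteq> {\<Sum>U\<in>\<FF>. c U * F U | c. \<forall>U. c U \<in> polys N}"
proof (rule sym_poly.genideal_minimal)
  show "ideal {\<Sum>U\<in>\<FF>. c U * F U | c. \<forall>U. c U \<in> polys N} (sym_poly_ring N)"
  proof (rule ideal_sym_poly_ringI)
    show "{\<Sum>U\<in>\<FF>. c U * F U | c. \<forall>U. c U \<in> polys N} \<subseteq> polys N"
      using F_subset_polys by (auto intro!: polys_sum polys_mult)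
    show "0 \<in> {\<Sum>U\<in>\<FF>. c U * F U | c. \<forall>U. c U \<in> polys N}"
      by (rule CollectI, rule exI[of _ "\<lambda>_. 0"]) simp
  next
    fix f g assume "f \<in> {\<Sum>U\<in>\<FF>. c U * F U | c. \<forall>U. c U \<in> polys N}" "g \<in> {\<Sum>U\<in>\<FF>. c U * F U | c. \<forall>U. c U \<in> polys N}"
    then obtain c d where "f = (\<Sum>U\<in>\<FF>. c U * F U)" "\<forall>U. c U \<in> polys N" "g = (\<Sum>U\<in>\<FF>. d U * F U)" "\<forall>U. d U \<in> polys N"
      by blast
    then show "f + g \<in> {\<Sum>U\<in>\<FF>. c U * F U | c. \<forall>U. c U \<in> polys N}"
      by (intro CollectI exI[of _ "\<lambda>U. c U + d U"]) (auto simp: distrib_right sum.distrib)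
  next
    fix f g :: "'k spoly"
    assume "f \<in> polys N" "g \<in> {\<Sum>U\<in>\<FF>. c U * F U | c. \<forall>U. c U \<in> polys N}"
    then obtain d where "f \<in> polys N" "g = (\<Sum>U\<in>\<FF>. d U * F U)" "\<forall>U. d U \<in> polys N"
      by blast
    then show "f * g \<in> {\<Sum>U\<in>\<FF>. c U * F U | c. \<forall>U. c U \<in> polys N}"
      by (intro CollectI exI[of _ "\<lambda>U. f * d U"]) (auto simp: sum_distrib_left mult.assoc)
  qed
  show "F ` \<FF> \<subseteq> {\<Sum>U\<in>\<FF>. c U * F U | c. \<forall>U. c U \<in> polys N}"
  proof
    fix f assume "f \<in> F ` \<FF>"
    then obtain V where V: "V \<in> \<FF>" "f = F V" by blast
    have "(\<Sum>U\<in>\<FF>. of_bool (U = V) * F U) = (\<Sum>U\<in>\<FF>. if U = V then F V else 0)"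
      by (intro sum.cong) auto
    also have "\<dots> = F V" using V(1) finite_F_index by (simp add: sum.delta)
    finally show "f \<in> {\<Sum>U\<in>\<FF>. c U * F U | c. \<forall>U. c U \<in> polys N}"
      unfolding V(2) by (intro CollectI exI[of _ "\<lambda>U. of_bool (U = V)"]) auto
  qed
qed

lemma sym_ideal_sum: "sym_ideal (Q <+>\<^bsub>sym_poly_ring N\<^esub> genideal (sym_poly_ring N) (F ` \<FF>)) N"
  unfolding sym_ideal_def
  by (intro sym_poly.add_ideals sym_poly.genideal_ideal F_subset_polys) (rule Q.is_ideal)

lemma mem_sum_iff: "f \<in> A <+>\<^bsub>sym_poly_ring N\<^esub> B \<longleftrightarrow> (\<exists>a\<in>A. \<exists>b\<in>B. f = a + b)"
  by (auto simp: set_add_def set_mult_def)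

lemma Ann_eq_sum: "An = Q <+>\<^bsub>sym_poly_ring N\<^esub> genideal (sym_poly_ring N) (F ` \<FF>)" (is "_ = ?P")
proof
  interpret G: sym_ideal "genideal (sym_poly_ring N) (F ` \<FF>)" N
    by (rule genideal_sym_poly[OF F_subset_polys])
  have self: "F ` \<FF> \<subseteq> genideal (sym_poly_ring N) (F ` \<FF>)"
    by (rule sym_poly.genideal_self[OF F_subset_polys])
  have "genideal (sym_poly_ring N) (F ` \<FF>) \<subseteq> An"
    by (rule sym_poly.genideal_minimal[OF A.is_ideal]) (use F_Ann in blast)
  then show PA: "?P \<subseteq> An"
    using Q_Ann by (auto simp: mem_sum_iff intro!: A.add_mem)
  show "An \<subseteq> ?P"
  proof (rule Ann_subset[OF sym_ideal_sum _ PA two])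
    show "Q \<subseteq> ?P"
    proof
      fix q assume "q \<in> Q"
      then show "q \<in> ?P" unfolding mem_sum_iff by (intro bexI[of _ q] bexI[of _ 0]) auto
    qed
    fix U assume "U \<in> F_index N CHAR('k)"
    then show "F_minor CHAR('k) U \<in> ?P"
      unfolding mem_sum_iff CHAR using self by (intro bexI[of _ 0] bexI[of _ "F U"]) auto
  qed
qed

lemma Ann_decompose:
  assumes "f \<in> An"
  obtains q c where "q \<in> Q" "\<And>U. c U \<in> polys N" "f = q + (\<Sum>U\<in>\<FF>. c U * F U)"
proof -
  from assms obtain q g where "q \<in> Q" "g \<in> genideal (sym_poly_ring N) (F ` \<FF>)" "f = q + g"
    unfolding Ann_eq_sum mem_sum_iff by blast
  moreover from this(2) genideal_F obtain c where "g = (\<Sum>U\<in>\<FF>. c U * F U)" "\<forall>U. c U \<in> polys N"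
    by blast
  ultimately show thesis using that by blast
qed

abbreviation "gens \<equiv> Q_gens N \<union> F ` \<FF>"

lemma gens_polys: "gens \<subseteq> polys N"
  using Q_gens_subset F_subset_polys by blast

lemma gens_Ann: "gens \<subseteq> An"
  using Q_gens_in_Q Q_Ann F_Ann by blast

lemma Ann_eq_genideal: "An = genideal (sym_poly_ring N) gens"
proof
  interpret G: sym_ideal "genideal (sym_poly_ring N) gens" N
    by (rule genideal_sym_poly[OF gens_polys])
  have "Q \<subseteq> genideal (sym_poly_ring N) gens" "genideal (sym_poly_ring N) (F ` \<FF>) \<subseteq> genideal (sym_poly_ring N) gens"
    unfolding Q_ideal_def using gens_polys by (intro genideal_mono_polys; blast)+
  then show "An \<subseteq> genideal (sym_poly_ring N) gens"
    unfolding Ann_eq_sum by (auto simp: mem_sum_iff intro!: G.add_mem)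
  show "genideal (sym_poly_ring N) gens \<subseteq> An"
    by (rule sym_poly.genideal_minimal[OF A.is_ideal gens_Ann])
qed

text \<open>In a decomposition of \<open>f\<close>, the part in \<open>Q\<close> annihilates
  \<open>F_U\<close>, and each minor already sends \<open>F_U\<close> to a constant, of which a
  further coefficient polynomial sees only its own constant term.\<close>

lemma diff_op_Ann_F:
  assumes f: "f \<in> An" and U: "U \<in> \<FF>"
  shows "diff_op f (F U) = const (F_coeff p U f)"
proof -
  obtain q c where qc: "q \<in> Q" "\<And>U. c U \<in> polys N" "f = q + (\<Sum>U\<in>\<FF>. c U * F U)"
    using Ann_decompose[OF f] by blast
  have "diff_op f (F U) = (\<Sum>V\<in>\<FF>. diff_op (c V) (diff_op (F V) (F U)))"
    unfolding qc(3) diff_op_add diff_op_sum diff_op_mult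
    using Q_annihilates_sym_minor[OF two qc(1)] by (simp add: F_minor_eq_sym_minor)
  also have "\<dots> = (\<Sum>V\<in>\<FF>. if V = U then diff_op (c V) (const fct) else 0)"
    using U by (intro sum.cong refl) (simp add: diff_op_F_minor_F_minor)
  also have "\<dots> = const (lookup (c U) 0 * fct)"
    using U finite_F_index by (simp add: diff_op_const)
  finally show ?thesis unfolding F_coeff_def by (simp add: const_def)
qed

text \<open>So the pairing vanishes on the multiples of \<open>Ann\<close> by polynomials without
  constant term. It thereby takes over the role of the graded Nakayama lemma in the statements on
  minimal generators.\<close>

lemma F_coeff_mult:
  "f \<in> An \<Longrightarrow> U \<in> \<FF> \<Longrightarrow> F_coeff p U (r * f) = lookup r 0 * F_coeff p U f"
  unfolding F_coeff_def[of p U "r * f"] diff_op_mult diff_op_Ann_F diff_op_const by (simp add: const_def)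

text \<open>Up to the unit \<open>fct\<close>, the projection of \<open>Ann\<close> onto the span of
  the minors; see \<open>F_part_F\<close>.\<close>

definition F_part :: "'k spoly \<Rightarrow> 'k spoly" where
  "F_part f = (\<Sum>U\<in>\<FF>. const (F_coeff p U f) * F U)"

text \<open>The minors have degree p - 1, so in this degree only the constant terms of their
  coefficients survive, and \<open>F_coeff\<close> recovers these up to \<open>fct\<close>.\<close>

lemma hom_part_Ann:
  assumes f: "f \<in> An"
  shows "const fct * hom_part (p - 1) f - F_part f \<in> Q"
proof -
  obtain q c where qc: "q \<in> Q" "\<And>U. c U \<in> polys N" "f = q + (\<Sum>U\<in>\<FF>. c U * F U)"
    using Ann_decompose[OF f] by blast
  have coeff: "F_coeff p U f = lookup (c U) 0 * fct" if "U \<in> \<FF>" for U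
  proof -
    have "F_coeff p U f = (\<Sum>V\<in>\<FF>. lookup (c V) 0 * F_coeff p U (F V))"
      unfolding qc(3) F_coeff_add F_coeff_sum using that
      by (simp add: F_coeff_Q[OF two qc(1)] F_coeff_mult F_Ann)
    also have "\<dots> = (\<Sum>V\<in>\<FF>. if V = U then lookup (c V) 0 * fct else 0)"
      using that by (intro sum.cong refl) (simp add: F_coeff_F_minor)
    finally show ?thesis using that finite_F_index by simp
  qed
  have "hom_part (p - 1) f = hom_part (p - 1) q + (\<Sum>U\<in>\<FF>. const (lookup (c U) 0) * F U)"
    unfolding qc(3) hom_part_add hom_part_sum
    by (simp add: hom_part_mult[OF homogeneous_F_minor] hom_part_0_eq)
  moreover have "F_part f = const fct * (\<Sum>U\<in>\<FF>. const (lookup (c U) 0) * F U)"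
    unfolding F_part_def sum_distrib_left
    by (intro sum.cong refl) (simp add: coeff const_mult mult_ac)
  ultimately have "const fct * hom_part (p - 1) f - F_part f = const fct * hom_part (p - 1) q"
    by (simp add: distrib_left)
  then show ?thesis using Q.const_mult_mem[OF hom_part_Q[OF qc(1)]] by simp
qed

end

subsection \<open>The module \<open>Ann/Q\<close>\<close>

lemma Q_class_eq_iff:
  assumes "f \<in> polys N" "g \<in> polys N"
  shows "Q_class N f = Q_class N g \<longleftrightarrow> f - g \<in> (Q_ideal N :: 'k::comm_ring_1 spoly set)"
proof -
  have "f \<ominus>\<^bsub>sym_poly_ring N\<^esub> g = f - g"
    using assms by (simp add: a_minus_def)
  then show ?thesis
    using sym_poly.quotient_eq_iff_same_a_r_cos[OF Q.is_ideal assms] by (simp add: Q_class_def)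
qed

lemma Q_class_ring_hom: "Q_class N \<in> Ring.ring_hom (sym_poly_ring N) (sym_poly_ring N Quot (Q_ideal N :: 'k::comm_ring_1 spoly set))"
  using ideal.rcos_ring_hom[OF Q.is_ideal] by (simp add: Q_class_def[abs_def])

lemma Q_class_add:
  "f \<in> polys N \<Longrightarrow> g \<in> polys N \<Longrightarrow>
    Q_class N f <+>\<^bsub>sym_poly_ring N\<^esub> Q_class N g = Q_class N (f + g :: 'k::comm_ring_1 spoly)"
  using ring_hom_add[OF Q_class_ring_hom, of f N g] by (simp add: FactRing_def)

lemma Q_class_mult:
  "r \<in> polys N \<Longrightarrow> f \<in> polys N \<Longrightarrow>
    rcoset_mult (sym_poly_ring N) (Q_ideal N) (Q_class N r) (Q_class N f) = Q_class N (r * f :: 'k::comm_ring_1 spoly)"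
  using ring_hom_mult[OF Q_class_ring_hom, of r N f] by (simp add: FactRing_def)

lemma Q_class_0: "Q_class N 0 = (Q_ideal N :: 'k::comm_ring_1 spoly set)"
  using additive_subgroup.a_subset[OF Q.is_additive_subgroup]
  by (simp add: Q_class_def a_r_coset_def r_coset_def)

lemma Ann_mod_Q_simps:
  "carrier (Ann_mod_Q N) = Q_class N ` Ann N"
  "add (Ann_mod_Q N) = set_add (sym_poly_ring N)"
  "zero (Ann_mod_Q N) = Q_class N 0"
  by (simp_all add: Ann_mod_Q_def quot_module_def Q_class_def[abs_def] Q_class_0[unfolded Q_class_def])

lemma smult_Ann_mod_Q:
  "r \<in> polys N \<Longrightarrow> f \<in> polys N \<Longrightarrow> r \<odot>\<^bsub>Ann_mod_Q N\<^esub> Q_class N f = Q_class N (r * f)"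
  using Q_class_mult[of r N f] by (simp add: Ann_mod_Q_def quot_module_def Q_class_def)

interpretation Ann: sym_ideal "Ann N :: 'k::comm_ring_1 spoly set" N for N
  by (rule sym_ideal_Ann)

lemma add_Ann_mod_Q:
  "f \<in> Ann N \<Longrightarrow> g \<in> Ann N \<Longrightarrow> Q_class N f \<oplus>\<^bsub>Ann_mod_Q N\<^esub> Q_class N g = Q_class N (f + g)"
  by (simp add: Ann_mod_Q_simps Q_class_add Ann.subset_polys)

lemma abelian_group_Ann_mod_Q:
  "abelian_group (Ann_mod_Q N :: ('k::comm_ring_1 spoly, 'k spoly set) module)"
proof (rule abelian_groupI)
  fix x :: "'k spoly set" assume "x \<in> carrier (Ann_mod_Q N)"
  then obtain f where f: "f \<in> Ann N" "x = Q_class N f" by (auto simp: Ann_mod_Q_simps)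
  show "\<zero>\<^bsub>Ann_mod_Q N\<^esub> \<oplus>\<^bsub>Ann_mod_Q N\<^esub> x = x"
    unfolding Ann_mod_Q_simps(3) f(2) using f(1) by (subst add_Ann_mod_Q) auto
  show "\<exists>y\<in>carrier (Ann_mod_Q N). y \<oplus>\<^bsub>Ann_mod_Q N\<^esub> x = \<zero>\<^bsub>Ann_mod_Q N\<^esub>"
    unfolding Ann_mod_Q_simps(1,3) f(2) using f(1)
    by (intro bexI[of _ "Q_class N (- f)"]) (auto simp: add_Ann_mod_Q Ann.uminus_mem)
next
  fix x y :: "'k spoly set" assume "x \<in> carrier (Ann_mod_Q N)" "y \<in> carrier (Ann_mod_Q N)"
  then obtain f g where fg: "f \<in> Ann N" "x = Q_class N f" "g \<in> Ann N" "y = Q_class N g"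
    by (auto simp: Ann_mod_Q_simps)
  then show "x \<oplus>\<^bsub>Ann_mod_Q N\<^esub> y \<in> carrier (Ann_mod_Q N)"
    by (auto simp: add_Ann_mod_Q Ann_mod_Q_simps(1))
  from fg show "x \<oplus>\<^bsub>Ann_mod_Q N\<^esub> y = y \<oplus>\<^bsub>Ann_mod_Q N\<^esub> x"
    by (simp add: add_Ann_mod_Q add.commute)
  fix z :: "'k spoly set" assume "z \<in> carrier (Ann_mod_Q N)"
  then obtain h where h: "h \<in> Ann N" "z = Q_class N h" by (auto simp: Ann_mod_Q_simps)
  with fg show "x \<oplus>\<^bsub>Ann_mod_Q N\<^esub> y \<oplus>\<^bsub>Ann_mod_Q N\<^esub> z = x \<oplus>\<^bsub>Ann_mod_Q N\<^esub> (y \<oplus>\<^bsub>Ann_mod_Q N\<^esub> z)"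
    by (simp add: add_Ann_mod_Q Ann.add_mem add.assoc)
qed (auto simp: Ann_mod_Q_simps)

lemma finsum_Ann_mod_Q:
  fixes f :: "'i \<Rightarrow> 'k::comm_ring_1 spoly"
  assumes "finite I" "\<And>i. i \<in> I \<Longrightarrow> f i \<in> Ann N"
  shows "(\<Oplus>\<^bsub>Ann_mod_Q N\<^esub>i\<in>I. Q_class N (f i)) = Q_class N (\<Sum>i\<in>I. f i)"
proof -
  interpret M: abelian_group "Ann_mod_Q N :: ('k spoly, 'k spoly set) module"
    by (rule abelian_group_Ann_mod_Q)
  show ?thesis
    using assms
  proof (induction I rule: finite_induct)
    case empty
    show ?case by (simp add: Ann_mod_Q_simps)
  next
    case (insert x I)
    then have "(\<Oplus>\<^bsub>Ann_mod_Q N\<^esub>i\<in>insert x I. Q_class N (f i)) =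
        Q_class N (f x) \<oplus>\<^bsub>Ann_mod_Q N\<^esub> (\<Oplus>\<^bsub>Ann_mod_Q N\<^esub>i\<in>I. Q_class N (f i))"
      by (intro M.finsum_insert) (auto simp: Ann_mod_Q_simps(1))
    also have "\<dots> = Q_class N (f x) \<oplus>\<^bsub>Ann_mod_Q N\<^esub> Q_class N (\<Sum>i\<in>I. f i)"
      using insert by simp
    also have "\<dots> = Q_class N (f x + (\<Sum>i\<in>I. f i))"
      using insert by (intro add_Ann_mod_Q Ann.sum_mem) auto
    finally show ?case using insert by simp
  qed
qed

text \<open>One direction of the correspondence between submodules of Ann/Q and ideals inside
  \<open>Ann\<close>; \<open>sym_ideal_Q_class_vimage\<close> is the other.\<close>

lemma submodule_Q_class_image:
  assumes I: "sym_ideal I N" "I \<subseteq> Ann N"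
  shows "submodule (Q_class N ` I) (sym_poly_ring N) (Ann_mod_Q N :: ('k::comm_ring_1 spoly, 'k spoly set) module)"
proof -
  interpret I: sym_ideal I N by (rule I(1))
  interpret M: abelian_group "Ann_mod_Q N :: ('k spoly, 'k spoly set) module"
    by (rule abelian_group_Ann_mod_Q)
  have inv: "\<ominus>\<^bsub>Ann_mod_Q N\<^esub> Q_class N f = Q_class N (- f)" if "f \<in> I" for f
  proof (rule M.minus_equality)
    show "Q_class N (- f) \<oplus>\<^bsub>Ann_mod_Q N\<^esub> Q_class N f = \<zero>\<^bsub>Ann_mod_Q N\<^esub>"
      using that I(2) by (subst add_Ann_mod_Q) (auto simp: Ann_mod_Q_simps)
  qed (use that I(2) in \<open>auto simp: Ann_mod_Q_simps(1)\<close>)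
  show ?thesis
  proof (intro submodule.intro submodule_axioms.intro M.add.subgroupI)
    show "Q_class N ` I \<subseteq> carrier (Ann_mod_Q N)" using I(2) by (auto simp: Ann_mod_Q_simps(1))
    show "Q_class N ` I \<noteq> {}" using I.zero_mem by blast
    show "\<ominus>\<^bsub>Ann_mod_Q N\<^esub> x \<in> Q_class N ` I" if "x \<in> Q_class N ` I" for x
      using that by (auto simp: inv)
    show "x \<oplus>\<^bsub>Ann_mod_Q N\<^esub> y \<in> Q_class N ` I" if "x \<in> Q_class N ` I" "y \<in> Q_class N ` I" for x y
      using that I(2) by (auto simp: add_Ann_mod_Q subset_iff)
    show "r \<odot>\<^bsub>Ann_mod_Q N\<^esub> x \<in> Q_class N ` I" if "r \<in> polys N" "x \<in> Q_class N ` I" for r x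
      using that by (auto simp: smult_Ann_mod_Q I.subset_polys I.mult_mem)
  qed
qed

lemma sym_ideal_Q_class_vimage:
  assumes "submodule H (sym_poly_ring N) (Ann_mod_Q N :: ('k::comm_ring_1 spoly, 'k spoly set) module)"
  shows "sym_ideal {f \<in> Ann N. Q_class N f \<in> H} N"
proof -
  interpret H: submodule H "sym_poly_ring N" "Ann_mod_Q N :: ('k spoly, 'k spoly set) module" by fact
  show ?thesis
    unfolding sym_ideal_def
  proof (rule ideal_sym_poly_ringI)
    show "0 \<in> {f \<in> Ann N. Q_class N f \<in> H}"
      using H.one_closed by (simp add: Ann_mod_Q_simps(3))
    show "f + g \<in> {f \<in> Ann N. Q_class N f \<in> H}"
      if "f \<in> {f \<in> Ann N. Q_class N f \<in> H}" "g \<in> {f \<in> Ann N. Q_class N f \<in> H}" for f g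
      using that H.m_closed[of "Q_class N f" "Q_class N g"] by (auto simp: add_Ann_mod_Q)
    show "r * f \<in> {f \<in> Ann N. Q_class N f \<in> H}"
      if "r \<in> polys N" "f \<in> {f \<in> Ann N. Q_class N f \<in> H}" for r f
      using that H.smult_closed[of r "Q_class N f"]
      by (auto simp: smult_Ann_mod_Q Ann.subset_polys Ann.mult_mem)
  qed (use Ann.subset_polys in auto)
qed

section \<open>Generation of Ann/Q by classes of minors\<close>

context odd_char
begin

abbreviation "M \<equiv> Ann_mod_Q N :: ('k spoly, 'k spoly set) module"

text \<open>The ideal of S corresponding to the submodule generated by \<open>G\<close>. All
  representatives are adjoined, which avoids a choice, and generation of Ann/Q becomes an inclusion
  of ideals.\<close>

definition lift_gens :: "'k spoly set set \<Rightarrow> 'k spoly set" where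
  "lift_gens G = genideal (sym_poly_ring N) (Q \<union> {f \<in> An. Q_class N f \<in> G})"

lemma lift_gens_polys: "Q \<union> {f \<in> An. Q_class N f \<in> G} \<subseteq> polys N"
  using Q.subset_polys A.subset_polys by blast

lemma sym_ideal_lift_gens: "sym_ideal (lift_gens G) N"
  unfolding lift_gens_def by (rule genideal_sym_poly[OF lift_gens_polys])

lemma lift_gens_mem: "Q \<subseteq> lift_gens G" "f \<in> An \<Longrightarrow> Q_class N f \<in> G \<Longrightarrow> f \<in> lift_gens G"
  unfolding lift_gens_def using sym_poly.genideal_self[OF lift_gens_polys, of G] by blast+

lemma lift_gens_minimal:
  "sym_ideal I N \<Longrightarrow> Q \<subseteq> I \<Longrightarrow> (\<And>f. f \<in> An \<Longrightarrow> Q_class N f \<in> G \<Longrightarrow> f \<in> I) \<Longrightarrow> lift_gens G \<subseteq> I"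
  unfolding lift_gens_def sym_ideal_def by (rule sym_poly.genideal_minimal) auto

lemma lift_gens_Ann: "lift_gens G \<subseteq> An"
  by (rule lift_gens_minimal[OF sym_ideal_Ann Q_Ann])

lemma generated_submodule_eq_carrier_iff:
  assumes G: "G \<subseteq> carrier M"
  shows "generated_submodule (sym_poly_ring N) M G = carrier M \<longleftrightarrow> An \<subseteq> lift_gens G"
proof
  assume eq: "generated_submodule (sym_poly_ring N) M G = carrier M"
  interpret L: sym_ideal "lift_gens G" N by (rule sym_ideal_lift_gens)
  have "submodule (Q_class N ` lift_gens G) (sym_poly_ring N) M"
    by (rule submodule_Q_class_image[OF sym_ideal_lift_gens lift_gens_Ann])
  moreover have "G \<subseteq> Q_class N ` lift_gens G"
  proof
    fix A assume A: "A \<in> G"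
    then obtain f where "f \<in> An" "A = Q_class N f" using G by (auto simp: Ann_mod_Q_simps(1))
    then show "A \<in> Q_class N ` lift_gens G" using lift_gens_mem(2)[of f G] A by simp
  qed
  ultimately have sub: "carrier M \<subseteq> Q_class N ` lift_gens G"
    unfolding eq[symmetric] generated_submodule_def
    by (rule Inter_lower[OF CollectI, OF conjI])
  show "An \<subseteq> lift_gens G"
  proof
    fix f assume f: "f \<in> An"
    then obtain g where g: "g \<in> lift_gens G" "Q_class N f = Q_class N g"
      using sub by (auto simp: Ann_mod_Q_simps(1))
    then have "f - g \<in> Q"
      using Q_class_eq_iff[OF A.subset_polys[OF f] L.subset_polys[OF g(1)]] by simp
    then have "f - g \<in> lift_gens G" using lift_gens_mem(1) by (rule subsetD[rotated])
    from L.add_mem_cancel[OF this] show "f \<in> lift_gens G" using g(1) by simp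
  qed
next
  assume sub: "An \<subseteq> lift_gens G"
  have "carrier M \<subseteq> H" if H: "submodule H (sym_poly_ring N) M" "G \<subseteq> H" for H
  proof -
    have "Q \<subseteq> {f \<in> An. Q_class N f \<in> H}"
    proof
      fix q assume q: "q \<in> Q"
      then have "Q_class N q = Q_class N 0" by (subst Q_class_eq_iff) (auto intro: Q.subset_polys)
      moreover have "Q_class N 0 \<in> H"
        using subgroup.one_closed[OF submodule.axioms(1)[OF H(1)]] by (simp add: Ann_mod_Q_simps(3))
      ultimately show "q \<in> {f \<in> An. Q_class N f \<in> H}" using q Q_Ann by auto
    qed
    then have "lift_gens G \<subseteq> {f \<in> An. Q_class N f \<in> H}"
      using H(2) by (intro lift_gens_minimal sym_ideal_Q_class_vimage[OF H(1)]) auto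
    then show ?thesis using sub by (auto simp: Ann_mod_Q_simps(1))
  qed
  moreover have "submodule (carrier M) (sym_poly_ring N) M"
    unfolding Ann_mod_Q_simps(1) by (rule submodule_Q_class_image[OF sym_ideal_Ann subset_refl])
  ultimately show "generated_submodule (sym_poly_ring N) M G = carrier M"
    unfolding generated_submodule_def using G
    by (intro subset_antisym Inter_lower Inter_greatest CollectI conjI) simp_all
qed

lemma F_part_add: "F_part (f + g) = F_part f + F_part g"
  by (simp add: F_part_def F_coeff_add const_add distrib_right sum.distrib)

lemma F_part_diff: "F_part (f - g) = F_part f - F_part g"
  using F_part_add[of "f - g" g] by simp

lemma F_part_Q: "q \<in> Q \<Longrightarrow> F_part q = 0"
  by (simp add: F_part_def F_coeff_Q[OF two])

lemma F_part_mult: "f \<in> An \<Longrightarrow> F_part (r * f) = const (lookup r 0) * F_part f"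
  by (simp add: F_part_def F_coeff_mult const_mult sum_distrib_left mult.assoc)

lemma F_part_F: "U \<in> \<FF> \<Longrightarrow> F_part (F U) = const fct * F U"
proof -
  assume U: "U \<in> \<FF>"
  then have "F_part (F U) = (\<Sum>V\<in>\<FF>. if V = U then const fct * F U else 0)"
    unfolding F_part_def by (intro sum.cong refl) (auto simp: F_coeff_F_minor)
  then show ?thesis using U finite_F_index by simp
qed

lemma F_coeff_F_part: "U \<in> \<FF> \<Longrightarrow> F_coeff p U (\<Sum>V\<in>\<FF>. const (c V) * F V) = c U * fct"
proof -
  assume U: "U \<in> \<FF>"
  then have "F_coeff p U (\<Sum>V\<in>\<FF>. const (c V) * F V) = (\<Sum>V\<in>\<FF>. if V = U then c V * fct else 0)"
    unfolding F_coeff_sum F_coeff_const_mult by (intro sum.cong refl) (simp add: F_coeff_F_minor)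
  then show ?thesis using U finite_F_index by simp
qed

lemma Q_class_F_eq_imp: "U \<in> \<FF> \<Longrightarrow> V \<in> \<FF> \<Longrightarrow> F U - F V \<in> Q \<Longrightarrow> U = V"
proof (rule ccontr)
  assume "U \<in> \<FF>" "V \<in> \<FF>" "F U - F V \<in> Q" "U \<noteq> V"
  then have "F_coeff p U (F U) - F_coeff p U (F V) = 0"
    using F_coeff_Q[OF two, of "F U - F V" N p U] by (simp add: F_coeff_diff)
  with \<open>U \<in> \<FF>\<close> \<open>V \<in> \<FF>\<close> \<open>U \<noteq> V\<close> show False
    using fct_neq_0 by (simp add: F_coeff_F_minor del: of_nat_fact)
qed

lemma inj_on_Q_class_F: "inj_on (\<lambda>U. Q_class N (F U)) \<FF>"
proof (rule inj_onI)
  fix U V assume UV: "U \<in> \<FF>" "V \<in> \<FF>" "Q_class N (F U) = Q_class N (F V)"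
  then have "F U - F V \<in> Q"
    using Q_class_eq_iff[OF A.subset_polys[OF F_Ann] A.subset_polys[OF F_Ann], of U V] by simp
  with UV show "U = V" by (intro Q_class_F_eq_imp)
qed

lemma card_F_index: "card \<FF> = N choose (2 * p - 2)"
  using n_subsets[of "{1..N}" "2 * p - 2"] by (simp add: F_index_def)

text \<open>Independence follows by applying \<open>F_coeff\<close>, spanning from
  \<open>hom_part_Ann\<close> after division by \<open>fct\<close>.\<close>

lemma K_basis: "K_basis_family M (Ann_mod_Q_component N (p - 1)) \<FF> (\<lambda>U. Q_class N (F U))"
  unfolding K_basis_family_def
proof (intro conjI allI impI ballI finite_F_index)
  have finsum: "(\<Oplus>\<^bsub>M\<^esub>U\<in>\<FF>. const (c U) \<odot>\<^bsub>M\<^esub> Q_class N (F U)) = Q_class N (\<Sum>U\<in>\<FF>. const (c U) * F U)" for c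
  proof -
    interpret M: abelian_group M by (rule abelian_group_Ann_mod_Q)
    have "(\<Oplus>\<^bsub>M\<^esub>U\<in>\<FF>. const (c U) \<odot>\<^bsub>M\<^esub> Q_class N (F U)) = (\<Oplus>\<^bsub>M\<^esub>U\<in>\<FF>. Q_class N (const (c U) * F U))"
      using F_Ann by (intro M.finsum_cong') (auto simp: smult_Ann_mod_Q A.subset_polys Ann_mod_Q_simps(1))
    also have "\<dots> = Q_class N (\<Sum>U\<in>\<FF>. const (c U) * F U)"
      using F_Ann by (intro finsum_Ann_mod_Q finite_F_index) auto
    finally show ?thesis .
  qed
  have sum_Ann: "(\<Sum>U\<in>\<FF>. const (c U) * F U) \<in> An" for c using F_Ann by auto
  show "(\<lambda>U. Q_class N (F U)) ` \<FF> \<subseteq> Ann_mod_Q_component N (p - 1)"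
    unfolding Ann_mod_Q_component_def using F_Ann homogeneous_F_minor by blast
  {
    fix c U assume "(\<Oplus>\<^bsub>M\<^esub>U\<in>\<FF>. const (c U) \<odot>\<^bsub>M\<^esub> Q_class N (F U)) = \<zero>\<^bsub>M\<^esub>" and U: "U \<in> \<FF>"
    then have "(\<Sum>U\<in>\<FF>. const (c U) * F U) \<in> Q"
      unfolding finsum Ann_mod_Q_simps(3) using sum_Ann[of c] by (subst (asm) Q_class_eq_iff) (auto intro: A.subset_polys)
    then have "c U * fct = 0" using F_coeff_Q[OF two] F_coeff_F_part[OF U, of c] by metis
    then show "c U = 0" using fct_neq_0 by (simp del: of_nat_fact)
  }
  fix x :: "'k spoly set" assume "x \<in> Ann_mod_Q_component N (p - 1)"
  then obtain f where f: "f \<in> An" "homogeneous (p - 1) f" "x = Q_class N f"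
    by (auto simp: Ann_mod_Q_component_def)
  let ?c = "\<lambda>U. inverse fct * F_coeff p U f"
  have "const fct * f - F_part f \<in> Q"
    using hom_part_Ann[OF f(1)] by (simp add: hom_part_homogeneous[OF f(2)] del: of_nat_fact)
  then have "const (inverse fct) * (const fct * f - F_part f) \<in> Q" by (rule Q.const_mult_mem)
  also have "const (inverse fct) * (const fct * f - F_part f) = f - (\<Sum>U\<in>\<FF>. const (?c U) * F U)"
    using fct_neq_0 unfolding F_part_def right_diff_distrib sum_distrib_left mult.assoc[symmetric] const_mult[symmetric]
    by (simp del: of_nat_fact)
  finally have "x = Q_class N (\<Sum>U\<in>\<FF>. const (?c U) * F U)"
    unfolding f(3) Q_class_eq_iff[OF A.subset_polys[OF f(1)] A.subset_polys[OF sum_Ann]] .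
  then show "\<exists>c. x = (\<Oplus>\<^bsub>M\<^esub>U\<in>\<FF>. const (c U) \<odot>\<^bsub>M\<^esub> Q_class N (F U))"
    unfolding finsum by (rule exI[of _ ?c])
qed

lemma Ann_subset_if_F_subset:
  assumes "sym_ideal I N" "Q \<subseteq> I" "F ` \<FF> \<subseteq> I"
  shows "An \<subseteq> I"
  unfolding Ann_eq_genideal
  by (rule sym_poly.genideal_minimal[OF sym_ideal.is_ideal[OF assms(1)]])
    (use assms(2,3) Q_gens_in_Q in blast)

text \<open>If the class of \<open>F_U\<close> is left out, all that is generated lies in the kernel
  of \<open>F_coeff p U\<close>, which is an ideal by \<open>F_coeff_mult\<close>; but
  \<open>F_U\<close> is not in this kernel.\<close>

lemma minimally_generates_F: "minimally_generates (sym_poly_ring N) M ((\<lambda>U. Q_class N (F U)) ` \<FF>)"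
proof -
  let ?G = "(\<lambda>U. Q_class N (F U)) ` \<FF>"
  have G: "?G \<subseteq> carrier M" using F_Ann by (auto simp: Ann_mod_Q_simps(1))
  have "An \<subseteq> lift_gens ?G"
    using F_Ann by (intro Ann_subset_if_F_subset sym_ideal_lift_gens lift_gens_mem(1)) (auto intro: lift_gens_mem(2))
  moreover have "\<not> An \<subseteq> lift_gens H" if H: "H \<subset> ?G" for H :: "'k spoly set set"
  proof
    assume sub: "An \<subseteq> lift_gens H"
    obtain U where U: "U \<in> \<FF>" "Q_class N (F U) \<notin> H" using H by blast
    have "lift_gens H \<subseteq> {f \<in> An. F_coeff p U f = 0}"
    proof (rule lift_gens_minimal)
      show "sym_ideal {f \<in> An. F_coeff p U f = 0} N"
        unfolding sym_ideal_def
        by (rule ideal_sym_poly_ringI)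
          (auto simp: F_coeff_add F_coeff_mult[OF _ U(1)] A.mult_mem intro: A.subset_polys, simp add: F_coeff_def)
      show "Q \<subseteq> {f \<in> An. F_coeff p U f = 0}" using Q_Ann F_coeff_Q[OF two] by blast
      fix f assume f: "f \<in> An" "Q_class N f \<in> H"
      then obtain V where V: "V \<in> \<FF>" "Q_class N f = Q_class N (F V)" using H by blast
      then have "U \<noteq> V" using U(2) f(2) by auto
      have "f - F V \<in> Q"
        using Q_class_eq_iff[OF A.subset_polys[OF f(1)] A.subset_polys[OF F_Ann[OF V(1)]]] V(2) by simp
      then have "F_coeff p U f = F_coeff p U (F V)"
        using F_coeff_Q[OF two, of "f - F V" N p U] by (simp add: F_coeff_diff)
      also have "\<dots> = 0" using U(1) V(1) \<open>U \<noteq> V\<close> by (simp add: F_coeff_F_minor)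
      finally show "f \<in> {f \<in> An. F_coeff p U f = 0}" using f(1) by simp
    qed
    then have "F_coeff p U (F U) = 0" using sub F_Ann[OF U(1)] by blast
    then show False using U(1) fct_neq_0 by (simp add: F_coeff_F_minor del: of_nat_fact)
  qed
  ultimately show ?thesis
    unfolding minimally_generates_def using G generated_submodule_eq_carrier_iff[OF G]
      generated_submodule_eq_carrier_iff[OF subset_trans[OF psubset_imp_subset G]]
    by simp
qed

end

lemma vector_space_spoly: "vector_space (\<lambda>c f. const c * f :: 'k::field spoly)"
  by unfold_locales (simp_all add: algebra_simps const_add const_mult)

context odd_char
begin

interpretation V: vector_space "\<lambda>c f. const c * f :: 'k spoly"
  by (rule vector_space_spoly)

lemma inj_on_F: "inj_on F \<FF>"
  using inj_on_Q_class_F by (auto simp: inj_on_def)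

lemma independent_F: "V.independent (F ` \<FF>)"
proof
  assume "V.dependent (F ` \<FF>)"
  then obtain u U where u: "U \<in> \<FF>" "u (F U) \<noteq> 0" "(\<Sum>v\<in>F ` \<FF>. const (u v) * v) = 0"
    using V.dependent_finite[of "F ` \<FF>"] finite_F_index by auto
  have "(\<Sum>V\<in>\<FF>. const (u (F V)) * F V) = 0"
    using u(3) by (simp add: sum.reindex[OF inj_on_F])
  then have "F_coeff p U (\<Sum>V\<in>\<FF>. const (u (F V)) * F V) = 0"
    by (simp add: F_coeff_def)
  then have "u (F U) * fct = 0" by (simp add: F_coeff_F_part[OF u(1), of "\<lambda>V. u (F V)"])
  with u(2) fct_neq_0 show False by (simp del: of_nat_fact)
qed

text \<open>
  The coefficients of the \<open>F\<^sub>U\<close> define a linear map from \<open>Ann\<close> to the span of the \<open>F\<^sub>U\<close>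
  that kills \<open>Q\<close> and the multiples by polynomials without constant term, so it maps generators onto
  a spanning set; conversely, lifts of a basis of the span already generate.
\<close>

lemma card_minimal_generators:
  assumes G: "G \<subseteq> (\<Union>d. Ann_mod_Q_component N d)" and min: "minimally_generates (sym_poly_ring N) M G"
  shows "finite G \<and> card G = card \<FF>"
proof -
  have carrier: "G \<subseteq> carrier M" and gen: "generated_submodule (sym_poly_ring N) M G = carrier M"
    and minimal: "\<And>H. H \<subset> G \<Longrightarrow> generated_submodule (sym_poly_ring N) M H \<noteq> carrier M"
    using min by (auto simp: minimally_generates_def)
  have "\<forall>A\<in>G. \<exists>f. f \<in> An \<and> (\<exists>d. homogeneous d f) \<and> Q_class N f = A"
    using G by (force simp: Ann_mod_Q_component_def)
  from bchoice[OF this] obtain r where r: "\<And>A. A \<in> G \<Longrightarrow> r A \<in> An"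
    "\<And>A. A \<in> G \<Longrightarrow> \<exists>d. homogeneous d (r A)" "\<And>A. A \<in> G \<Longrightarrow> Q_class N (r A) = A"
    by blast
  let ?T = "(\<lambda>A. F_part (r A)) ` G"
  have T_span: "?T \<subseteq> V.span (F ` \<FF>)"
    unfolding F_part_def by (intro image_subsetI V.span_sum V.span_scale V.span_base imageI)
  have "lift_gens G \<subseteq> {f \<in> An. F_part f \<in> V.span ?T}"
  proof (rule lift_gens_minimal)
    show "sym_ideal {f \<in> An. F_part f \<in> V.span ?T} N"
      unfolding sym_ideal_def
    proof (rule ideal_sym_poly_ringI)
      show "0 \<in> {f \<in> An. F_part f \<in> V.span ?T}"
        using F_part_Q[OF Q.zero_mem] V.span_zero by simp
    qed (auto simp: F_part_add F_part_mult intro: A.subset_polys A.mult_mem V.span_add V.span_scale)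
    show "Q \<subseteq> {f \<in> An. F_part f \<in> V.span ?T}"
      using Q_Ann F_part_Q V.span_zero by auto
    fix f assume f: "f \<in> An" "Q_class N f \<in> G"
    have "f - r (Q_class N f) \<in> Q"
      using Q_class_eq_iff[OF A.subset_polys[OF f(1)] A.subset_polys[OF r(1)[OF f(2)]]] r(3)[OF f(2)] by simp
    then have "F_part f = F_part (r (Q_class N f))"
      using F_part_Q F_part_diff by (metis eq_iff_diff_eq_0)
    with f show "f \<in> {f \<in> An. F_part f \<in> V.span ?T}"
      by (auto intro!: V.span_base)
  qed
  moreover have "An \<subseteq> lift_gens G"
    using generated_submodule_eq_carrier_iff[OF carrier] gen by simp
  ultimately have part: "F_part f \<in> V.span ?T" if "f \<in> An" for f using that by blast
  have F_span: "F ` \<FF> \<subseteq> V.span ?T"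
  proof safe
    fix U assume U: "U \<in> \<FF>"
    have "const (inverse fct) * F_part (F U) \<in> V.span ?T"
      using part[OF F_Ann[OF U]] by (rule V.span_scale)
    moreover have "const (inverse fct) * F_part (F U) = F U"
      unfolding F_part_F[OF U] mult.assoc[symmetric] const_mult[symmetric]
      using fct_neq_0 by (simp del: of_nat_fact)
    ultimately show "F U \<in> V.span ?T" by simp
  qed
  obtain B where B: "B \<subseteq> ?T" "V.independent B" "?T \<subseteq> V.span B"
    by (rule V.maximal_independent_subset)
  have span: "V.span B = V.span (F ` \<FF>)"
  proof (rule subset_antisym)
    show "V.span B \<subseteq> V.span (F ` \<FF>)"
      using B(1) T_span by (intro V.span_minimal V.subspace_span) blast
    have "V.span ?T \<subseteq> V.span B" using B(3) by (intro V.span_minimal V.subspace_span)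
    with F_span show "V.span (F ` \<FF>) \<subseteq> V.span B" by (intro V.span_minimal V.subspace_span) blast
  qed
  have "finite B"
    using V.independent_span_bound[OF _ B(2), of "F ` \<FF>"] B(1) T_span finite_F_index by blast
  have "card B = card (F ` \<FF>)"
    using V.dim_eq_card[OF span B(2)] V.dim_eq_card_independent[OF independent_F] by simp
  then have card_B: "card B = card \<FF>" by (simp add: card_image inj_on_F)
  \<comment> \<open>One class is kept for each basis vector. Once \<open>H\<close> is seen to
    generate, minimality forces \<open>H = G\<close>, so \<open>G\<close> has as many elements as
    \<open>B\<close>.\<close>
  obtain H where H: "H \<subseteq> G" "inj_on (\<lambda>A. F_part (r A)) H" "B = (\<lambda>A. F_part (r A)) ` H"
    using B(1) unfolding subset_image_inj by blast
  interpret L: sym_ideal "lift_gens H" N by (rule sym_ideal_lift_gens)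
  have "F_part (r A) \<in> lift_gens H" if A: "A \<in> H" for A
  proof -
    have AG: "A \<in> G" using A H(1) by blast
    obtain d where d: "homogeneous d (r A)" using r(2)[OF AG] by blast
    have "r A \<in> lift_gens H" using lift_gens_mem(2)[OF r(1)[OF AG]] r(3)[OF AG] A by simp
    \<comment> \<open>The representative is homogeneous, so its component of degree p - 1 is either
      the representative itself or 0.\<close>
    then have "const fct * hom_part (p - 1) (r A) \<in> lift_gens H"
      unfolding hom_part_homogeneous[OF d] by auto
    then have "const fct * hom_part (p - 1) (r A) -
        (const fct * hom_part (p - 1) (r A) - F_part (r A)) \<in> lift_gens H"
      using subsetD[OF lift_gens_mem(1) hom_part_Ann[OF r(1)[OF AG]]] by (rule L.diff_mem)
    then show ?thesis by simp
  qed
  then have "V.span B \<subseteq> lift_gens H"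
    unfolding H(3) by (intro V.span_minimal V.subspaceI) auto
  then have "F ` \<FF> \<subseteq> lift_gens H"
    unfolding span using V.span_superset by blast
  then have "An \<subseteq> lift_gens H"
    by (intro Ann_subset_if_F_subset sym_ideal_lift_gens lift_gens_mem(1))
  then have "generated_submodule (sym_poly_ring N) M H = carrier M"
    using generated_submodule_eq_carrier_iff H(1) carrier by blast
  with minimal H(1) have "H = G" by blast
  moreover have "finite H" "card H = card B"
    using \<open>finite B\<close> H(2,3) by (auto simp: finite_image_iff card_image)
  ultimately show ?thesis using card_B by simp
qed


subsection \<open>Generators of the annihilator\<close>

definition gen_deg :: "'k spoly \<Rightarrow> nat" where
  "gen_deg h = (if h \<in> Q_gens N then 2 else p - 1)"

lemma homogeneous_gens: "h \<in> gens \<Longrightarrow> homogeneous (gen_deg h) h"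
  using homogeneous_F_minor by (auto simp: gen_deg_def Q_gens_homogeneous)

lemma F_notin_Q: "U \<in> \<FF> \<Longrightarrow> F U \<notin> Q"
  using F_coeff_Q[OF two, of "F U" N p U] fct_neq_0 by (auto simp: F_coeff_F_minor simp del: of_nat_fact)

text \<open>For p - 1 \<ge> 4 a quadric in \<open>Ann\<close> can only involve the generators of
  \<open>Q\<close>. Generation by quadrics therefore forces \<open>Ann\<close> into
  \<open>Q\<close>, which fails as soon as some \<open>F_U\<close> exists.\<close>

lemma generated_by_quadrics_iff:
  assumes "p \<ge> 5"
  shows "generated_by_quadrics N An \<longleftrightarrow> N < 2 * p - 2"
proof
  assume "N < 2 * p - 2"
  then have "card \<FF> = 0" using card_F_index by simp
  then have "\<FF> = {}" using finite_F_index by simp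
  then have "An = genideal (sym_poly_ring N) (Q_gens N)" using Ann_eq_genideal by simp
  then show "generated_by_quadrics N An"
    unfolding generated_by_quadrics_def
    by (intro exI[of _ "Q_gens N"] conjI subsetI CollectI Q_gens_homogeneous subsetD[OF Q_gens_subset])
next
  assume "generated_by_quadrics N An"
  then obtain G where G: "G \<subseteq> {f \<in> polys N. homogeneous 2 f}" "An = genideal (sym_poly_ring N) G"
    by (auto simp: generated_by_quadrics_def)
  have Gs: "G \<subseteq> polys N" using G(1) by blast
  have "G \<subseteq> Q"
  proof
    fix g assume g: "g \<in> G"
    have "g \<in> An" unfolding G(2) using sym_poly.genideal_self[OF Gs] g by (rule subsetD)
    moreover have g2: "homogeneous 2 g" using G(1) g by blast
    ultimately have "g \<in> genideal (sym_poly_ring N) {h \<in> gens. gen_deg h \<le> 2}"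
      unfolding Ann_eq_genideal
      by (intro homogeneous_genideal[OF gens_polys _ _ g2] homogeneous_gens)
    moreover have "{h \<in> gens. gen_deg h \<le> 2} \<subseteq> Q_gens N"
      using assms by (auto simp: gen_deg_def split: if_splits)
    then have "genideal (sym_poly_ring N) {h \<in> gens. gen_deg h \<le> 2} \<subseteq> Q"
      unfolding Q_ideal_def by (rule genideal_mono_polys[OF _ Q_gens_subset])
    ultimately show "g \<in> Q" by blast
  qed
  then have "An \<subseteq> Q" unfolding G(2) by (rule sym_poly.genideal_minimal[OF Q.is_ideal])
  then have "\<FF> = {}" using F_notin_Q F_Ann by blast
  then have "N choose (2 * p - 2) = 0" using card_F_index by simp
  then show "N < 2 * p - 2" by (simp add: binomial_eq_0_iff)
qed

text \<open>A generator \<open>g\<close> of any other degree lies in the ideal of those known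
  generators whose degree is smaller than its own. For degree reasons these are obtained from
  members of \<open>G\<close> other than \<open>g\<close>, so \<open>g\<close> could be
  omitted.\<close>

lemma minimal_generator_degree:
  assumes min: "minimal_homogeneous_ideal_gens N An G" and g: "g \<in> G"
  shows "homogeneous 2 g \<or> homogeneous (p - 1) g"
proof (rule ccontr)
  assume "\<not> (homogeneous 2 g \<or> homogeneous (p - 1) g)"
  then have not2: "\<not> homogeneous 2 g" and notp: "\<not> homogeneous (p - 1) g" by auto
  have G: "G \<subseteq> polys N" "\<And>h. h \<in> G \<Longrightarrow> \<exists>d. homogeneous d h" "genideal (sym_poly_ring N) G = An"
    and minimal: "genideal (sym_poly_ring N) (G - {g}) \<noteq> An"
    using min g by (auto simp: minimal_homogeneous_ideal_gens_def)
  obtain dg where dg: "\<And>h. h \<in> G \<Longrightarrow> homogeneous (dg h) h"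
    using G(2) by metis
  let ?J = "genideal (sym_poly_ring N) (G - {g})"
  have Jid: "ideal ?J (sym_poly_ring N)" using G(1) by (intro sym_poly.genideal_ideal) auto
  have small: "h \<in> ?J" if h: "h \<in> gens" "gen_deg h < dg g" for h
  proof -
    have "h \<in> genideal (sym_poly_ring N) G" using h gens_Ann G(3) by blast
    then have "h \<in> genideal (sym_poly_ring N) {h' \<in> G. dg h' \<le> gen_deg h}"
      by (rule homogeneous_genideal[OF G(1) _ _ homogeneous_gens[OF h(1)], rotated]) (rule dg)
    also have "\<dots> \<subseteq> ?J" using h(2) G(1) by (intro genideal_mono_polys) auto
    finally show ?thesis .
  qed
  have "g \<in> An" unfolding G(3)[symmetric] using sym_poly.genideal_self[OF G(1)] g by (rule subsetD)
  then have "g \<in> genideal (sym_poly_ring N) gens" unfolding Ann_eq_genideal .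
  then have "g \<in> genideal (sym_poly_ring N) {h \<in> gens. gen_deg h \<le> dg g}"
    by (rule homogeneous_genideal[OF gens_polys _ _ dg[OF g], rotated]) (rule homogeneous_gens)
  also have "\<dots> \<subseteq> ?J"
  proof (rule sym_poly.genideal_minimal[OF Jid], safe)
    fix h assume "h \<in> Q_gens N" "gen_deg h \<le> dg g"
    moreover have "dg g \<noteq> gen_deg h" using dg[OF g] not2 \<open>h \<in> Q_gens N\<close> by (auto simp: gen_deg_def)
    ultimately show "h \<in> ?J" by (intro small) auto
  next
    fix U assume "U \<in> \<FF>" "gen_deg (F U) \<le> dg g"
    moreover have "dg g \<noteq> gen_deg (F U)" using dg[OF g] not2 notp by (auto simp: gen_deg_def)
    ultimately show "F U \<in> ?J" by (intro small) auto
  qed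
  finally have "g \<in> ?J" .
  then have "G \<subseteq> ?J" using sym_poly.genideal_self[of "G - {g}" N] G(1) by blast
  then have "An \<subseteq> ?J" unfolding G(3)[symmetric] by (rule sym_poly.genideal_minimal[OF Jid])
  moreover have "?J \<subseteq> An" unfolding G(3)[symmetric] using G(1) by (intro genideal_mono_polys) auto
  ultimately show False using minimal by blast
qed

lemma generated_by_quadrics_char_3: "p = 3 \<Longrightarrow> generated_by_quadrics N An"
  unfolding generated_by_quadrics_def
proof (intro exI[of _ gens] conjI Ann_eq_genideal subsetI CollectI)
  assume "p = 3"
  fix h assume h: "h \<in> gens"
  then show "h \<in> polys N" using gens_polys by blast
  have "gen_deg h = 2" unfolding gen_deg_def using \<open>p = 3\<close> by simp
  with homogeneous_gens[OF h] show "homogeneous 2 h" by simp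
qed

end

theorem theorem1p1:
  fixes N :: nat
  assumes "N \<ge> 1"
  shows
    "(\<forall>p. CHAR('k::field) = p \<and> odd p \<longrightarrow>
        (Ann N :: 'k spoly set) =
          Q_ideal N <+>\<^bsub>sym_poly_ring N\<^esub> genideal (sym_poly_ring N) (F_minor p ` F_index N p) \<and>
        K_basis_family (Ann_mod_Q N :: ('k spoly, 'k spoly set) module)
          (Ann_mod_Q_component N (p - 1)) (F_index N p) (\<lambda>U. Q_class N (F_minor p U)) \<and>
        minimally_generates (sym_poly_ring N)
          (Ann_mod_Q N :: ('k spoly, 'k spoly set) module)
          ((\<lambda>U. Q_class N (F_minor p U)) ` F_index N p) \<and>
        card ((\<lambda>U. Q_class N (F_minor p U :: 'k spoly)) ` F_index N p) = N choose (2 * p - 2) \<and>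
        (\<forall>G \<subseteq> (\<Union>d. Ann_mod_Q_component N d).
           minimally_generates (sym_poly_ring N)
             (Ann_mod_Q N :: ('k spoly, 'k spoly set) module) G \<longrightarrow>
           finite G \<and> card G = N choose (2 * p - 2)) \<and>
        (p \<ge> 5 \<longrightarrow>
           (generated_by_quadrics N (Ann N :: 'k spoly set) \<longleftrightarrow> N < 2 * p - 2) \<and>
           (\<forall>G. minimal_homogeneous_ideal_gens N (Ann N :: 'k spoly set) G \<longrightarrow>
              (\<forall>g\<in>G. homogeneous 2 g \<or> homogeneous (p - 1) g))) \<and>
        (p = 3 \<longrightarrow> generated_by_quadrics N (Ann N :: 'k spoly set))) \<and>
     (CHAR('k) = 0 \<longrightarrow> (Ann N :: 'k spoly set) = Q_ideal N)"
proof (intro conjI[of "\<forall>p. _ p"] allI impI)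
  fix p assume p: "CHAR('k) = p \<and> odd p"
  then have "p \<noteq> 0" by (intro notI) simp
  then have "prime p" using p prime_CHAR_semidom[where ?'a = 'k] by auto
  then have "p > 2" using p prime_ge_2_nat[of p] by (cases "p = 2") auto
  with p interpret odd_char N p "TYPE('k)" by unfold_locales auto
  show "An = Q <+>\<^bsub>sym_poly_ring N\<^esub> genideal (sym_poly_ring N) (F ` \<FF>) \<and>
      K_basis_family M (Ann_mod_Q_component N (p - 1)) \<FF> (\<lambda>U. Q_class N (F U)) \<and>
      minimally_generates (sym_poly_ring N) M ((\<lambda>U. Q_class N (F U)) ` \<FF>) \<and>
      card ((\<lambda>U. Q_class N (F U)) ` \<FF>) = N choose (2 * p - 2) \<and>
      (\<forall>G \<subseteq> (\<Union>d. Ann_mod_Q_component N d). minimally_generates (sym_poly_ring N) M G \<longrightarrow>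
         finite G \<and> card G = N choose (2 * p - 2)) \<and>
      (p \<ge> 5 \<longrightarrow> (generated_by_quadrics N An \<longleftrightarrow> N < 2 * p - 2) \<and>
         (\<forall>G. minimal_homogeneous_ideal_gens N An G \<longrightarrow> (\<forall>g\<in>G. homogeneous 2 g \<or> homogeneous (p - 1) g))) \<and>
      (p = 3 \<longrightarrow> generated_by_quadrics N An)"
  proof (intro conjI allI impI ballI)
    show "card ((\<lambda>U. Q_class N (F U)) ` \<FF>) = N choose (2 * p - 2)"
      by (simp add: card_image inj_on_Q_class_F card_F_index)
    show "finite G" "card G = N choose (2 * p - 2)"
      if "G \<subseteq> (\<Union>d. Ann_mod_Q_component N d)" "minimally_generates (sym_poly_ring N) M G" for G
      using card_minimal_generators[OF that] card_F_index by auto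
    show "homogeneous 2 g \<or> homogeneous (p - 1) g" if "minimal_homogeneous_ideal_gens N An G" "g \<in> G" for G g
      using that by (rule minimal_generator_degree)
  qed (rule Ann_eq_sum K_basis minimally_generates_F generated_by_quadrics_iff generated_by_quadrics_char_3; assumption?)+
next
  assume "CHAR('k) = 0"
  then have two: "(2::'k) \<noteq> 0"
    using of_nat_eq_0_iff_char_dvd[of 2, where ?'a = 'k] by auto
  \<comment> \<open>Here \<open>P\<close> is \<open>Q\<close> itself, the condition on the minors
    being vacuous in characteristic 0.\<close>
  have "Ann N \<subseteq> (Q_ideal N :: 'k spoly set)"
    by (rule Ann_subset[OF sym_ideal_Q subset_refl Q_subset_Ann[OF two] two]) (simp add: \<open>CHAR('k) = 0\<close>)
  then show "(Ann N :: 'k spoly set) = Q_ideal N"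
    using Q_subset_Ann[OF two] by (rule subset_antisym)
qed

end
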